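(* Let $q$ be a prime power, let $k\ge3$ and $n$ be integers, and assume that either $q\ge3$ and $n\ge2k+1$, or $q\ge2$ and $n\ge2k+2$. Let $V$ be an $n$-dimensional vector space over $\mathbb{F}_q$. If $\mathcal{F}\subseteq\mathrm{Gr}_k(V)$ is a nontrivial intersecting family, then $$\sigma_{k,q}(\mathcal{F})\le\binom{k}{1}_q\left(\binom{n-2}{k-2}_q-q^{k(k-2)}\binom{n-k-2}{k-2}_q\right).$$ Moreover, equality holds if and only if one of the following occurs: (i) for some subspaces $X<M\le V$ with $\dim X=1$ and $\dim M=k+1$, $\mathcal{F}=\mathcal{H}_1^\circ(X,M)\cup\mathcal{G}$, where $\mathcal{G}\subseteq\mathrm{Gr}_k(M)$ and at least one member of $\mathcal{G}$ does not contain $X$; (ii) $k=3$ and, for some $3$-dimensional subspace $Z$ of $V$, $\mathcal{F}=\mathcal{H}_3(Z)$ or $\mathcal{F}=\mathcal{H}_3(Z)\setminus\{Z\}$.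
   Context: $\binom{a}{b}_q=\prod_{i=0}^{b-1}\frac{q^{a-i}-1}{q^{b-i}-1}$ is the Gaussian coefficient, with $\binom{a}{b}_q=0$ if $b<0$ or $b>a$. $\mathrm{Gr}_k(V)$ is the set of all $k$-dimensional subspaces of $V$; the elements of $\mathrm{Gr}_1(V)$ are called points. A family $\mathcal{F}\subseteq\mathrm{Gr}_k(V)$ is intersecting if $\dim(F\cap F')\ge1$ for all $F,F'\in\mathcal{F}$; it is trivial if all its members contain a common $1$-subspace, and nontrivial otherwise. For a point $x$, $d_{\mathcal{F}}(x)=|\{F\in\mathcal{F}:x\le F\}|$; for $S\in\mathrm{Gr}_k(V)$, $d_{\mathcal{F}}(S)=\sum_{x\in\mathrm{Gr}_1(S)}d_{\mathcal{F}}(x)$. For $\mathcal{F}\ne\mathrm{Gr}_k(V)$ the projective Ore-degree is $\sigma_{k,q}(\mathcal{F})=\min\{d_{\mathcal{F}}(S):S\in\mathrm{Gr}_k(V)\setminus\mathcal{F}\}$. For $X<M\le V$ with $\dim X=1$, $\dim M=k+1$: $\mathcal{H}_1^\circ(X,M)=\{F\in\mathrm{Gr}_k(V): X\le F,\ \dim(F\cap M)\ge2,\ F\nleq M\}$. For $k=3$ and a $3$-subspace $Z$ of $V$: $\mathcal{H}_3(Z)=\{F\in\mathrm{Gr}_3(V):\dim(F\cap Z)\ge2\}$. *)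

theory Defs
  imports Complex_Main "HOL-Number_Theory.Prime_Powers"
begin

(* The case b < 0 of the usual convention is vacuous for natural numbers.
   For b <= a and i < b all exponents are genuine (untruncated) differences. *)
definition gauss_binomial :: "nat \<Rightarrow> nat \<Rightarrow> nat \<Rightarrow> real" where
  "gauss_binomial q a b =
     (if b > a then 0
      else (\<Prod>i<b. (real q ^ (a - i) - 1) / (real q ^ (b - i) - 1)))"

(* The ambient space V is UNIV :: 'v set with scalar multiplication scale.  The definitions take
   scale explicitly instead of living in the locale vector_space, whose global interpretation for
   real vector spaces would capture their unqualified names. *)
type_synonym ('f, 'v) scaling = "'f \<Rightarrow> 'v \<Rightarrow> 'v"

definition Gr :: "('f::field, 'v::ab_group_add) scaling \<Rightarrow> nat \<Rightarrow> 'v set \<Rightarrow> 'v set set" where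
  "Gr scale k W = {S. module.subspace scale S \<and> S \<subseteq> W \<and> vector_space.dim scale S = k}"

definition intersecting :: "('f::field, 'v::ab_group_add) scaling \<Rightarrow> 'v set set \<Rightarrow> bool" where
  "intersecting scale \<F> \<longleftrightarrow> (\<forall>F\<in>\<F>. \<forall>F'\<in>\<F>. vector_space.dim scale (F \<inter> F') \<ge> 1)"

definition trivial_family :: "('f::field, 'v::ab_group_add) scaling \<Rightarrow> 'v set set \<Rightarrow> bool" where
  "trivial_family scale \<F> \<longleftrightarrow> (\<exists>x\<in>Gr scale 1 UNIV. \<forall>F\<in>\<F>. x \<subseteq> F)"

definition point_degree :: "'v set set \<Rightarrow> 'v set \<Rightarrow> nat" where
  "point_degree \<F> x = card {F \<in> \<F>. x \<subseteq> F}"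

definition subspace_degree ::
  "('f::field, 'v::ab_group_add) scaling \<Rightarrow> 'v set set \<Rightarrow> 'v set \<Rightarrow> nat" where
  "subspace_degree scale \<F> S = (\<Sum>x\<in>Gr scale 1 S. point_degree \<F> x)"

(* Meaningful only if Gr scale k UNIV is finite and not contained in the family. *)
definition ore_degree ::
  "('f::field, 'v::ab_group_add) scaling \<Rightarrow> nat \<Rightarrow> 'v set set \<Rightarrow> nat" where
  "ore_degree scale k \<F> = Min {subspace_degree scale \<F> S | S. S \<in> Gr scale k UNIV - \<F>}"

definition H1_open ::
  "('f::field, 'v::ab_group_add) scaling \<Rightarrow> nat \<Rightarrow> 'v set \<Rightarrow> 'v set \<Rightarrow> 'v set set" where
  "H1_open scale k X M =
     {F \<in> Gr scale k UNIV. X \<subseteq> F \<and> vector_space.dim scale (F \<inter> M) \<ge> 2 \<and> \<not> F \<subseteq> M}"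

definition H3 :: "('f::field, 'v::ab_group_add) scaling \<Rightarrow> 'v set \<Rightarrow> 'v set set" where
  "H3 scale Z = {F \<in> Gr scale 3 UNIV. vector_space.dim scale (F \<inter> Z) \<ge> 2}"

end

theory Submission
  imports Defs
begin

text \<open>
  If $T$ is a subspace of dimension at most $k$ (a cover) that meets every member of the family,
  then no $k$-subspace $S$ with $S \cap T = 0$ is a member, and the average of the degree of $S$
  over these $S$ is $[k]_q$ times the average degree of the points outside $T$. So it suffices to
  find a cover for which the latter average is smaller than the bracket in the bound.

  Passing to a larger family only increases all degrees, so the family may be taken maximal; then
  any two small covers meet. If the covers of dimension two have no common point, they span a
  three-space $Z$ and the family consists of all $F$ with $\dim (F \cap Z) \ge 2$. If they pass
  through a point $X$, let $M$ be their span: for $\dim M = k + 1$ the family is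
  of the first extremal type, and for smaller $M$ the members meeting $M$ only in $X$ are few
  because each of their lines through $X$ is missed by some member. If there is only one such cover,
  or none, repeated branching (a member that contains $A$ meets each member missing $A$) bounds the size
  of the whole family; here it is essential to treat separately the members that contain a cover of
  minimal dimension and those that do not.
  Planes ($k = 3$) without a two-dimensional cover need another argument: either every line lies in
  at most $q + 1$ members, or all members missing some line lie in one five-space.

  In the two extremal families every point outside $M$ (respectively $Z$) has exactly the critical degree and every
  point has at least that degree. A missing member not contained in $M$ (respectively $Z$) lowers the
  degree of a point outside, which accounts for all subfamilies attaining the bound.
\<close>

section \<open>Gaussian coefficients and subspace counts\<close>

text \<open>Estimates are measured in units of \<open>K * g 3\<close>: by \<open>bd_ge\<close> the
  bracket loses at most the factor 1 - c/2 against it. A member meets the cover, so at most K - 1 of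
  its points lie outside, and it adds at most c/K to the mean degree there. Hence R members can be
  charged c R / K by mere counting. For the members through a two-dimensional cover this costs c * g
  2 / K, which by \<open>g_step\<close> is at least their degree bound g 3 at a single outside
  point. This is why, near two-dimensional covers, the family is split into a part charged pointwise
  and a counted remainder, whereas for larger covers counting alone suffices. The hypotheses on q
  and n make c = q^(2k-n)/(q-1) at most 1/4 for q = 2 and at most 1/(q(q-1)) for q >= 3; the
  tightest numerical cases are q = 2 with c = 1/4 and q = 3 with c = 1/6.\<close>

definition qint :: "nat \<Rightarrow> nat \<Rightarrow> real" where
  "qint q m = (real q ^ m - 1) / (real q - 1)"

abbreviation (input) gauss :: "nat \<Rightarrow> nat \<Rightarrow> nat \<Rightarrow> real" where
  "gauss \<equiv> gauss_binomial"

lemma qint_0 [simp]: "qint q 0 = 0"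
  by (simp add: qint_def)

lemma qint_1: "q \<ge> 2 \<Longrightarrow> qint q (Suc 0) = 1"
  by (simp add: qint_def)

lemma qint_mult: "q \<ge> 2 \<Longrightarrow> qint q m * (real q - 1) = real q ^ m - 1"
  by (simp add: qint_def)

lemma qint_add: "q \<ge> 2 \<Longrightarrow> qint q (a + b) = qint q a + real q ^ a * qint q b"
  unfolding qint_def by (simp add: divide_simps power_add) (simp add: algebra_simps)

lemma qint_Suc: "q \<ge> 2 \<Longrightarrow> qint q (Suc m) = real q * qint q m + 1"
  using qint_add[of q 1 m] by (simp add: qint_1)

lemma qint_nonneg: "q \<ge> 2 \<Longrightarrow> qint q m \<ge> 0"
  by (simp add: qint_def)

lemma qint_mono: "q \<ge> 2 \<Longrightarrow> a \<le> b \<Longrightarrow> qint q a \<le> qint q b"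
  by (simp add: qint_def divide_right_mono)

lemma qint_pos: "q \<ge> 2 \<Longrightarrow> m > 0 \<Longrightarrow> qint q m > 0"
  by (simp add: qint_def)

lemma gauss_0 [simp]: "gauss q a 0 = 1"
  by (simp add: gauss_binomial_def)

lemma gauss_1: "gauss q a 1 = qint q a"
  by (simp add: gauss_binomial_def qint_def lessThan_Suc)

lemma gauss_nonneg: "q \<ge> 2 \<Longrightarrow> gauss q a b \<ge> 0"
  unfolding gauss_binomial_def by (auto intro!: prod_nonneg divide_nonneg_nonneg)

lemma gauss_pos: "q \<ge> 2 \<Longrightarrow> b \<le> a \<Longrightarrow> gauss q a b > 0"
  unfolding gauss_binomial_def by (auto intro!: prod_pos divide_pos_pos one_less_power)

lemma power_diff_neq_1: "q \<ge> 2 \<Longrightarrow> i < a \<Longrightarrow> real q ^ (a - i) \<noteq> 1"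
  by (metis of_nat_1_eq_iff one_less_power less_irrefl of_nat_less_iff of_nat_1 less_le_trans
      one_less_numeral_iff semiring_norm(76) zero_less_diff)

lemma gauss_same: "q \<ge> 2 \<Longrightarrow> gauss q a a = 1"
  unfolding gauss_binomial_def by (auto intro!: prod.neutral simp: power_diff_neq_1)

lemma gauss_Suc_Suc:
  assumes "q \<ge> 2"
  shows "gauss q (Suc a) (Suc b) * qint q (Suc b) = qint q (Suc a) * gauss q a b"
proof (cases "b \<le> a")
  case True
  have "qint q (Suc b) \<noteq> 0" using qint_pos[OF assms, of "Suc b"] by simp
  moreover have "gauss q (Suc a) (Suc b)
      = qint q (Suc a) / qint q (Suc b) * gauss q a b"
    using True assms unfolding gauss_binomial_def qint_def
    by (subst prod.lessThan_Suc_shift) simp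
  ultimately show ?thesis by simp
next
  case False then show ?thesis by (simp add: gauss_binomial_def)
qed

lemma gauss_Suc:
  assumes q: "q \<ge> 2" and b: "b \<le> a"
  shows "gauss q a (Suc b) * qint q (Suc b) = gauss q a b * qint q (a - b)"
proof (cases "b < a")
  case True
  define D where "D m = (\<Prod>i<m. real q ^ (m - i) - 1)" for m
  define P where "P m = (\<Prod>i<m. real q ^ (a - i) - 1)" for m
  have D: "D (Suc b) = (real q ^ Suc b - 1) * D b"
    unfolding D_def by (subst prod.lessThan_Suc_shift) simp
  have P: "P (Suc b) = P b * (real q ^ (a - b) - 1)"
    unfolding P_def by simp
  have D0: "D m \<noteq> 0" for m
    unfolding D_def using q by (simp add: power_diff_neq_1)
  have "gauss q a (Suc b) = P (Suc b) / D (Suc b)" "gauss q a b = P b / D b"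
    using True b unfolding gauss_binomial_def P_def D_def by (auto simp: prod_dividef)
  moreover have "real q ^ Suc b - 1 \<noteq> 0"
    using one_less_power[of "real q" "Suc b"] q by simp
  moreover have "real q - 1 \<noteq> 0" using q by simp
  ultimately show ?thesis
    using D0[of b] unfolding D P qint_def by (simp del: power_Suc)
next
  case False
  then show ?thesis using b by (simp add: gauss_binomial_def)
qed

lemma gauss_pascal:
  assumes q: "q \<ge> 2" and b: "b \<le> a"
  shows "gauss q (Suc a) (Suc b)
    = real q ^ Suc b * gauss q a (Suc b) + gauss q a b"
proof -
  have p: "qint q (Suc b) > 0" using qint_pos[OF q] by simp
  have s: "qint q (Suc a) = qint q (Suc b) + real q ^ Suc b * qint q (a - b)"
    using qint_add[OF q, of "Suc b" "a - b"] b by simp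
  have "gauss q (Suc a) (Suc b) * qint q (Suc b)
      = (real q ^ Suc b * gauss q a (Suc b) + gauss q a b) * qint q (Suc b)"
    using gauss_Suc_Suc[OF q, of a b] gauss_Suc[OF q b] unfolding s
    by (simp add: algebra_simps)
  with p show ?thesis by simp
qed

text \<open>Shifts the upper index; \<open>bd_ge\<close> needs it for the ratio of consecutive
  terms. For b = a + 1 both sides vanish.\<close>

lemma gauss_pred:
  assumes q: "q \<ge> 2" and b: "b \<le> Suc a"
  shows "gauss q a b * qint q (Suc a) = gauss q (Suc a) b * qint q (Suc a - b)"
proof (cases b)
  case 0
  then show ?thesis by simp
next
  case (Suc c)
  then have c: "c \<le> a" using b by simp
  have p: "qint q (Suc c) > 0" using qint_pos[OF q] by simp
  have "gauss q a (Suc c) * qint q (Suc a) * qint q (Suc c)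
      = gauss q (Suc a) (Suc c) * qint q (a - c) * qint q (Suc c)"
    using gauss_Suc_Suc[OF q, of a c] gauss_Suc[OF q c] by (simp add: algebra_simps)
  with p show ?thesis by (simp add: Suc)
qed

locale finite_vector_space = vector_space scale
  for scale :: "'f::{field,finite} \<Rightarrow> 'v::ab_group_add \<Rightarrow> 'v" +
  fixes q :: nat
  assumes finite_UNIV_v: "finite (UNIV :: 'v set)"
    and card_field: "card (UNIV :: 'f set) = q"
begin

text \<open>The locale \<open>finite_dimensional_vector_space\<close> has a basis as parameter, so
  one is fixed by choice in order to interpret it.\<close>

definition some_basis :: "'v set" where
  "some_basis = (SOME B. independent B \<and> span B = UNIV)"

lemma some_basis: "independent some_basis \<and> span some_basis = UNIV"
  unfolding some_basis_def
proof (rule someI_ex)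
  show "\<exists>B. independent B \<and> span B = UNIV"
    using maximal_independent_subset[of UNIV] by (metis top.extremum_uniqueI)
qed

lemma fin [simp, intro]: "finite (A :: 'v set)"
  using finite_UNIV_v by (rule finite_subset[OF subset_UNIV])

lemma fin2 [simp, intro]: "finite (A :: 'v set set)"
proof -
  have "finite (Pow (UNIV :: 'v set))" using finite_UNIV_v by (simp only: finite_Pow_iff)
  then show ?thesis by (rule finite_subset[rotated]) simp
qed

sublocale finite_dimensional_vector_space scale some_basis
  by unfold_locales (use some_basis in auto)

lemma q_ge_2: "q \<ge> 2"
proof -
  have "card {0, 1 :: 'f} \<le> q" unfolding card_field[symmetric] by (rule card_mono) auto
  then show ?thesis by simp
qed

lemma card_span_independent:
  "finite B \<Longrightarrow> independent B \<Longrightarrow> card (span B) = q ^ card B"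
proof (induction B rule: finite_induct)
  case empty
  then show ?case by simp
next
  case (insert b B)
  have b: "b \<notin> span B" and B: "independent B"
    using insert.prems insert.hyps independent_insert by auto
  have "bij_betw (\<lambda>(c, x). scale c b + x) (UNIV \<times> span B) (span (insert b B))"
  proof (rule bij_betw_imageI)
    show "inj_on (\<lambda>(c, x). scale c b + x) (UNIV \<times> span B)"
    proof (rule inj_onI)
      fix u w :: "'f \<times> 'v"
      obtain c x d y where uw: "u = (c, x)" "w = (d, y)" by (metis surj_pair)
      assume "u \<in> UNIV \<times> span B" "w \<in> UNIV \<times> span B"
        and e: "(\<lambda>(c, x). scale c b + x) u = (\<lambda>(c, x). scale c b + x) w"
      then have x: "x \<in> span B" and y: "y \<in> span B" using uw by auto
      have "scale c b + x = scale d b + y" using e uw by simp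
      then have "scale c b = scale d b + y - x" by (simp add: eq_diff_eq)
      then have sc: "scale (c - d) b = y - x"
        unfolding scale_left_diff_distrib by simp
      then have s: "scale (c - d) b \<in> span B" using span_diff[OF y x] by simp
      have "c - d = 0"
      proof (rule ccontr)
        assume "c - d \<noteq> 0"
        then have "scale (inverse (c - d)) (scale (c - d) b) = b" by simp
        with span_scale[OF s, of "inverse (c - d)"] b show False by simp
      qed
      then show "u = w" using sc uw by simp
    qed
    show "(\<lambda>(c, x). scale c b + x) ` (UNIV \<times> span B) = span (insert b B)"
    proof (intro set_eqI iffI)
      fix v assume "v \<in> (\<lambda>(c, x). scale c b + x) ` (UNIV \<times> span B)"
      then obtain c x where "x \<in> span B" "v = scale c b + x" by auto
      then show "v \<in> span (insert b B)"
        unfolding span_breakdown_eq[of v] by (intro exI[of _ c]) simp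
    next
      fix v assume "v \<in> span (insert b B)"
      then obtain c where "v - scale c b \<in> span B" unfolding span_breakdown_eq[of v] by auto
      then show "v \<in> (\<lambda>(c, x). scale c b + x) ` (UNIV \<times> span B)"
        by (intro image_eqI[of _ _ "(c, v - scale c b)"]) auto
    qed
  qed
  then have "card (span (insert b B)) = q * card (span B)"
    by (metis bij_betw_same_card card_cartesian_product card_field)
  then show ?case using insert B by simp
qed

lemma card_subspace: "subspace S \<Longrightarrow> card S = q ^ dim S"
  by (metis basis_subspace_exists card_span_independent)

section \<open>Joins, the modular law and points\<close>

abbreviation join :: "'v set \<Rightarrow> 'v set \<Rightarrow> 'v set" (infixl "\<squnion>" 65) where
  "A \<squnion> B \<equiv> span (A \<union> B)"

lemma span_id [simp]: "subspace S \<Longrightarrow> span S = S"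
  by simp

declare span_eq_iff [simp del]

lemma join_ub: "A \<subseteq> A \<squnion> B" "B \<subseteq> A \<squnion> B"
  using span_superset[of "A \<union> B"] by auto

lemma join_least: "A \<subseteq> C \<Longrightarrow> B \<subseteq> C \<Longrightarrow> subspace C \<Longrightarrow> A \<squnion> B \<subseteq> C"
  by (rule span_minimal) auto

lemma join_sum: "subspace A \<Longrightarrow> subspace B \<Longrightarrow> A \<squnion> B = {x + y |x y. x \<in> A \<and> y \<in> B}"
  using span_Un[of A B] by (simp only: span_id)

lemma dim_join: "subspace A \<Longrightarrow> subspace B \<Longrightarrow> dim (A \<squnion> B) + dim (A \<inter> B) = dim A + dim B"
  using dim_sums_Int[of A B] join_sum[of A B] by (simp only:)

text \<open>Dedekind's law. With A a point or a two-space it identifies the intersection of a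
  subspace with a join.\<close>

lemma modular:
  assumes "subspace A" "subspace B" "subspace C" "A \<subseteq> C"
  shows "(A \<squnion> B) \<inter> C = A \<squnion> (B \<inter> C)"
proof
  show "(A \<squnion> B) \<inter> C \<subseteq> A \<squnion> (B \<inter> C)"
  proof
    fix v assume "v \<in> (A \<squnion> B) \<inter> C"
    then obtain x y where v: "v = x + y" "x \<in> A" "y \<in> B" "v \<in> C"
      using join_sum[OF assms(1,2)] by blast
    then have "y \<in> C" using subspace_diff[OF assms(3), of v x] assms(4) by auto
    then have "x \<in> A \<squnion> (B \<inter> C)" "y \<in> A \<squnion> (B \<inter> C)"
      using v by (simp_all add: span_base)
    then show "v \<in> A \<squnion> (B \<inter> C)" unfolding v(1) by (rule span_add)
  qed
  show "A \<squnion> (B \<inter> C) \<subseteq> (A \<squnion> B) \<inter> C"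
  proof (rule join_least)
    show "A \<subseteq> (A \<squnion> B) \<inter> C" using assms join_ub(1)[of A B] by blast
    show "B \<inter> C \<subseteq> (A \<squnion> B) \<inter> C" using join_ub(2)[of B A] by blast
    show "subspace ((A \<squnion> B) \<inter> C)" using assms by (intro subspace_inter subspace_span)
  qed
qed

lemma dim_Int_pos: "subspace A \<Longrightarrow> subspace B \<Longrightarrow> dim (A \<inter> B) \<ge> 1 \<longleftrightarrow> A \<inter> B \<noteq> {0}"
proof -
  assume AB: "subspace A" "subspace B"
  have "dim (A \<inter> B) \<ge> 1 \<longleftrightarrow> \<not> A \<inter> B \<subseteq> {0}"
    using dim_eq_0[of "A \<inter> B"] by linarith
  also have "\<dots> \<longleftrightarrow> A \<inter> B \<noteq> {0}"
    using subspace_0[OF AB(1)] subspace_0[OF AB(2)] by blast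
  finally show ?thesis .
qed

lemma subspace_eqI: "subspace S \<Longrightarrow> subspace T \<Longrightarrow> S \<subseteq> T \<Longrightarrow> dim T \<le> dim S \<Longrightarrow> S = T"
  using subspace_dim_equal by blast

definition pts :: "'v set \<Rightarrow> 'v set set" where
  "pts S = Gr scale 1 S"

lemma pts_iff: "x \<in> pts S \<longleftrightarrow> subspace x \<and> x \<subseteq> S \<and> dim x = 1"
  by (simp add: pts_def Gr_def)

lemma Gr_iff: "F \<in> Gr scale k W \<longleftrightarrow> subspace F \<and> F \<subseteq> W \<and> dim F = k"
  by (simp add: Gr_def)

lemma point_span: "v \<noteq> 0 \<Longrightarrow> v \<in> S \<Longrightarrow> subspace S \<Longrightarrow> span {v} \<in> pts S"
  unfolding pts_iff by (simp add: span_minimal)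

lemma exists_point: "subspace S \<Longrightarrow> S \<noteq> {0} \<Longrightarrow> \<exists>x. x \<in> pts S"
proof -
  assume S: "subspace S" "S \<noteq> {0}"
  then obtain v where "v \<in> S" "v \<noteq> 0" using subspace_0 by blast
  then show ?thesis using point_span S by blast
qed

lemma point_Int:
  assumes "x \<in> pts UNIV" "subspace S"
  shows "x \<inter> S = (if x \<subseteq> S then x else {0})"
proof (cases "x \<subseteq> S")
  case False
  have s: "subspace (x \<inter> S)" using assms by (auto simp: pts_iff intro: subspace_inter)
  have "dim (x \<inter> S) < 1"
  proof (rule ccontr)
    assume "\<not> ?thesis"
    then have "1 \<le> dim (x \<inter> S)" by linarith
    then have "dim x \<le> dim (x \<inter> S)" using assms(1) unfolding pts_iff by metis
    then have "x \<inter> S = x" using s assms by (intro subspace_eqI) (auto simp: pts_iff)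
    with False show False by auto
  qed
  then have "dim (x \<inter> S) = 0" by linarith
  then have "x \<inter> S \<subseteq> {0}" by (simp only: dim_eq_0)
  with False subspace_0[OF s] show ?thesis by auto
qed auto

lemma point_nonzero: "x \<in> pts S \<Longrightarrow> x \<noteq> {0}"
  using dim_eq_0[of x] by (auto simp: pts_iff)

lemma point_eq: "x \<in> pts A \<Longrightarrow> y \<in> pts B \<Longrightarrow> x \<subseteq> y \<Longrightarrow> x = y"
  by (rule subspace_eqI) (auto simp: pts_iff)

lemma dim_join_point:
  assumes "x \<in> pts UNIV" "subspace S" "\<not> x \<subseteq> S"
  shows "dim (S \<squnion> x) = Suc (dim S)"
proof -
  have "S \<inter> x = {0}" using point_Int[OF assms(1,2)] assms(3) by auto
  then show ?thesis using dim_join[of S x] assms by (simp add: pts_iff)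
qed

lemma ptsD: "x \<in> pts S \<Longrightarrow> x \<in> pts UNIV" "x \<in> pts S \<Longrightarrow> subspace x" "x \<in> pts S \<Longrightarrow> x \<subseteq> S"
  "x \<in> pts S \<Longrightarrow> dim x = 1"
  by (auto simp: pts_iff)

section \<open>Counting subspaces with a prescribed intersection\<close>

definition between :: "'v set \<Rightarrow> 'v set \<Rightarrow> 'v set \<Rightarrow> nat \<Rightarrow> 'v set set" where
  "between L Y W k = {F. subspace F \<and> L \<subseteq> F \<and> F \<subseteq> W \<and> dim F = k \<and> F \<inter> Y = L}"

text \<open>Double counting of the pairs (v, F) with v in F outside Y. Adjoining v to both L and Y
  leads to the same problem with m one smaller, because F then meets the enlarged Y in exactly the
  enlarged L.\<close>

lemma card_between_prod:
  assumes "subspace L" "subspace Y" "subspace W" "L \<subseteq> Y" "Y \<subseteq> W" "dim L + m = k"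
  shows "real (card (between L Y W k))
    = (\<Prod>i<m. (real q ^ dim W - real q ^ (dim Y + i)) / (real q ^ k - real q ^ (dim L + i)))"
  using assms
proof (induction m arbitrary: L Y)
  case 0
  have "between L Y W k = {L}"
  proof (intro set_eqI iffI)
    fix F assume "F \<in> between L Y W k"
    then have "F = L" using 0 subspace_eqI[of L F] by (auto simp: between_def)
    then show "F \<in> {L}" by simp
  next
    fix F assume "F \<in> {L}"
    then show "F \<in> between L Y W k" using 0 by (auto simp: between_def)
  qed
  then show ?case by simp
next
  case (Suc m)
  let ?N = "between L Y W k"
  have eq: "v \<in> F \<and> v \<notin> Y \<and> F \<in> ?N \<longleftrightarrow>
      v \<in> W - Y \<and> F \<in> between (L \<squnion> {v}) (Y \<squnion> {v}) W k" for v F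
  proof
    assume h: "v \<in> F \<and> v \<notin> Y \<and> F \<in> ?N"
    then have F: "subspace F" "L \<subseteq> F" "F \<subseteq> W" "dim F = k" "F \<inter> Y = L" by (auto simp: between_def)
    have "L \<squnion> {v} \<subseteq> F" using F h by (intro join_least) auto
    moreover have "F \<inter> (Y \<squnion> {v}) = L \<squnion> {v}"
    proof
      show "L \<squnion> {v} \<subseteq> F \<inter> (Y \<squnion> {v})"
        using F h \<open>L \<squnion> {v} \<subseteq> F\<close> Suc.prems by (auto intro: span_mono[THEN subsetD, rotated])
      show "F \<inter> (Y \<squnion> {v}) \<subseteq> L \<squnion> {v}"
      proof
        fix w assume w: "w \<in> F \<inter> (Y \<squnion> {v})"
        then obtain c where c: "w - scale c v \<in> span Y" using span_breakdown_eq[of w v Y] by auto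
        then have "w - scale c v \<in> F \<inter> Y"
          using w h subspace_diff[OF F(1) _ subspace_scale[OF F(1), of v c]]
            span_id[OF Suc.prems(2)] by simp
        then have "w - scale c v \<in> L" using F by simp
        then show "w \<in> L \<squnion> {v}"
          using span_breakdown_eq[of w v L] by (auto intro: span_base)
      qed
    qed
    ultimately show "v \<in> W - Y \<and> F \<in> between (L \<squnion> {v}) (Y \<squnion> {v}) W k"
      using F h by (auto simp: between_def)
  next
    assume h: "v \<in> W - Y \<and> F \<in> between (L \<squnion> {v}) (Y \<squnion> {v}) W k"
    then have F: "subspace F" "L \<squnion> {v} \<subseteq> F" "F \<subseteq> W" "dim F = k" "F \<inter> (Y \<squnion> {v}) = L \<squnion> {v}"
      by (auto simp: between_def)
    have L: "L \<subseteq> F" "v \<in> F" using F(2) join_ub(1)[of L "{v}"] span_base[of v "L \<union> {v}"] by blast+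
    have "F \<inter> Y \<subseteq> L"
    proof
      fix w assume w: "w \<in> F \<inter> Y"
      then have "w \<in> L \<squnion> {v}" using F(5) join_ub(1)[of Y "{v}"] by blast
      then obtain c where c: "w - scale c v \<in> span L" using span_breakdown_eq[of w v L] by auto
      then have c': "w - scale c v \<in> L" using span_id[OF Suc.prems(1)] by simp
      have "scale c v \<in> Y"
        using subspace_diff[of Y w "w - scale c v"] w c' Suc.prems by auto
      have "c = 0"
      proof (rule ccontr)
        assume "c \<noteq> 0"
        then have "scale (inverse c) (scale c v) = v" by simp
        then have "v \<in> Y"
          using subspace_scale[of Y "scale c v" "inverse c"] \<open>scale c v \<in> Y\<close> Suc.prems by simp
        then show False using h by simp
      qed
      then show "w \<in> L" using c' by simp
    qed
    then show "v \<in> F \<and> v \<notin> Y \<and> F \<in> ?N" using F L h Suc.prems by (auto simp: between_def)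
  qed
  have dL: "dim L \<le> dim Y" using Suc.prems dim_subset by auto
  have cardF: "card {v\<in>F. v \<notin> Y} = q ^ k - q ^ dim L" if "F \<in> ?N" for F
  proof -
    have F: "subspace F" "dim F = k" "F \<inter> Y = L" using that by (auto simp: between_def)
    have "{v\<in>F. v \<notin> Y} = F - L" using F by auto
    then show ?thesis using F Suc.prems by (auto simp: card_Diff_subset card_subspace)
  qed
  have IH: "real (card (between (L \<squnion> {v}) (Y \<squnion> {v}) W k)) =
     (\<Prod>i<m. (real q ^ dim W - real q ^ (dim Y + Suc i)) / (real q ^ k - real q ^ (dim L + Suc i)))"
    if v: "v \<in> W - Y" for v
  proof -
    have dY: "dim (Y \<squnion> {v}) = Suc (dim Y)"
      using v span_id[OF Suc.prems(2)] by (simp add: dim_insert)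
    have dL: "dim (L \<squnion> {v}) = Suc (dim L)"
      using v span_id[OF Suc.prems(1)] Suc.prems(4) by (auto simp: dim_insert)
    have "L \<squnion> {v} \<subseteq> Y \<squnion> {v}" using Suc.prems by (intro span_mono) auto
    moreover have "Y \<squnion> {v} \<subseteq> W" using v Suc.prems by (intro join_least) auto
    ultimately have "real (card (between (L \<squnion> {v}) (Y \<squnion> {v}) W k)) =
     (\<Prod>i<m. (real q ^ dim W - real q ^ (dim (Y \<squnion> {v}) + i))
        / (real q ^ k - real q ^ (dim (L \<squnion> {v}) + i)))"
      using Suc.prems dL by (intro Suc.IH) auto
    then show ?thesis unfolding dY dL by simp
  qed
  have dk: "dim L < k" using Suc.prems by simp
  have "card ?N * (q ^ k - q ^ dim L) = (\<Sum>F\<in>?N. card {v\<in>F. v \<notin> Y})"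
    using cardF by simp
  also have "\<dots> = card (SIGMA F:?N. {v\<in>F. v \<notin> Y})"
    by simp
  also have "\<dots> = card (SIGMA v:W - Y. between (L \<squnion> {v}) (Y \<squnion> {v}) W k)"
  proof (rule bij_betw_same_card[of prod.swap], rule bij_betw_imageI)
    show "prod.swap ` (SIGMA F:?N. {v\<in>F. v \<notin> Y}) = (SIGMA v:W - Y. between (L \<squnion> {v}) (Y \<squnion> {v}) W k)"
    proof (intro set_eqI iffI)
      fix p assume "p \<in> prod.swap ` (SIGMA F:?N. {v\<in>F. v \<notin> Y})"
      then obtain F v where "p = (v, F)" "F \<in> ?N" "v \<in> F" "v \<notin> Y" by auto
      then show "p \<in> (SIGMA v:W - Y. between (L \<squnion> {v}) (Y \<squnion> {v}) W k)"
        using eq[of v F] by simp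
    next
      fix p assume "p \<in> (SIGMA v:W - Y. between (L \<squnion> {v}) (Y \<squnion> {v}) W k)"
      then obtain v F where p: "p = (v, F)" "v \<in> W - Y" "F \<in> between (L \<squnion> {v}) (Y \<squnion> {v}) W k"
        by auto
      then have "v \<in> F \<and> v \<notin> Y \<and> F \<in> ?N" using eq[of v F] by simp
      then show "p \<in> prod.swap ` (SIGMA F:?N. {v\<in>F. v \<notin> Y})"
        using p by (intro image_eqI[of _ _ "(F, v)"]) auto
    qed
  qed simp
  also have "\<dots> = (\<Sum>v\<in>W - Y. card (between (L \<squnion> {v}) (Y \<squnion> {v}) W k))"
    by simp
  finally have "real (card ?N * (q ^ k - q ^ dim L))
      = (\<Sum>v\<in>W - Y. real (card (between (L \<squnion> {v}) (Y \<squnion> {v}) W k)))"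
    by simp
  also have "\<dots> = (\<Sum>v\<in>W - Y.
     (\<Prod>i<m. (real q ^ dim W - real q ^ (dim Y + Suc i)) / (real q ^ k - real q ^ (dim L + Suc i))))"
    by (rule sum.cong) (use IH in auto)
  also have "\<dots> = real (card (W - Y)) *
     (\<Prod>i<m. (real q ^ dim W - real q ^ (dim Y + Suc i)) / (real q ^ k - real q ^ (dim L + Suc i)))"
    by simp
  also have "real (card (W - Y)) = real q ^ dim W - real q ^ dim Y"
    using Suc.prems dim_subset[of Y W] q_ge_2
    by (simp add: card_Diff_subset card_subspace of_nat_diff power_increasing)
  finally have fin: "real (card ?N) * (real q ^ k - real q ^ dim L) = (real q ^ dim W - real q ^ dim Y) *
     (\<Prod>i<m. (real q ^ dim W - real q ^ (dim Y + Suc i)) / (real q ^ k - real q ^ (dim L + Suc i)))"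
    using dk q_ge_2 by (simp add: of_nat_diff power_increasing)
  have pos: "real q ^ k - real q ^ dim L > 0"
    using dk q_ge_2 by (simp add: power_strict_increasing)
  show ?case
    using fin pos by (subst prod.lessThan_Suc_shift) (simp add: field_simps)
qed

lemma card_between:
  assumes "subspace L" "subspace Y" "subspace W" "L \<subseteq> Y" "Y \<subseteq> W" "dim L \<le> k"
  shows "real (card (between L Y W k))
    = real q ^ ((dim Y - dim L) * (k - dim L)) * gauss q (dim W - dim Y) (k - dim L)"
proof -
  define m where "m = k - dim L"
  have k: "dim L + m = k" using assms by (simp add: m_def)
  have LY: "dim L \<le> dim Y" and YW: "dim Y \<le> dim W" using assms dim_subset by auto
  have eq: "real (card (between L Y W k))
    = (\<Prod>i<m. (real q ^ dim W - real q ^ (dim Y + i)) / (real q ^ k - real q ^ (dim L + i)))"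
    by (rule card_between_prod) (use assms k in auto)
  show ?thesis
  proof (cases "m \<le> dim W - dim Y")
    case True
    have "(real q ^ dim W - real q ^ (dim Y + i)) / (real q ^ k - real q ^ (dim L + i))
       = real q ^ (dim Y - dim L) * ((real q ^ (dim W - dim Y - i) - 1) / (real q ^ (m - i) - 1))"
      if "i < m" for i
    proof -
      have "real q ^ dim W = real q ^ (dim L + i) * real q ^ (dim Y - dim L) * real q ^ (dim W - dim Y - i)"
        "real q ^ (dim Y + i) = real q ^ (dim L + i) * real q ^ (dim Y - dim L)"
        "real q ^ k = real q ^ (dim L + i) * real q ^ (m - i)"
        using that True LY YW k unfolding power_add[symmetric] by (auto intro: arg_cong)
      moreover have "real q ^ (dim L + i) \<noteq> 0" using q_ge_2 by simp
      moreover have div: "(a * b * r - a * b) / (a * s - a) = b * ((r - 1) / (s - 1))"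
        if "a \<noteq> 0" for a b r s :: real
      proof -
        have "a * b * r - a * b = a * (b * (r - 1))" "a * s - a = a * (s - 1)"
          by (simp_all add: algebra_simps)
        with that show ?thesis by simp
      qed
      ultimately show ?thesis by (simp only: div not_False_eq_True)
    qed
    then have "real (card (between L Y W k))
      = (\<Prod>i<m. real q ^ (dim Y - dim L) * ((real q ^ (dim W - dim Y - i) - 1) / (real q ^ (m - i) - 1)))"
      unfolding eq by (intro prod.cong) auto
    also have "\<dots> = real q ^ ((dim Y - dim L) * m) * gauss q (dim W - dim Y) m"
      unfolding gauss_binomial_def using True
      by (simp add: power_mult prod.distrib flip: times_divide_eq_right)
    finally show ?thesis by (simp add: m_def)
  next
    case False
    \<comment> \<open>There is no room for F outside Y: the factor with index dim W - dim Y is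
      zero.\<close>
    have "real (card (between L Y W k)) = 0"
      unfolding eq using False YW by (intro prod_zero bexI[of _ "dim W - dim Y"]) auto
    then show ?thesis using False by (simp add: m_def gauss_binomial_def)
  qed
qed

lemma card_supersets:
  assumes "subspace L" "subspace W" "L \<subseteq> W" "dim L \<le> k"
  shows "real (card {F \<in> Gr scale k W. L \<subseteq> F}) = gauss q (dim W - dim L) (k - dim L)"
proof -
  have "{F \<in> Gr scale k W. L \<subseteq> F} = between L L W k"
    by (auto simp: between_def Gr_iff)
  then show ?thesis using card_between[of L L W k] assms by simp
qed

lemma card_Gr: "subspace W \<Longrightarrow> real (card (Gr scale k W)) = gauss q (dim W) k"
proof -
  assume W: "subspace W"
  have "{F \<in> Gr scale k W. {0} \<subseteq> F} = Gr scale k W"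
    by (auto simp: Gr_iff subspace_0)
  then show ?thesis using card_supersets[of "{0}" W k] W subspace_0[OF W] by simp
qed

lemma card_pts: "subspace W \<Longrightarrow> real (card (pts W)) = qint q (dim W)"
  unfolding pts_def by (simp add: card_Gr gauss_1 flip: One_nat_def)

text \<open>S is sought among the k-spaces that meet the join of A and T exactly in A; by
  \<open>card_between\<close> their number is positive as soon as k + dim T is at most dim
  V.\<close>

lemma exists_complementary:
  assumes "subspace A" "subspace T" "A \<inter> T = {0}" "dim A \<le> k" "k + dim T \<le> dim (UNIV :: 'v set)"
  obtains S where "S \<in> Gr scale k UNIV" "A \<subseteq> S" "S \<inter> T = {0}"
proof -
  have d: "dim (A \<squnion> T) = dim A + dim T" using dim_join[of A T] assms by simp
  have "real (card (between A (A \<squnion> T) UNIV k)) > 0"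
    using assms d q_ge_2
    by (subst card_between) (auto simp: join_ub simp del: dim_UNIV intro!: mult_pos_pos gauss_pos)
  then have "between A (A \<squnion> T) UNIV k \<noteq> {}" by auto
  then obtain S where "S \<in> between A (A \<squnion> T) UNIV k" by blast
  then have S: "subspace S" "A \<subseteq> S" "dim S = k" "S \<inter> (A \<squnion> T) = A" by (auto simp: between_def)
  have "S \<inter> T = {0}"
  proof -
    have "S \<inter> T \<subseteq> A \<inter> T" using S(4) join_ub[of T] by (auto intro: span_base)
    then show ?thesis using assms S subspace_0 by blast
  qed
  then show ?thesis using that S by (auto simp: Gr_iff)
qed

end

section \<open>Numerical estimates\<close>

locale erdos_params =
  fixes q k n :: nat
  assumes k_ge_3: "k \<ge> 3"
    and qn: "(q \<ge> 3 \<and> n \<ge> 2 * k + 1) \<or> (q \<ge> 2 \<and> n \<ge> 2 * k + 2)"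
begin

abbreviation Q :: real where "Q \<equiv> real q"
abbreviation K :: real where "K \<equiv> qint q k"
text \<open>The number of k-spaces through a fixed l-space of V, for l at most k.\<close>

definition g :: "nat \<Rightarrow> real" where "g l = gauss q (n - l) (k - l)"
text \<open>
  The cost of one branching step: trading the supersets of an \<open>l\<close>-space for \<open>K\<close> choices of a
  further point multiplies the bound by at most \<open>c\<close>, see \<open>g_step\<close>.
\<close>

definition c :: real where "c = Q ^ (2 * k) / (Q ^ n * (Q - 1))"
text \<open>The degree of a point x outside M in the first extremal family: the k-spaces through the
  two-space x + X, less those that meet the (k+2)-space x + M in that two-space only.\<close>

definition bd :: real where
  "bd = gauss q (n - 2) (k - 2) - Q ^ (k * (k - 2)) * gauss q (n - k - 2) (k - 2)"

section \<open>The constant \<open>c\<close> and small q-integers\<close>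

lemma q2: "q \<ge> 2" using qn by auto

lemma n_ge: "n \<ge> 2 * k + 1" using qn by auto

lemma c_pos: "c > 0"
  unfolding c_def using q2 by simp

lemma c_eq: "c * (Q - 1) * Q ^ n = Q ^ (2 * k)"
  unfolding c_def using q2 by simp

text \<open>The two alternatives of the hypothesis on q and n meet here. For q = 2 the factor q - 1
  in the denominator gives nothing, and the additional dimension brings c from 1/2 down to
  1/4.\<close>

lemma c_cases: "(Q = 2 \<and> c \<le> 1/4) \<or> (Q \<ge> 3 \<and> c * (Q * (Q - 1)) \<le> 1)"
proof (cases "q \<ge> 3")
  case True
  have "Q ^ (2 * k) * Q \<le> Q ^ n"
    using n_ge q2 power_increasing[of "2 * k + 1" n Q] by (simp add: mult.commute)
  then have "c * (Q * (Q - 1)) * Q ^ n \<le> 1 * Q ^ n"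
    using c_eq by (simp add: mult.commute mult.left_commute)
  then have "c * (Q * (Q - 1)) \<le> 1"
    using q2 by (subst (asm) mult_le_cancel_right) auto
  with True show ?thesis by simp
next
  case False
  then have q: "q = 2" "n \<ge> 2 * k + 2" using qn by auto
  have Q: "Q = 2" using q by simp
  have "Q ^ (2 * k) * 4 \<le> Q ^ n"
    using q power_increasing[of "2 * k + 2" n Q] by simp
  moreover have "c * Q ^ n = Q ^ (2 * k)"
    using c_eq unfolding Q by simp
  ultimately have "c * 4 * Q ^ n \<le> 1 * Q ^ n" by linarith
  then have "c * 4 \<le> 1" using q2 by (subst (asm) mult_le_cancel_right) auto
  then have "c \<le> 1/4" by linarith
  with Q show ?thesis by blast
qed

lemma c_le_quarter: "c \<le> 1/4"
  using c_cases
proof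
  assume "Q \<ge> 3 \<and> c * (Q * (Q - 1)) \<le> 1"
  then have "c * 6 \<le> c * (Q * (Q - 1))" "c * (Q * (Q - 1)) \<le> 1"
    using c_pos mult_mono[of 3 Q 2 "Q - 1"] by auto
  then show ?thesis by simp
qed (rule conjunct2)

lemma c_le_sixth: "Q \<ge> 3 \<Longrightarrow> c \<le> 1/6"
proof -
  assume q3: "Q \<ge> 3"
  then have "c * 6 \<le> c * (Q * (Q - 1))" "c * (Q * (Q - 1)) \<le> 1"
    using c_pos mult_mono[of 3 Q 2 "Q - 1"] c_cases by auto
  then show ?thesis by simp
qed

text \<open>For q >= 3 this replaces c by 1/(q(q-1)), so that a bound on c x becomes a polynomial
  inequality in q.\<close>

lemma c_ratio:
  assumes "Q \<ge> 3" "x \<le> r * Q^2 - r * Q" "r \<ge> 0"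
  shows "c * x \<le> r"
proof -
  have "c * x \<le> r * (c * (Q * (Q - 1)))"
    using mult_left_mono[OF assms(2), of c] c_pos by (simp add: algebra_simps power2_eq_square)
  also have "\<dots> \<le> r * 1" using assms c_cases by (intro mult_left_mono) auto
  finally show ?thesis by simp
qed

lemma Q_sq: "Q \<ge> 3 \<Longrightarrow> 3 * Q \<le> Q^2"
  by (simp add: power2_eq_square)

text \<open>The constants from here to \<open>c3_qint_4\<close> are the values at q = 3, c = 1/6 or
  at q = 2, c = 1/4, or slight roundings of them.\<close>

lemma c_Q1': "Q \<ge> 3 \<Longrightarrow> c * (Q + 1) \<le> 2/3"
  using Q_sq by (intro c_ratio) auto

lemma c_Q1: "c * (Q + 1) \<le> 3/4"
  using c_cases c_Q1' by fastforce

lemma qint_2: "qint q 2 = Q + 1"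
  using qint_Suc[OF q2, of 1] qint_1[OF q2] by (simp add: numeral_2_eq_2)

lemma qint_3: "qint q 3 = Q^2 + Q + 1"
  using qint_Suc[OF q2, of 2] qint_2 by (simp add: eval_nat_numeral algebra_simps)

lemma qint_4: "qint q 4 = (Q + 1) * (Q^2 + 1)"
  using qint_Suc[OF q2, of 3] qint_3 by (simp add: eval_nat_numeral algebra_simps)

lemma K_ge_3: "K \<ge> Q^2 + Q + 1"
  using qint_mono[OF q2 k_ge_3] qint_3 by simp

lemma Q2: "Q \<ge> 2" using q2 by simp

lemma K_ge_7: "K \<ge> 7"
proof -
  have "Q^2 \<ge> 4" using power_mono[OF Q2, of 2] by simp
  then show ?thesis using K_ge_3 Q2 by simp
qed

lemma c_qint_3: "Q \<ge> 3 \<Longrightarrow> c * qint q 3 \<le> 13/6"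
  unfolding qint_3 using Q_sq by (intro c_ratio) auto

lemma c2_qint_3: "c * (c * qint q 3) \<le> 7/16"
  using c_cases
proof
  assume h: "Q = 2 \<and> c \<le> 1/4"
  have "c * c \<le> 1/4 * (1/4)" using c_le_quarter c_pos by (intro mult_mono) auto
  moreover have "qint q 3 = 7" using h unfolding qint_3 by simp
  ultimately show ?thesis by simp
next
  assume h: "Q \<ge> 3 \<and> c * (Q * (Q - 1)) \<le> 1"
  have "c * (c * qint q 3) \<le> 1/6 * (13/6)"
    using h c_le_sixth c_qint_3 c_pos qint_nonneg[OF q2, of 3] by (intro mult_mono) auto
  then show ?thesis by simp
qed

text \<open>The cases stay apart because the second bound exceeds 1; it is always combined with the
  sharper estimates that q >= 3 allows.\<close>

lemma c2_qint_4: "(Q = 2 \<and> c * (c * qint q 4) \<le> 15/16) \<or> (Q \<ge> 3 \<and> c * (c * qint q 4) \<le> 10/9)"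
  using c_cases
proof
  assume h: "Q = 2 \<and> c \<le> 1/4"
  have "c * c \<le> 1/4 * (1/4)" using c_le_quarter c_pos by (intro mult_mono) auto
  moreover have "qint q 4 = 15" using h unfolding qint_4 by simp
  ultimately have "c * (c * qint q 4) \<le> 15/16" by simp
  then show ?thesis using h by blast
next
  assume h: "Q \<ge> 3 \<and> c * (Q * (Q - 1)) \<le> 1"
  have "c * (Q^2 + 1) \<le> 10/6"
    using h Q_sq by (intro c_ratio) auto
  then have "(c * (Q + 1)) * (c * (Q^2 + 1)) \<le> 2/3 * (10/6)"
    using h c_Q1' c_pos by (intro mult_mono) auto
  then have "c * (c * qint q 4) \<le> 10/9" unfolding qint_4 by (simp add: mult_ac)
  then show ?thesis using h by simp
qed

lemma c3_qint_4: "c * (c * (c * qint q 4)) \<le> 1/4"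
  using c2_qint_4
proof
  assume h: "Q = 2 \<and> c * (c * qint q 4) \<le> 15/16"
  then have "c * (c * (c * qint q 4)) \<le> 1/4 * (15/16)"
    using c_le_quarter c_pos qint_nonneg[OF q2, of 4] by (intro mult_mono) auto
  then show ?thesis by simp
next
  assume h: "Q \<ge> 3 \<and> c * (c * qint q 4) \<le> 10/9"
  then have "c * (c * (c * qint q 4)) \<le> 1/6 * (10/9)"
    using c_le_sixth c_pos qint_nonneg[OF q2, of 4] by (intro mult_mono) auto
  then show ?thesis by simp
qed

section \<open>Superset counts and the bracket in units of \<open>g 3\<close>\<close>

lemma qint_prod_le:
  assumes "l \<le> k"
  shows "K * qint q (k - l) \<le> c * qint q (n - l)"
proof -
  have p: "0 < Q - 1" using q2 by simp
  have n: "n - 2 * k + (2 * k - l) = n - l" "k + (k - l) = 2 * k - l" using assms n_ge by auto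
  have cq: "c * (Q - 1) * Q ^ (n - 2 * k) = 1"
  proof -
    have "Q ^ n = Q ^ (n - 2 * k) * Q ^ (2 * k)" using n_ge by (simp flip: power_add)
    then have "c * (Q - 1) * Q ^ (n - 2 * k) * Q ^ (2 * k) = 1 * Q ^ (2 * k)"
      using c_eq by (simp add: mult_ac)
    then show ?thesis using q2 by (metis mult_cancel_right power_not_zero of_nat_0_eq_iff
        not_numeral_le_zero)
  qed
  have "(Q ^ k - 1) * (Q ^ (k - l) - 1) \<le> Q ^ (2 * k - l) - Q ^ k"
  proof -
    have "(Q ^ k - 1) * (Q ^ (k - l) - 1) = Q ^ (2 * k - l) - Q ^ k - (Q ^ (k - l) - 1)"
      unfolding n(2)[symmetric] power_add by (simp add: algebra_simps)
    then show ?thesis using q2 by simp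
  qed
  then have "Q ^ (n - 2 * k) * ((Q ^ k - 1) * (Q ^ (k - l) - 1)) \<le> Q ^ (n - 2 * k) * (Q ^ (2 * k - l) - Q ^ k)"
    using q2 by (intro mult_left_mono) auto
  also have "\<dots> \<le> Q ^ (n - l) - 1"
  proof -
    have "1 \<le> Q ^ (n - 2 * k) * Q ^ k" using q2 by (simp flip: power_add)
    then show ?thesis unfolding n(1)[symmetric] power_add by (simp add: algebra_simps)
  qed
  finally have "c * (Q - 1) * (Q ^ (n - 2 * k) * ((Q ^ k - 1) * (Q ^ (k - l) - 1)))
      \<le> c * (Q - 1) * (Q ^ (n - l) - 1)"
    using c_pos p by (intro mult_left_mono) auto
  then have "(Q ^ k - 1) * (Q ^ (k - l) - 1) \<le> c * (Q - 1) * (Q ^ (n - l) - 1)"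
    using cq by (simp only: mult.assoc[symmetric])
  then have "K * qint q (k - l) * (Q - 1)^2 \<le> c * qint q (n - l) * (Q - 1)^2"
    unfolding qint_mult[OF q2, symmetric] by (simp add: power2_eq_square mult_ac)
  then show ?thesis by (rule mult_right_le_imp_le) (use p in simp)
qed

text \<open>Consecutive counts have the ratio \<open>g (Suc l)\<close> : \<open>g l\<close> = [k-l]
  : [n-l], so this is \<open>qint_prod_le\<close>. It explains \<open>c\<close>: up to lower order
  terms, K [k-l] / [n-l] equals q^(2k-n)/(q-1) whatever l is.\<close>

lemma g_step: "l < k \<Longrightarrow> K * g (Suc l) \<le> c * g l"
proof -
  assume l: "l < k"
  then have s: "n - l = Suc (n - Suc l)" "k - l = Suc (k - Suc l)" using n_ge by auto
  have pos: "qint q (n - l) > 0" using l n_ge by (intro qint_pos[OF q2]) auto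
  have e: "g l * qint q (k - l) = qint q (n - l) * g (Suc l)"
    unfolding g_def s using gauss_Suc_Suc[OF q2] by simp
  have "K * g (Suc l) * qint q (n - l) = g l * (K * qint q (k - l))"
    using e by (simp add: mult_ac)
  also have "\<dots> \<le> g l * (c * qint q (n - l))"
    using l qint_prod_le[of l] gauss_nonneg[OF q2] by (intro mult_left_mono) (auto simp: g_def)
  finally have "K * g (Suc l) * qint q (n - l) \<le> c * g l * qint q (n - l)" by (simp add: mult_ac)
  with pos show ?thesis by simp
qed

lemma g_pos: "l \<le> k \<Longrightarrow> g l > 0"
  unfolding g_def using n_ge by (intro gauss_pos[OF q2]) auto

lemma g_nonneg: "g l \<ge> 0"
  unfolding g_def by (rule gauss_nonneg[OF q2])

text \<open>The price of one member in the averaging argument: at most K - 1 of its points avoid the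
  cover, while at least [n] - K points of V do. So it adds at most c/K to the mean degree
  outside.\<close>

lemma weight_le: "(K - 1) * K \<le> c * (qint q n - K)"
proof -
  obtain m where m: "k = Suc m" using k_ge_3 by (cases k) auto
  have "K - 1 = Q * qint q (k - 1)" using qint_Suc[OF q2, of m] m by simp
  moreover have "qint q n - K = Q ^ k * qint q (n - k)"
    using qint_add[OF q2, of k "n - k"] n_ge by simp
  moreover have "Q * qint q (k - 1) * K \<le> c * (Q ^ k * qint q (n - k))"
  proof -
    have p: "0 < Q - 1" using q2 by simp
    have "(Q ^ k - Q) * (Q ^ k - 1) * Q ^ n \<le> Q ^ (2 * k) * (Q ^ n - Q ^ k)"
    proof -
      have a: "Q ^ (2 * k) = Q ^ k * Q ^ k" by (simp add: mult_2 power_add)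
      have "Q ^ n \<ge> Q ^ (2 * k)" using n_ge q2 by (intro power_increasing) auto
      then have "Q ^ (2 * k) * Q ^ k \<le> Q ^ n * Q ^ k" using q2 by (intro mult_right_mono) auto
      moreover have "(Q ^ k - Q) * (Q ^ k - 1) \<le> Q ^ (2 * k) - Q ^ k"
        using q2 power_increasing[of 1 k Q] k_ge_3 unfolding a
        by (simp add: algebra_simps)
      then have "(Q ^ k - Q) * (Q ^ k - 1) * Q ^ n \<le> (Q ^ (2 * k) - Q ^ k) * Q ^ n"
        using q2 by (intro mult_right_mono) auto
      ultimately show ?thesis by (simp add: algebra_simps)
    qed
    also have "\<dots> = c * (Q - 1) * (Q ^ n - Q ^ k) * Q ^ n" using c_eq by (simp add: mult_ac)
    finally have "(Q ^ k - Q) * (Q ^ k - 1) \<le> c * (Q - 1) * (Q ^ n - Q ^ k)"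
      using q2 by (subst (asm) mult_le_cancel_right) auto
    moreover have "Q ^ k - Q = (Q - 1) * (Q * qint q (k - 1))"
    proof -
      have "Q ^ k - Q = Q * (qint q m * (Q - 1))" unfolding qint_mult[OF q2] m by (simp add: algebra_simps)
      then show ?thesis by (simp add: m mult_ac)
    qed
    moreover have "Q ^ n - Q ^ k = (Q - 1) * (Q ^ k * qint q (n - k))"
    proof -
      have "Q ^ n = Q ^ k * Q ^ (n - k)" using n_ge by (simp flip: power_add)
      then have "Q ^ n - Q ^ k = Q ^ k * (qint q (n - k) * (Q - 1))"
        unfolding qint_mult[OF q2] by (simp add: algebra_simps)
      then show ?thesis by (simp add: mult_ac)
    qed
    moreover have "Q ^ k - 1 = K * (Q - 1)" using qint_mult[OF q2, of k] by simp
    ultimately have "(Q * qint q (k - 1) * K) * ((Q - 1) * (Q - 1)) \<le> (c * (Q ^ k * qint q (n - k))) * ((Q - 1) * (Q - 1))"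
      by (simp add: mult_ac)
    then show ?thesis using p by (subst (asm) mult_le_cancel_right) auto
  qed
  ultimately show ?thesis by simp
qed


text \<open>
  Telescoping the q-Pascal rule writes the bracket in the bound as a sum of $k$ terms, the $i$-th of
  which is close to $q^i$ times the first one, which is \<open>g 3\<close>.
\<close>

lemma bd_ge: "bd \<ge> (1 - c / 2) * K * g 3"
proof -
  define j N where "j = k - 2" and "N = n - 2"
  \<comment> \<open>\<open>r i\<close> is what Pascal's rule splits off when the upper index drops
    from N - i to N - i - 1.\<close>
  define r where "r i = Q ^ (i * j) * gauss q (N - 1 - i) (j - 1)" for i
  \<comment> \<open>The relative error q^(k-n) of the approximation of \<open>r i\<close> by q^i
    \<open>r 0\<close>.\<close>
  define e where "e = Q ^ k / Q ^ n"
  have j: "Suc (j - 1) = j" and Nn: "N - k = n - k - 2" and jN: "j + k \<le> N - 1"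
    using k_ge_3 n_ge by (auto simp: j_def N_def)
  have bd_sum: "gauss q N j - Q ^ (i * j) * gauss q (N - i) j = (\<Sum>s<i. r s)"
    if "i \<le> k" for i
    using that
  proof (induction i)
    case 0
    then show ?case by simp
  next
    case (Suc i)
    have "gauss q (N - i) j = Q ^ j * gauss q (N - Suc i) j
        + gauss q (N - Suc i) (j - 1)"
      using gauss_pascal[OF q2, of "j - 1" "N - Suc i"] j jN Suc.prems
      by (simp add: Suc_diff_Suc)
    then have "Q ^ (i * j) * gauss q (N - i) j
        = Q ^ (Suc i * j) * gauss q (N - Suc i) j + r i"
      by (simp add: r_def algebra_simps power_add)
    then show ?case using Suc by simp
  qed
  have e_eq: "e * Q ^ N = Q ^ j"
  proof -
    have "Q ^ n = Q ^ N * Q ^ 2" "Q ^ k = Q ^ j * Q ^ 2"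
    proof -
      have "n = N + 2" "k = j + 2" using k_ge_3 n_ge by (auto simp: j_def N_def)
      then show "Q ^ n = Q ^ N * Q ^ 2" "Q ^ k = Q ^ j * Q ^ 2" by (simp_all only: power_add)
    qed
    then show ?thesis using q2 by (simp add: e_def)
  qed
  have e_pos: "e > 0" using q2 by (simp add: e_def)
  have r0: "r 0 = g 3" by (simp add: r_def g_def j_def N_def eval_nat_numeral)
  have p: "0 < Q - 1" using q2 by simp
  \<comment> \<open>The ratio of \<open>r (Suc i)\<close> to \<open>r i\<close> is at least q (1 - e
    q^i). The losses e q^s for s < i form a geometric sum below e q^i/(q-1).\<close>
  have r_ge: "r i \<ge> Q ^ i * g 3 * (1 - e * Q ^ i / (Q - 1))" if "i < k" for i
    using that
  proof (induction i)
    case 0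
    have "e / (Q - 1) \<ge> 0" using e_pos p by simp
    then show ?case using g_nonneg[of 3] by (simp add: r0 mult_left_le)
  next
    case (Suc i)
    define m where "m = N - Suc (Suc i)"
    have m: "N - 1 - i = Suc m" "N - 1 - Suc i = m" "j - 1 \<le> Suc m" "Suc m = N - Suc i"
      and m2: "Suc m - (j - 1) = N - i - j"
      using jN Suc.prems j by (auto simp: m_def)
    have pos: "Q ^ Suc m - 1 > 0" using q2 one_less_power[of Q "Suc m"] by simp
    have "gauss q m (j - 1) * qint q (Suc m)
        = gauss q (Suc m) (j - 1) * qint q (N - i - j)"
      using gauss_pred[OF q2 m(3)] m2 by simp
    then have "gauss q m (j - 1) * (Q ^ Suc m - 1)
        = gauss q (Suc m) (j - 1) * (Q ^ (N - i - j) - 1)"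
      using p unfolding qint_def by simp
    then have "r (Suc i) * (Q ^ Suc m - 1) = r i * (Q ^ j * (Q ^ (N - i - j) - 1))"
      unfolding r_def m(1,2) by (simp add: power_add mult_ac)
    also have "Q ^ j * (Q ^ (N - i - j) - 1) = Q * Q ^ Suc m - Q ^ j"
    proof -
      have "Q ^ j * Q ^ (N - i - j) = Q * Q ^ Suc m"
      proof -
        have "j + (N - i - j) = Suc (Suc m)" using jN Suc.prems by (auto simp: m_def)
        then show ?thesis by (metis power_add power_Suc)
      qed
      then show ?thesis by (simp add: algebra_simps)
    qed
    also have "\<dots> = Q * Q ^ Suc m * (1 - e * Q ^ i)"
    proof -
      have "Q ^ N = Q * Q ^ Suc m * Q ^ i"
      proof -
        have "N = Suc (Suc m) + i" using jN Suc.prems by (auto simp: m_def)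
        then show ?thesis by (metis power_add power_Suc)
      qed
      then show ?thesis using e_eq by (simp add: algebra_simps)
    qed
    finally have req: "r (Suc i) * (Q ^ Suc m - 1) = r i * (Q * Q ^ Suc m * (1 - e * Q ^ i))" .
    have e1: "1 - e * Q ^ i \<ge> 0"
    proof -
      have "j + i \<le> N" using jN Suc.prems by linarith
      then have "Q ^ j * Q ^ i \<le> Q ^ N"
        using q2 power_increasing[of "j + i" N Q] by (simp add: power_add)
      moreover have "e * Q ^ i * Q ^ N = Q ^ j * Q ^ i" unfolding e_eq[symmetric] by (simp only: mult_ac)
      ultimately have "e * Q ^ i * Q ^ N \<le> 1 * Q ^ N" by (simp only: mult_1)
      then show ?thesis using q2 by (subst (asm) mult_le_cancel_right) auto
    qed
    have ri: "r i \<ge> 0" unfolding r_def using gauss_nonneg[OF q2] by simp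
    have "r i * Q * (1 - e * Q ^ i) * (Q ^ Suc m - 1) \<le> r i * Q * (1 - e * Q ^ i) * Q ^ Suc m"
      using ri e1 by (intro mult_left_mono mult_nonneg_nonneg) auto
    also have "\<dots> = r (Suc i) * (Q ^ Suc m - 1)" using req by (simp add: mult_ac)
    finally have 1: "r i * Q * (1 - e * Q ^ i) \<le> r (Suc i)"
      using pos by (subst (asm) mult_le_cancel_right) auto
    have "Q ^ i * g 3 * (1 - e * Q ^ i / (Q - 1)) * Q * (1 - e * Q ^ i) \<le> r i * Q * (1 - e * Q ^ i)"
      using Suc e1 by (intro mult_right_mono) auto
    with 1 have 2: "Q ^ Suc i * g 3 * ((1 - e * Q ^ i / (Q - 1)) * (1 - e * Q ^ i)) \<le> r (Suc i)"
      by (simp add: mult_ac)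
    have "1 - e * Q ^ Suc i / (Q - 1) \<le> (1 - e * Q ^ i / (Q - 1)) * (1 - e * Q ^ i)"
    proof -
      have "(1 - e * Q ^ i / (Q - 1)) * (1 - e * Q ^ i)
         = 1 - e * Q ^ Suc i / (Q - 1) + (e * Q ^ i) * (e * Q ^ i) / (Q - 1)"
      proof -
        have "(1 - d / p) * (1 - d) = 1 - d * (p + 1) / p + d * d / p" if "p > 0" for d p :: real
          using that by (simp add: field_simps)
        from this[OF p, of "e * Q ^ i"] show ?thesis by (simp add: mult_ac)
      qed
      moreover have "(e * Q ^ i) * (e * Q ^ i) / (Q - 1) \<ge> 0" using p by simp
      ultimately show ?thesis by linarith
    qed
    then have "Q ^ Suc i * g 3 * (1 - e * Q ^ Suc i / (Q - 1))
       \<le> Q ^ Suc i * g 3 * ((1 - e * Q ^ i / (Q - 1)) * (1 - e * Q ^ i))"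
      using g_nonneg[of 3] by (intro mult_left_mono) auto
    with 2 show ?case by linarith
  qed
  have "(\<Sum>i<k. Q ^ i * g 3 * (1 - e * Q ^ i / (Q - 1))) \<le> (\<Sum>i<k. r i)"
    using r_ge by (intro sum_mono) auto
  also have "(\<Sum>i<k. r i) = bd"
    using bd_sum[of k] by (simp add: bd_def j_def N_def mult.commute diff_commute)
  finally have main: "(\<Sum>i<k. Q ^ i * g 3 * (1 - e * Q ^ i / (Q - 1))) \<le> bd" .
  have s1: "(\<Sum>i<k. Q ^ i) = K"
    using q2 geometric_sum[of Q k] by (simp add: qint_def)
  have s2: "(\<Sum>i<k. Q ^ i * Q ^ i) = K * (Q ^ k + 1) / (Q + 1)"
  proof -
    have ne: "Q * Q \<noteq> 1" using mult_mono[OF Q2 Q2] by auto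
    have "(\<Sum>i<k. Q ^ i * Q ^ i) = (\<Sum>i<k. (Q * Q) ^ i)" by (simp add: power_mult_distrib)
    also have "\<dots> = ((Q * Q) ^ k - 1) / (Q * Q - 1)" using geometric_sum[OF ne, of k] by simp
    also have "Q * Q - 1 = (Q - 1) * (Q + 1)" by (simp add: algebra_simps)
    also have "(Q * Q) ^ k - 1 = (Q ^ k - 1) * (Q ^ k + 1)" by (simp add: algebra_simps power_mult_distrib)
    finally show ?thesis by (simp add: qint_def)
  qed
  have "(\<Sum>i<k. Q ^ i * g 3 * (1 - e * Q ^ i / (Q - 1)))
      = g 3 * (\<Sum>i<k. Q ^ i) - g 3 * e / (Q - 1) * (\<Sum>i<k. Q ^ i * Q ^ i)"
    unfolding sum_distrib_left sum_subtractf[symmetric]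
    by (intro sum.cong) (auto simp: algebra_simps)
  also have "\<dots> = K * g 3 * (1 - e * (Q ^ k + 1) / ((Q - 1) * (Q + 1)))"
    unfolding s1 s2 by (simp add: algebra_simps)
  finally have main2: "K * g 3 * (1 - e * (Q ^ k + 1) / ((Q - 1) * (Q + 1))) \<le> bd" using main by simp
  \<comment> \<open>Here e q^k = c (q-1). Since q^k >= 8, the summand 1 costs at most a factor 9/8,
    and q + 1 >= 3 turns 9/8 into less than 1/2.\<close>
  have "e * (Q ^ k + 1) / ((Q - 1) * (Q + 1)) \<le> c / 2"
  proof -
    have ec: "e * Q ^ k = c * (Q - 1)"
    proof -
      have "e * Q ^ k * Q ^ n = c * (Q - 1) * Q ^ n"
        unfolding c_eq using q2 by (simp add: e_def mult_2 power_add)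
      then show ?thesis using q2 by (subst (asm) mult_cancel_right) auto
    qed
    have "Q ^ k \<ge> 2 ^ 3"
      using power_mono[of 2 Q 3] power_increasing[of 3 k Q] Q2 k_ge_3 by linarith
    then have "e * 8 \<le> e * Q ^ k" using e_pos by (intro mult_left_mono) auto
    then have "e * (Q ^ k + 1) \<le> 9 / 8 * (c * (Q - 1))" using ec by (simp add: algebra_simps)
    also have "\<dots> \<le> c / 2 * ((Q - 1) * (Q + 1))"
    proof -
      have "c * (Q - 1) * 3 \<le> c * (Q - 1) * (Q + 1)" using c_pos Q2 by (intro mult_left_mono) auto
      moreover have "c * (Q - 1) \<ge> 0" using c_pos Q2 by simp
      moreover have "c / 2 * ((Q - 1) * (Q + 1)) = c * (Q - 1) * (Q + 1) / 2" by simp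
      ultimately show ?thesis by linarith
    qed
    finally show ?thesis using p by (simp add: divide_le_eq)
  qed
  then have "K * g 3 * (1 - c / 2) \<le> K * g 3 * (1 - e * (Q ^ k + 1) / ((Q - 1) * (Q + 1)))"
    using g_nonneg[of 3] qint_nonneg[OF q2, of k] by (intro mult_left_mono) auto
  with main2 show ?thesis by (simp add: mult_ac)
qed

lemma bd_k3: "k = 3 \<Longrightarrow> bd = K"
proof -
  assume k: "k = 3"
  have "qint q (n - 2) = qint q 3 + Q ^ 3 * qint q (n - 5)"
    using qint_add[OF q2, of 3 "n - 5"] n_ge k by simp
  then show ?thesis unfolding bd_def using k gauss_1[of q "n - 2"] gauss_1[of q "n - 5"] by simp
qed

lemma g3_k3: "k = 3 \<Longrightarrow> g 3 = 1"
  unfolding g_def by simp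

lemma K_pos: "K > 0" using K_ge_7 by linarith

lemma below_bd: "x < (1 - c / 2) * K \<Longrightarrow> x * g 3 < bd"
proof -
  assume "x < (1 - c / 2) * K"
  then have "x * g 3 < (1 - c / 2) * K * g 3"
    using g_pos k_ge_3 by (intro mult_strict_right_mono) auto
  then show ?thesis using bd_ge by linarith
qed

lemma cK: "c * K \<le> K / 4" "c * K > 0"
  using mult_right_mono[OF c_le_quarter, of K] K_pos c_pos by auto

lemma slack: "(1 - c / 2) * K = K - c * K / 2"
  by (simp add: algebra_simps)

text \<open>
  Except for \<open>num_hyperplanes\<close>, the inequalities below instantiate the hypothesis \<open>\<alpha> + c * R / K < bd\<close> of the averaging lemma
  \<open>light_by_weight\<close>: $\alpha$ bounds a pointwise degree and $R$ the number of the remaining members.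
\<close>

lemma num_single_cover: "g 3 + c * ((Q + 1) * (K - 1) * K * g 3) / K < bd"
proof -
  have "(c * (Q + 1)) * (K - 1) \<le> 3/4 * (K - 1)"
    using c_Q1 K_ge_7 by (intro mult_right_mono) auto
  moreover have "1 + x < K - y / 2" if "x \<le> 3/4 * (K - 1)" "y \<le> K / 4" for x y
    using that K_ge_7 by simp
  ultimately have "1 + c * (Q + 1) * (K - 1) < (1 - c / 2) * K"
    unfolding slack using cK(1) by blast
  moreover have "g 3 + c * ((Q + 1) * (K - 1) * K * g 3) / K = (1 + c * (Q + 1) * (K - 1)) * g 3"
    using K_pos by (simp add: field_simps)
  ultimately show ?thesis using below_bd by simp
qed

lemma qint_lt_K: "l < k \<Longrightarrow> 2 * qint q l \<le> K - 1"
proof -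
  assume "l < k"
  then have "qint q (Suc l) \<le> K" by (intro qint_mono[OF q2]) auto
  moreover have "2 * qint q l \<le> Q * qint q l"
    using Q2 qint_nonneg[OF q2] by (intro mult_right_mono) auto
  ultimately show ?thesis using qint_Suc[OF q2, of l] by simp
qed

text \<open>Here x bounds the contribution of the members avoiding X. The pencil uses up [l], at
  most half of K; the remaining K - [l] is damped by c.\<close>

lemma num_pencil:
  assumes "l < k" "x \<le> g 3"
  shows "(qint q l * g 3 + x) + c * ((K - qint q l) * K * g 3) / K < bd"
proof -
  have "(1 - c) * (2 * qint q l) \<le> (1 - c) * (K - 1)"
    using qint_lt_K[OF assms(1)] c_le_quarter by (intro mult_left_mono) auto
  then have "2 * qint q l - 2 * (c * qint q l) \<le> K - 1 - c * K + c"
    by (simp add: algebra_simps)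
  moreover have "x + 1 + (z - w) < K - z / 2"
    if "2 * x - 2 * w \<le> K - 1 - z + c" "z \<le> K / 4" for x w z
    using that c_le_quarter K_ge_7 by simp
  ultimately have "qint q l + 1 + c * (K - qint q l) < (1 - c / 2) * K"
    unfolding slack right_diff_distrib using cK(1) by blast
  from below_bd[OF this] have "(qint q l + 1 + c * (K - qint q l)) * g 3 < bd" .
  moreover have "(qint q l * g 3 + x) + c * ((K - qint q l) * K * g 3) / K
      = (qint q l + 1 + c * (K - qint q l)) * g 3 + (x - g 3)"
    using K_pos by (simp add: field_simps)
  ultimately show ?thesis using assms(2) by simp
qed

text \<open>There are q^l complements of X in M, and each lies, together with an outside point, in
  at most \<open>g (Suc l)\<close> members. The sum stays below one unit only from l = 3 on: raising
  l multiplies the number by q <= K, which \<open>g_step\<close> absorbs.\<close>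

lemma num_hyperplanes: "3 \<le> l \<Longrightarrow> l < k \<Longrightarrow> Q ^ l * g (Suc l) \<le> g 3"
proof (induction l rule: dec_induct)
  case base
  then have "qint q 4 \<le> K" by (intro qint_mono[OF q2]) auto
  moreover have "Q ^ 3 \<le> qint q 4"
    using Q2 unfolding qint_4 by (simp add: algebra_simps power2_eq_square power3_eq_cube)
  ultimately have "Q ^ 3 * g 4 \<le> K * g 4" using g_nonneg by (intro mult_right_mono) auto
  also have "\<dots> \<le> c * g 3" using g_step[of 3] base by simp
  also have "\<dots> \<le> 1 * g 3" using c_le_quarter g_nonneg by (intro mult_right_mono) auto
  finally show ?case by simp
next
  case (step l)
  have "Q \<le> K" using K_ge_3 Q2 zero_le_power2[of Q] by linarith
  then have "Q * g (Suc (Suc l)) \<le> K * g (Suc (Suc l))" using g_nonneg by (intro mult_right_mono) auto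
  also have "\<dots> \<le> c * g (Suc l)" using g_step[of "Suc l"] step by simp
  also have "\<dots> \<le> 1 * g (Suc l)" using c_le_quarter g_nonneg by (intro mult_right_mono) auto
  finally have "Q ^ l * (Q * g (Suc (Suc l))) \<le> Q ^ l * g (Suc l)" by (intro mult_left_mono) auto
  then show ?case using step by (simp add: mult_ac)
qed

text \<open>For l = 2 the members avoiding X cannot be charged pointwise: [2] + q^2 = [3] already
  equals K when k = 3. They are counted instead, which gives the second summand of the
  remainder.\<close>

lemma num_pencil_2: "qint q 2 * g 3 + c * ((K - qint q 2) * K * g 3 + Q^2 * (K - 1) * g 3) / K < bd"
proof -
  have "Q^2 * (K - 1) / K \<le> Q^2"
    using K_pos by (simp add: divide_le_eq mult_left_mono)
  also have "Q^2 \<le> K - (Q + 1)" using K_ge_3 by simp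
  finally have "c * (Q^2 * (K - 1) / K) \<le> c * (K - (Q + 1))" using c_pos by (intro mult_left_mono) auto
  moreover have "(Q + 1) * 7 \<le> K * 3"
  proof -
    have "2 * Q \<le> Q^2" using Q2 by (simp add: power2_eq_square)
    moreover have "(x + 1) * 7 \<le> K * 3" if "2 * x \<le> y" "y + x + 1 \<le> K" "2 \<le> x" for x y :: real
      using that by simp
    ultimately show ?thesis using K_ge_3 Q2 by blast
  qed
  moreover have "c * (5/2 * K - 2 * (Q + 1)) \<le> 1/4 * (5/2 * K - 2 * (Q + 1))"
    using c_le_quarter calculation(2) K_pos by (intro mult_right_mono) auto
  ultimately have "(Q + 1) + c * (K - (Q + 1)) + c * (Q^2 * (K - 1) / K) < (1 - c / 2) * K"
    using K_pos by (simp add: algebra_simps)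
  from below_bd[OF this] K_pos show ?thesis unfolding qint_2
    by (simp add: field_simps)
qed

text \<open>For k = 3 the two sides agree, in accordance with the second extremal family.\<close>

lemma num_triangle: "k \<ge> 4 \<Longrightarrow> qint q 3 * g 3 < bd"
proof -
  assume "k \<ge> 4"
  then have "2 * qint q 3 \<le> K - 1" by (intro qint_lt_K) auto
  then have "qint q 3 < (1 - c / 2) * K" unfolding slack using cK K_ge_7 by linarith
  then show ?thesis by (rule below_bd)
qed

text \<open>N is the number of three-dimensional covers, bounded as in
  \<open>card_min_covers\<close>. The first term of R counts members without such a cover, the
  second those through one.\<close>

lemma num_cover_3:
  assumes k: "k \<ge> 4" and N: "N \<le> K^2 \<or> N \<le> (Q + 1) * qint q 3 * K \<or> N \<le> qint q 3 ^ 3"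
    and R: "R \<le> qint q 3 * K^3 * g 4 + N * g 3"
  shows "c * R / K < bd"
proof -
  have K4: "qint q 4 \<le> K" using k by (intro qint_mono[OF q2]) auto
  have q3: "qint q 3 > 0" by (rule qint_pos[OF q2]) simp
  have "K * g 4 \<le> c * g 3" using g_step[of 3] k by simp
  then have "qint q 3 * K^2 * (K * g 4) \<le> qint q 3 * K^2 * (c * g 3)"
    using q3 by (intro mult_left_mono) auto
  then have "R \<le> (qint q 3 * c * K^2 + N) * g 3" using R by (simp add: algebra_simps power3_eq_cube power2_eq_square)
  then have "c * R / K \<le> c * ((qint q 3 * c * K^2 + N) * g 3) / K"
    using c_pos K_pos by (intro divide_right_mono mult_left_mono) auto
  also have "\<dots> = (c * (c * qint q 3) * K + c * N / K) * g 3"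
    using K_pos by (simp add: field_simps power2_eq_square)
  also have "\<dots> < bd"
  proof (rule below_bd)
    \<comment> \<open>The budget is 7/16 + 2/5 + 1/8 < 1, where 1/8 pays for the loss c/2 in
      \<open>bd_ge\<close>.\<close>
    have "c * (c * qint q 3) * K \<le> 7/16 * K"
      using c2_qint_3 K_pos by (intro mult_right_mono) auto
    moreover have "c * N / K \<le> 2/5 * K"
      using N
    proof (elim disjE)
      assume "N \<le> K^2"
      then have "c * N \<le> c * K^2" using c_pos by (intro mult_left_mono) auto
    also have "c * K^2 \<le> 1/4 * K^2" using c_le_quarter K_pos by (intro mult_right_mono) auto
    finally have "c * N \<le> 1/4 * K^2" .
      moreover have "0 < K^2" using K_pos by simp
      ultimately have "c * N \<le> 2/5 * K^2" by linarith
      then show ?thesis using K_pos by (simp add: divide_le_eq power2_eq_square mult.assoc)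
    next
      assume "N \<le> (Q + 1) * qint q 3 * K"
      then have "c * N \<le> c * ((Q + 1) * qint q 3 * K)" using c_pos by (intro mult_left_mono) auto
      also have "\<dots> \<le> c * ((Q + 1) * (7/5 * (Q^2 + 1)) * K)"
      proof -
        \<comment> \<open>Equality at q = 2, where [3] = 7 and q^2 + 1 = 5; this is the origin of
          7/5.\<close>
        have "5 * Q \<le> 2 * Q^2 + 2"
        proof -
          have "(Q - 2) * (2 * Q - 1) \<ge> 0" using Q2 by (intro mult_nonneg_nonneg) auto
          then show ?thesis by (simp add: algebra_simps power2_eq_square)
        qed
        then have "qint q 3 \<le> 7/5 * (Q^2 + 1)" unfolding qint_3 by simp
        then show ?thesis using c_pos K_pos by (intro mult_left_mono mult_right_mono) auto
      qed
      also have "\<dots> = 7/5 * (c * (qint q 4 * K))" unfolding qint_4 by (simp add: mult_ac)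
      also have "\<dots> \<le> 7/5 * (1/4 * (K * K))"
        using K4 c_le_quarter c_pos K_pos qint_nonneg[OF q2, of 4] by (intro mult_left_mono mult_mono) auto
      moreover have "0 < K * K" using K_pos by simp
      ultimately have "c * N \<le> 2/5 * (K * K)" by linarith
      then show ?thesis using K_pos by (simp add: divide_le_eq mult.assoc)
    next
      assume "N \<le> qint q 3 ^ 3"
      then have cN: "c * N \<le> c * qint q 3 ^ 3" using c_pos by (intro mult_left_mono) auto
      have "c * qint q 3 ^ 3 \<le> 2/5 * (qint q 4 * qint q 4)"
        using c_cases
      proof
        assume h: "Q = 2 \<and> c \<le> 1/4"
        have "qint q 3 = 7" "qint q 4 = 15" using h unfolding qint_3 qint_4 by simp_all
        then show ?thesis using c_le_quarter by simp
      next
        assume h: "Q \<ge> 3 \<and> c * (Q * (Q - 1)) \<le> 1"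
        have "qint q 4 = Q * qint q 3 + 1" using qint_Suc[OF q2, of 3] by simp
        moreover have "3 * qint q 3 \<le> Q * qint q 3" using h q3 by (intro mult_right_mono) auto
        ultimately have "3 * qint q 3 \<le> qint q 4" by simp
        then have "(3 * qint q 3) * (3 * qint q 3) \<le> qint q 4 * qint q 4"
          using q3 by (intro mult_mono) auto
        moreover have "(c * qint q 3) * (qint q 3 * qint q 3) \<le> 13/6 * (qint q 3 * qint q 3)"
          using c_qint_3 h by (intro mult_right_mono) auto
        moreover have "0 \<le> qint q 3 * qint q 3" by simp
        moreover have "c * qint q 3 ^ 3 = (c * qint q 3) * (qint q 3 * qint q 3)"
          by (simp add: power3_eq_cube)
        moreover have "(3 * qint q 3) * (3 * qint q 3) = 9 * (qint q 3 * qint q 3)" by simp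
        ultimately show ?thesis by linarith
      qed
      also have "\<dots> \<le> 2/5 * (K * K)"
        using K4 K_pos qint_nonneg[OF q2, of 4] by (intro mult_left_mono mult_mono) auto
      finally show ?thesis using cN K_pos by (simp add: divide_le_eq)
    qed
    ultimately show "c * (c * qint q 3) * K + c * N / K < (1 - c / 2) * K"
      unfolding slack using cK K_pos by linarith
  qed
  finally show ?thesis .
qed

text \<open>The same split one dimension higher. Returning from \<open>g 4\<close> to
  \<open>g 3\<close> gains another factor c/K, and k >= 5 gives q [4] < K; each of the two terms
  then takes at most a quarter.\<close>

lemma num_cover_4:
  assumes k: "k \<ge> 5" and N: "N \<le> K^3 \<or> N \<le> (Q + 1) * qint q 4 * K^2 \<or> N \<le> qint q 4 ^ 3 * K"
    and R: "R \<le> qint q 4 * K^4 * g 5 + N * g 4"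
  shows "c * R / K < bd"
proof -
  have "qint q 5 \<le> K" using k by (intro qint_mono[OF q2]) auto
  moreover have "qint q 5 = Q * qint q 4 + 1" using qint_Suc[OF q2, of 4] by simp
  ultimately have K5: "Q * qint q 4 \<le> K" by simp
  have q4: "qint q 4 > 0" by (rule qint_pos[OF q2]) simp
  have s4: "K * g 4 \<le> c * g 3" and s5: "K * g 5 \<le> c * g 4"
    using g_step[of 3] g_step[of 4] k by auto
  define M where "M = qint q 4 * c * K^3 + N"
  have "qint q 4 * K^3 * (K * g 5) \<le> qint q 4 * K^3 * (c * g 4)"
    using s5 q4 K_pos by (intro mult_left_mono) auto
  then have RM: "R \<le> M * g 4" using R by (simp add: M_def algebra_simps eval_nat_numeral)
  have cases: "c * (c * N) \<le> 1/4 * K^3"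
    using N
  proof (elim disjE)
    assume "N \<le> K^3"
    then have "c * N \<le> c * K^3" using c_pos by (intro mult_left_mono) auto
    also have "c * K^3 \<le> 1/4 * K^3" using c_le_quarter K_pos by (intro mult_right_mono) auto
    finally have "c * N \<le> 1/4 * K^3" .
    have "c * (c * N) \<le> 1/4 * (1/4 * K^3)"
    proof (rule order_trans)
      show "c * (c * N) \<le> c * (1/4 * K^3)"
        using \<open>c * N \<le> 1/4 * K^3\<close> c_pos by (intro mult_left_mono) auto
      show "c * (1/4 * K^3) \<le> 1/4 * (1/4 * K^3)"
        using c_le_quarter K_pos by (intro mult_right_mono) auto
    qed
    moreover have "0 < K^3" using K_pos by simp
    ultimately show ?thesis by linarith
  next
    assume "N \<le> (Q + 1) * qint q 4 * K^2"
    also have "\<dots> \<le> 2 * Q * qint q 4 * K^2"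
      using Q2 q4 by (intro mult_right_mono) auto
    also have "\<dots> \<le> 2 * K * K^2" using K5 by (simp add: mult_right_mono)
    finally have "c * N \<le> c * (2 * K^3)" using c_pos by (intro mult_left_mono) (auto simp: power3_eq_cube power2_eq_square)
    then have "c * (c * N) \<le> (c * c) * (2 * K^3)" using c_pos by (simp add: mult_left_mono mult_ac)
    also have "\<dots> \<le> (1/4 * (1/4)) * (2 * K^3)"
      using c_le_quarter c_pos K_pos by (intro mult_right_mono mult_mono) auto
    finally show ?thesis using zero_less_power[OF K_pos, of 3] by linarith
  next
    assume N: "N \<le> qint q 4 ^ 3 * K"
    have "c * (c * N) \<le> c * (c * (qint q 4 ^ 3 * K))" using c_pos N by (intro mult_left_mono) auto
    also have "\<dots> = (c * (c * qint q 4)) * (qint q 4 * qint q 4 * K)" by (simp add: power3_eq_cube mult_ac)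
    also have "\<dots> \<le> (1/4 * Q^2) * (qint q 4 * qint q 4 * K)"
    proof (intro mult_right_mono)
      show "c * (c * qint q 4) \<le> 1/4 * Q^2"
        using c2_qint_4
      proof
        assume h: "Q = 2 \<and> c * (c * qint q 4) \<le> 15/16"
        have "Q^2 = 4" using h by simp
        then show ?thesis using conjunct2[OF h] by linarith
      next
        assume h: "Q \<ge> 3 \<and> c * (c * qint q 4) \<le> 10/9"
        have "Q^2 \<ge> 9" using h power_mono[of 3 Q 2] by simp
        then show ?thesis using conjunct2[OF h] by linarith
      qed
    qed (use q4 K_pos in auto)
    also have "\<dots> = 1/4 * ((Q * qint q 4) * (Q * qint q 4) * K)" by (simp add: power2_eq_square mult_ac)
    also have "\<dots> \<le> 1/4 * (K * K * K)"
      using K5 K_pos q4 Q2 by (intro mult_left_mono mult_right_mono mult_mono) auto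
    finally show ?thesis by (simp add: power3_eq_cube)
  qed
  have "c * (c * (c * qint q 4)) * K^3 \<le> 1/4 * K^3"
    using c3_qint_4 K_pos by (intro mult_right_mono) auto
  with cases have M: "c * (c * M) \<le> 1/2 * K^3" unfolding M_def by (simp add: algebra_simps)
  show ?thesis
  \<comment> \<open>N is an arbitrary real number here, so the sign of M has to be settled before
    \<open>g 4\<close> is replaced by its upper bound.\<close>
  proof (cases "M \<ge> 0")
    case True
    have "c * R / K \<le> c * (M * g 4) / K"
      using c_pos K_pos RM by (intro divide_right_mono mult_left_mono) auto
    also have "\<dots> = c * M * (K * g 4) / (K * K)" using K_pos by (simp add: field_simps)
    also have "\<dots> \<le> c * M * (c * g 3) / (K * K)"
      using True s4 c_pos K_pos by (intro divide_right_mono mult_left_mono) auto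
    also have "\<dots> = (c * (c * M) / (K * K)) * g 3" by (simp add: mult_ac)
    also have "\<dots> < bd"
    proof (rule below_bd)
      have "c * (c * M) / (K * K) \<le> 1/2 * K"
        using M K_pos by (simp add: divide_le_eq power3_eq_cube mult_ac)
      then show "c * (c * M) / (K * K) < (1 - c / 2) * K"
        unfolding slack using cK K_pos by linarith
    qed
    finally show ?thesis .
  next
    case False
    then have "M * g 4 \<le> 0" using g_nonneg[of 4] by (simp add: mult_nonpos_nonneg)
    then have "c * R / K \<le> 0" using RM c_pos K_pos by (simp add: divide_nonpos_pos mult_nonneg_nonpos)
    moreover have "0 * g 3 < bd" using c_le_quarter K_pos by (intro below_bd) auto
    ultimately show ?thesis by simp
  qed
qed

text \<open>Passing from l to l + 1 multiplies the bound by at most c (q+1) <= 3/4, so l = 5 is the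
  worst case. There three factors c against [5] suffice without separating the minimal
  covers.\<close>

lemma num_cover_ge_5:
  assumes l: "5 \<le> l" "l \<le> k" and R: "R \<le> qint q l * K^(l - 1) * g l"
  shows "c * R / K < bd"
proof -
  have dec: "qint q l * K^(l - 1) * g l \<le> qint q 5 * K^4 * g 5"
    using l
  proof (induction l rule: dec_induct)
    case base
    then show ?case by simp
  next
    case (step l)
    obtain m where m: "l = Suc m" using step by (cases l) auto
    have ql: "qint q l \<ge> 1" using qint_mono[OF q2, of 1 l] qint_1[OF q2] step by simp
    have "qint q (Suc l) * K ^ (Suc l - 1) * g (Suc l) = qint q (Suc l) * K ^ (l - 1) * (K * g (Suc l))"
      by (simp add: m)
    also have "\<dots> \<le> qint q (Suc l) * K ^ (l - 1) * (c * g l)"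
      using g_step[of l] step qint_nonneg[OF q2] K_pos by (intro mult_left_mono) auto
    also have "\<dots> = (c * qint q (Suc l)) * (K ^ (l - 1) * g l)" by (simp add: mult_ac)
    also have "\<dots> \<le> qint q l * (K ^ (l - 1) * g l)"
    proof (intro mult_right_mono)
      have "qint q (Suc l) \<le> (Q + 1) * qint q l" using qint_Suc[OF q2, of l] ql by (simp add: algebra_simps)
      then have "c * qint q (Suc l) \<le> (c * (Q + 1)) * qint q l" using c_pos by (simp add: mult_left_mono mult.assoc)
      also have "\<dots> \<le> 1 * qint q l" using c_Q1 ql by (intro mult_right_mono) auto
      finally show "c * qint q (Suc l) \<le> qint q l" by simp
    qed (use K_pos g_nonneg in auto)
    also have "\<dots> = qint q l * K ^ (l - 1) * g l" by simp
    finally show ?case using step by simp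
  qed
  have "K * g 4 \<le> c * g 3" and s5: "K * g 5 \<le> c * g 4"
    using g_step[of 3] g_step[of 4] l by auto
  have q5: "qint q 5 \<ge> 0" by (rule qint_nonneg[OF q2])
  have "K * (K * g 5) \<le> K * (c * g 4)" using s5 K_pos by (intro mult_left_mono) auto
  also have "\<dots> = c * (K * g 4)" by simp
  also have "\<dots> \<le> c * (c * g 3)" using \<open>K * g 4 \<le> c * g 3\<close> c_pos by (intro mult_left_mono) auto
  finally have "qint q 5 * K^2 * (K * (K * g 5)) \<le> qint q 5 * K^2 * (c * (c * g 3))"
    using q5 by (intro mult_left_mono) auto
  then have "R \<le> qint q 5 * K^2 * (c * (c * g 3))"
    using R dec by (simp add: eval_nat_numeral mult_ac)
  then have "c * R / K \<le> c * (qint q 5 * K^2 * (c * (c * g 3))) / K"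
    using c_pos K_pos by (intro divide_right_mono mult_left_mono) auto
  also have "\<dots> = (c * (c * (c * qint q 5)) * K) * g 3" using K_pos by (simp add: field_simps power2_eq_square)
  also have "\<dots> < bd"
  proof (rule below_bd)
    have q4: "qint q 4 \<ge> 1" using qint_mono[OF q2, of 1 4] qint_1[OF q2] by simp
    have "qint q 5 \<le> (Q + 1) * qint q 4" using qint_Suc[OF q2, of 4] q4 by (simp add: algebra_simps)
    then have "c * (c * (c * qint q 5)) \<le> c * (c * (c * ((Q + 1) * qint q 4)))"
      using c_pos by (intro mult_left_mono) auto
    also have "\<dots> = (c * (Q + 1)) * (c * (c * qint q 4))" by (simp add: mult_ac)
    also have "\<dots> \<le> 3/4"
      using c2_qint_4
    proof
      assume "Q = 2 \<and> c * (c * qint q 4) \<le> 15/16"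
      then have "(c * (Q + 1)) * (c * (c * qint q 4)) \<le> 3/4 * (15/16)"
        using c_Q1 c_pos q4 by (intro mult_mono) auto
      then show ?thesis by simp
    next
      assume "Q \<ge> 3 \<and> c * (c * qint q 4) \<le> 10/9"
      then have "(c * (Q + 1)) * (c * (c * qint q 4)) \<le> 2/3 * (10/9)"
        using c_Q1' c_pos q4 by (intro mult_mono) auto
      then show ?thesis by simp
    qed
    finally have "c * (c * (c * qint q 5)) * K \<le> 3/4 * K" using K_pos by (intro mult_right_mono) auto
    then show "c * (c * (c * qint q 5)) * K < (1 - c / 2) * K"
      unfolding slack using cK K_pos by linarith
  qed
  finally show ?thesis .
qed

lemma num_cover_4_4:
  assumes k: "k = 4" and R: "R \<le> qint q 4 * K^3 * g 4"
  shows "c * R / K < bd"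
proof -
  have g: "g 4 = 1" "g 3 = qint q (n - 3)"
    unfolding g_def using k gauss_1[of q "n - 3"] by auto
  have "R \<le> K^4" using R k g by (simp add: eval_nat_numeral)
  then have "c * R / K \<le> c * K^4 / K" using c_pos K_pos by (intro divide_right_mono mult_left_mono) auto
  also have "\<dots> = (c * K^2) * K" using K_pos by (simp add: eval_nat_numeral)
  also have "\<dots> \<le> (3/4 * g 3) * K"
  proof (intro mult_right_mono)
    show "c * K^2 \<le> 3/4 * g 3"
      using c_cases
    proof
      assume h: "Q = 2 \<and> c \<le> 1/4"
      then have "q = 2" by simp
      then have n: "n \<ge> 10" using qn k by auto
      have "qint q 7 \<le> g 3" unfolding g using n by (intro qint_mono[OF q2]) auto
      moreover have "qint q 7 = 127" using h by (simp add: qint_def)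
      moreover have "K = 15" using h k unfolding k qint_4 by simp
      ultimately show ?thesis using c_le_quarter by simp
    next
      assume h: "Q \<ge> 3 \<and> c * (Q * (Q - 1)) \<le> 1"
      have "qint q (2 + 4) \<le> g 3" unfolding g using n_ge k by (intro qint_mono[OF q2]) auto
      then have 1: "Q^2 * K \<le> g 3" using qint_add[OF q2, of 2 4] k qint_nonneg[OF q2, of 2] by simp
      have "Q^2 + 1 \<le> 10/9 * Q^2" using h power_mono[of 3 Q 2] by simp
      then have "(c * (Q + 1)) * (Q^2 + 1) \<le> 2/3 * (10/9 * Q^2)"
        using h c_Q1' by (intro mult_mono) auto
      moreover have "c * K = (c * (Q + 1)) * (Q^2 + 1)" unfolding k qint_4 by simp
      ultimately have "c * K \<le> 3/4 * Q^2" using zero_le_power2[of Q] by linarith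
      then have "c * K * K \<le> 3/4 * Q^2 * K" using K_pos by (intro mult_right_mono) auto
      then show ?thesis using 1 by (simp add: power2_eq_square mult_ac)
    qed
  qed (use K_pos in auto)
  also have "\<dots> = (3/4 * K) * g 3" by simp
  also have "\<dots> < bd" using cK K_pos by (intro below_bd) (unfold slack, linarith)
  finally show ?thesis .
qed

text \<open>The term (q+1) K^2 counts members meeting a suitable two-space, q^5 those missing it. At
  q = 2, c = 1/4 the claim reads 179/4 < 49. The factor 7/8 lost by \<open>below_bd\<close> would
  spoil it, hence the exact value \<open>bd_k3\<close>.\<close>

lemma num_planes:
  assumes k: "k = 3" and R: "R \<le> (Q + 1) * K^2 + Q^5"
  shows "c * R / K < bd"
proof -
  have K3: "K = Q^2 + Q + 1" using k qint_3 by simp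
  have "c * R \<le> c * ((Q + 1) * K^2 + Q^5)" using c_pos R by (intro mult_left_mono) auto
  also have "\<dots> < K^2"
    using c_cases
  proof
    assume h: "Q = 2 \<and> c \<le> 1/4"
    have e: "(Q + 1) * K^2 + Q^5 = 179" "K^2 = 49" unfolding K3 using h by simp_all
    show ?thesis unfolding e(1) unfolding e(2) using c_le_quarter by linarith
  next
    assume h: "Q \<ge> 3 \<and> c * (Q * (Q - 1)) \<le> 1"
    \<comment> \<open>After replacing c by 1/(q(q-1)), what remains is q^5 < K^2 (q^2 - 2q - 1); the
      lower bound q^3 (q+2) for K^2 reduces it to a cubic.\<close>
    have Q3: "3 \<le> x \<Longrightarrow> (x + 1) * y^2 + x^5 < y^2 * (x * (x - 1))"
      if "y = x^2 + x + 1" for x y :: real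
    proof -
      assume x: "3 \<le> x"
      have "3 * x \<le> x^2" using mult_right_mono[of 3 x x] x by (simp add: power2_eq_square)
      then have D: "0 < x^2 - 2 * x - 1" using x by linarith
      have "x^3 * (x + 2) \<le> y^2"
        using x unfolding that by (simp add: power2_eq_square power3_eq_cube algebra_simps)
      then have "x^3 * (x + 2) * (x^2 - 2 * x - 1) \<le> y^2 * (x^2 - 2 * x - 1)"
        using D by (intro mult_right_mono) auto
      moreover have "x^2 < (x + 2) * (x^2 - 2 * x - 1)"
      proof -
        have "3 * x \<le> x^2" "3 * x^2 \<le> x^3"
          using x mult_right_mono[of 3 x x] mult_right_mono[of 3 x "x^2"]
          by (simp_all add: power2_eq_square power3_eq_cube)
        moreover have "(x + 2) * (x^2 - 2 * x - 1) = x^3 - 5 * x - 2"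
          by (simp add: power2_eq_square power3_eq_cube algebra_simps)
        ultimately show ?thesis using x by linarith
      qed
      then have "x^3 * x^2 < x^3 * ((x + 2) * (x^2 - 2 * x - 1))"
        using x by (intro mult_strict_left_mono) auto
      moreover have "x^3 * x^2 = x^5" by (simp flip: power_add)
      moreover have "y^2 * (x^2 - 2 * x - 1) = y^2 * (x * (x - 1)) - (x + 1) * y^2"
        by (simp add: power2_eq_square algebra_simps)
      ultimately show ?thesis by (simp add: mult.assoc)
    qed
    have "(Q + 1) * K^2 + Q^5 < K^2 * (Q * (Q - 1))" using Q3[OF K3] h by blast
    then have "c * ((Q + 1) * K^2 + Q^5) < c * (K^2 * (Q * (Q - 1)))"
      using c_pos by (intro mult_strict_left_mono)
    also have "\<dots> = K^2 * (c * (Q * (Q - 1)))" by (simp add: mult_ac)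
    also have "\<dots> \<le> K^2 * 1" using h by (intro mult_left_mono) auto
    finally show ?thesis by simp
  qed
  finally have "c * R / K < K" using K_pos by (simp add: divide_less_eq power2_eq_square)
  then show ?thesis using bd_k3 k by simp
qed

end

section \<open>Averaging over subspaces avoiding a cover\<close>

lemma card_UN_bound:
  assumes "finite I" "\<And>i. i \<in> I \<Longrightarrow> finite (T i)" "S \<subseteq> (\<Union>i\<in>I. T i)"
    and "\<And>i. i \<in> I \<Longrightarrow> real (card (T i)) \<le> C"
  shows "real (card S) \<le> real (card I) * C"
proof -
  have "card S \<le> card (\<Union>i\<in>I. T i)" using assms by (intro card_mono) auto
  also have "\<dots> \<le> (\<Sum>i\<in>I. card (T i))" by (rule card_UN_le[OF assms(1)])
  finally have "real (card S) \<le> (\<Sum>i\<in>I. real (card (T i)))"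
    by (metis of_nat_le_iff of_nat_sum)
  also have "\<dots> \<le> real (card I) * C" using assms(4) by (rule sum_bounded_above)
  finally show ?thesis .
qed

context finite_vector_space
begin

declare dim_UNIV [simp del]

abbreviation deg :: "'v set set \<Rightarrow> 'v set \<Rightarrow> real" where
  "deg \<G> A \<equiv> real (point_degree \<G> A)"

text \<open>Each G through A meets B in a point x outside A and so contains one of the [dim B]
  spaces A + x, of dimension one more than A.\<close>

lemma degree_branch:
  assumes "subspace A" "subspace B" "A \<inter> B = {0}"
    and "\<And>G. G \<in> \<G> \<Longrightarrow> subspace G"
    and "\<And>G. G \<in> \<G> \<Longrightarrow> A \<subseteq> G \<Longrightarrow> G \<inter> B \<noteq> {0}"
    and C: "\<And>A'. subspace A' \<Longrightarrow> A \<subseteq> A' \<Longrightarrow> dim A' = Suc (dim A) \<Longrightarrow> deg \<G> A' \<le> C"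
  shows "deg \<G> A \<le> qint q (dim B) * C"
proof -
  have "real (card {G \<in> \<G>. A \<subseteq> G}) \<le> real (card (pts B)) * C"
  proof (rule card_UN_bound[where T = "\<lambda>x. {G \<in> \<G>. A \<squnion> x \<subseteq> G}"])
    show "{G \<in> \<G>. A \<subseteq> G} \<subseteq> (\<Union>x\<in>pts B. {G \<in> \<G>. A \<squnion> x \<subseteq> G})"
    proof
      fix G assume "G \<in> {G \<in> \<G>. A \<subseteq> G}"
      then have G: "G \<in> \<G>" "A \<subseteq> G" "subspace G" using assms by auto
      have "subspace (G \<inter> B)" using G assms by (simp add: subspace_inter)
      then obtain x where x: "x \<in> pts (G \<inter> B)" using exists_point assms(5)[OF G(1,2)] by blast
      then have "A \<squnion> x \<subseteq> G" using G by (intro join_least) (auto simp: pts_iff)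
      moreover have "x \<in> pts B" using x by (auto simp: pts_iff)
      ultimately show "G \<in> (\<Union>x\<in>pts B. {G \<in> \<G>. A \<squnion> x \<subseteq> G})" using G by blast
    qed
    fix x assume x: "x \<in> pts B"
    have "\<not> x \<subseteq> A"
    proof
      assume "x \<subseteq> A"
      then have "x \<subseteq> {0}" using ptsD(3)[OF x] assms(3) by blast
      then show False using point_nonzero[OF x] subspace_0[OF ptsD(2)[OF x]] by blast
    qed
    then have "dim (A \<squnion> x) = Suc (dim A)" using dim_join_point ptsD(1)[OF x] assms(1) by blast
    then show "real (card {G \<in> \<G>. A \<squnion> x \<subseteq> G}) \<le> C"
      using C[of "A \<squnion> x"] join_ub(1)[of A x] by (simp add: point_degree_def)
  qed auto
  then show ?thesis using card_pts[OF assms(2)] by (simp add: point_degree_def)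
qed

text \<open>The test spaces in \<open>\<B>\<close> may be members, which gives [k] choices per step,
  or minimal covers, which gives only [l].\<close>

lemma degree_iterate:
  assumes \<G>: "\<And>G. G \<in> \<G> \<Longrightarrow> subspace G"
    and \<B>: "\<And>D. D \<in> \<B> \<Longrightarrow> subspace D \<and> dim D = b"
    and meet: "\<And>G D. G \<in> \<G> \<Longrightarrow> D \<in> \<B> \<Longrightarrow> G \<inter> D \<noteq> {0}"
    and miss: "\<And>A. subspace A \<Longrightarrow> dim A < s \<Longrightarrow> \<exists>D\<in>\<B>. A \<inter> D = {0}"
    and C: "\<And>A. subspace A \<Longrightarrow> dim A = s \<Longrightarrow> deg \<G> A \<le> C"
    and A: "subspace A" "dim A \<le> s"
  shows "deg \<G> A \<le> qint q b ^ (s - dim A) * C"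
  using A
proof (induction "s - dim A" arbitrary: A)
  case 0
  then show ?case using C by simp
next
  case (Suc m)
  then have lt: "dim A < s" by simp
  then obtain D where D: "D \<in> \<B>" "A \<inter> D = {0}" using miss Suc.prems by blast
  have "deg \<G> A \<le> qint q (dim D) * (qint q b ^ m * C)"
  proof (rule degree_branch)
    fix A' assume A': "subspace A'" "A \<subseteq> A'" "dim A' = Suc (dim A)"
    then have "m = s - dim A'" using Suc.hyps(2) by simp
    with Suc.hyps(1)[of A'] A' lt show "deg \<G> A' \<le> qint q b ^ m * C" by simp
  qed (use Suc.prems D \<B> \<G> meet in auto)
  then show ?case using Suc.hyps(2)[symmetric] \<B>[OF D(1)] by (simp add: mult_ac)
qed

lemma dim_Int_gt:
  assumes "subspace A" "subspace B" "subspace W" "A \<subseteq> W" "B \<subseteq> W" "dim A + dim B > dim W"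
  shows "A \<inter> B \<noteq> {0}"
proof
  assume "A \<inter> B = {0}"
  then have "dim (A \<squnion> B) = dim A + dim B" using dim_join[of A B] assms by simp
  moreover have "dim (A \<squnion> B) \<le> dim W" using assms by (intro dim_subset join_least)
  ultimately show False using assms by simp
qed

lemma two_points_line:
  assumes "x \<in> pts T" "y \<in> pts T" "x \<noteq> y" "subspace T" "dim T = 2"
  shows "x \<squnion> y = T"
proof -
  have "\<not> y \<subseteq> x" using point_eq[OF assms(2,1)] assms(3) by auto
  then have "dim (x \<squnion> y) = 2" using dim_join_point[of y x] assms by (auto simp: pts_iff)
  moreover have "x \<squnion> y \<subseteq> T" using assms ptsD(3) by (intro join_least) auto
  ultimately show ?thesis using assms by (intro subspace_eqI) auto
qed

lemma lines_meet:
  assumes "subspace A" "dim A = 2" "subspace B" "dim B = 2" "A \<noteq> B" "A \<inter> B \<noteq> {0}"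
  shows "A \<inter> B \<in> pts UNIV" "dim (A \<squnion> B) = 3"
proof -
  have s: "subspace (A \<inter> B)" using assms by (simp add: subspace_inter)
  have "dim (A \<inter> B) \<ge> 1" using dim_Int_pos assms by blast
  moreover have "dim (A \<inter> B) < 2"
  proof (rule ccontr)
    assume "\<not> ?thesis"
    then have "dim A \<le> dim (A \<inter> B)" "dim B \<le> dim (A \<inter> B)" using assms by auto
    then have "A \<inter> B = A" "A \<inter> B = B"
      using s assms subspace_eqI[of "A \<inter> B" A] subspace_eqI[of "A \<inter> B" B] by blast+
    then show False using assms by simp
  qed
  ultimately have d: "dim (A \<inter> B) = 1" by simp
  then show "A \<inter> B \<in> pts UNIV" using s by (simp add: pts_iff)
  show "dim (A \<squnion> B) = 3" using dim_join[of A B] d assms by simp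
qed

lemma common_point:
  assumes "subspace A" "subspace B" "A \<inter> B \<noteq> {0}"
  shows "\<exists>x. x \<in> pts UNIV \<and> x \<subseteq> A \<and> x \<subseteq> B \<and> x \<in> pts A \<and> x \<in> pts B"
proof -
  obtain x where "x \<in> pts (A \<inter> B)"
    using exists_point[OF subspace_inter[OF assms(1,2)] assms(3)] by blast
  then show ?thesis by (intro exI[of _ x]) (auto simp: pts_iff)
qed

lemma Int_nonzeroI: "x \<in> pts UNIV \<Longrightarrow> x \<subseteq> A \<Longrightarrow> x \<subseteq> B \<Longrightarrow> A \<inter> B \<noteq> {0}"
  using point_nonzero[of x UNIV] subspace_0[of x] ptsD(2) by blast

text \<open>Every point outside T lies in the same number N of k-spaces S with S \<inter> T = 0, so
  the mean weight of these S is [k] times the mean weight of the outside points.\<close>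

lemma exists_light_subspace:
  fixes w :: "'v set \<Rightarrow> real"
  assumes T: "subspace T" and k: "k \<ge> 1" "dim T + k \<le> dim (UNIV :: 'v set)"
    and w: "(\<Sum>x\<in>pts UNIV - pts T. w x) < \<beta> * (qint q (dim (UNIV :: 'v set)) - qint q (dim T))"
  shows "\<exists>S\<in>Gr scale k UNIV. S \<inter> T = {0} \<and> (\<Sum>x\<in>pts S. w x) < qint q k * \<beta>"
proof (rule ccontr)
  assume contra: "\<not> ?thesis"
  let ?n = "dim (UNIV :: 'v set)"
  let ?P = "pts UNIV - pts T"
  define \<S> where "\<S> = {S \<in> Gr scale k UNIV. S \<inter> T = {0}}"
  define N where "N = real q ^ (dim T * (k - 1)) * gauss q (?n - Suc (dim T)) (k - 1)"
  have N: "real (card {S \<in> \<S>. x \<subseteq> S}) = N" if x: "x \<in> ?P" for x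
  proof -
    have x': "x \<in> pts UNIV" "subspace x" "dim x = 1" "\<not> x \<subseteq> T" using x by (auto simp: pts_iff)
    have xT: "x \<inter> T = {0}" using point_Int[OF x'(1) T] x' by simp
    \<comment> \<open>For x in S, the modular law turns S \<inter> T = 0 into S \<inter> (T + x) =
      x, a condition that \<open>card_between\<close> counts independently of x.\<close>
    have "{S \<in> \<S>. x \<subseteq> S} = between x (T \<squnion> x) UNIV k"
    proof (intro set_eqI iffI)
      fix S assume "S \<in> {S \<in> \<S>. x \<subseteq> S}"
      then have S: "subspace S" "dim S = k" "x \<subseteq> S" "S \<inter> T = {0}" by (auto simp: \<S>_def Gr_iff)
      have "(x \<squnion> T) \<inter> S = x \<squnion> (T \<inter> S)" using S x' T by (intro modular)
      also have "T \<inter> S = {0}" using S by auto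
      also have "x \<squnion> {0} = x" using x' subspace_0[of x] by (simp add: Un_absorb2)
      finally show "S \<in> between x (T \<squnion> x) UNIV k"
        using S by (auto simp: between_def Un_commute)
    next
      fix S assume "S \<in> between x (T \<squnion> x) UNIV k"
      then have S: "subspace S" "dim S = k" "x \<subseteq> S" "S \<inter> (T \<squnion> x) = x" by (auto simp: between_def)
      have "S \<inter> T \<subseteq> x \<inter> T" using S(4) join_ub(1)[of T x] by blast
      then have "S \<inter> T = {0}" using xT subspace_0[OF S(1)] subspace_0[OF T] by blast
      then show "S \<in> {S \<in> \<S>. x \<subseteq> S}" using S by (auto simp: \<S>_def Gr_iff)
    qed
    moreover have "dim (T \<squnion> x) = Suc (dim T)" using dim_join_point x' T by blast
    ultimately show ?thesis
      using card_between[of x "T \<squnion> x" UNIV k] x' k join_ub(2)[of x T] by (simp add: N_def)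
  qed
  have swap: "(\<Sum>S\<in>\<S>. \<Sum>x\<in>pts S. f x) = (\<Sum>x\<in>?P. f x) * N" for f :: "'v set \<Rightarrow> real"
  proof -
    have ptsS: "pts S = {x \<in> ?P. x \<subseteq> S}" if "S \<in> \<S>" for S
    proof -
      have "\<not> x \<subseteq> T" if "x \<in> pts S" for x
      proof
        assume "x \<subseteq> T"
        then have "x \<subseteq> {0}" using that \<open>S \<in> \<S>\<close> by (auto simp: \<S>_def pts_iff)
        then show False using point_nonzero[OF that] subspace_0[OF ptsD(2)[OF that]] by blast
      qed
      then show ?thesis by (auto simp: pts_iff)
    qed
    have "(\<Sum>S\<in>\<S>. \<Sum>x\<in>pts S. f x) = (\<Sum>S\<in>\<S>. \<Sum>x\<in>{x \<in> ?P. x \<subseteq> S}. f x)"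
      using ptsS by simp
    also have "\<dots> = (\<Sum>x\<in>?P. \<Sum>S\<in>{S \<in> \<S>. x \<subseteq> S}. f x)"
      by (rule sum.swap_restrict) auto
    also have "\<dots> = (\<Sum>x\<in>?P. f x * N)"
      by (intro sum.cong) (auto simp: N mult.commute)
    finally show ?thesis by (simp add: sum_distrib_right)
  qed
  have "(\<Sum>S\<in>\<S>. \<Sum>x\<in>pts S. (1::real)) = real (card \<S>) * qint q k"
  proof -
    have "(\<Sum>x\<in>pts S. (1::real)) = qint q k" if "S \<in> \<S>" for S
      using that card_pts[of S] by (simp add: \<S>_def Gr_iff)
    then show ?thesis by simp
  qed
  moreover have "real (card ?P) = qint q ?n - qint q (dim T)"
  proof -
    have "pts T \<subseteq> pts UNIV" by (auto simp: pts_iff)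
    then have "card ?P = card (pts UNIV) - card (pts T)" by (simp add: card_Diff_subset)
    moreover have "card (pts T) \<le> card (pts UNIV)" using \<open>pts T \<subseteq> pts UNIV\<close> by (simp add: card_mono)
    ultimately show ?thesis using card_pts[OF T] card_pts[of UNIV] by (simp add: of_nat_diff)
  qed
  \<comment> \<open>Constant weight 1 in \<open>swap\<close> counts the incident pairs of outside
    points and spaces S in two ways.\<close>
  ultimately have count: "real (card \<S>) * qint q k = (qint q ?n - qint q (dim T)) * N"
    using swap[of "\<lambda>_. 1"] by simp
  have "N > 0" unfolding N_def using k q_ge_2 by (intro mult_pos_pos gauss_pos) auto
  have "qint q k * \<beta> \<le> (\<Sum>x\<in>pts S. w x)" if "S \<in> \<S>" for S
    using contra that by (force simp: \<S>_def)
  then have "real (card \<S>) * (qint q k * \<beta>) \<le> (\<Sum>S\<in>\<S>. \<Sum>x\<in>pts S. w x)"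
    by (rule sum_bounded_below)
  also have "\<dots> = (\<Sum>x\<in>?P. w x) * N" by (rule swap)
  also have "\<dots> < \<beta> * (qint q ?n - qint q (dim T)) * N"
    using w \<open>N > 0\<close> by (rule mult_strict_right_mono)
  also have "\<dots> = real (card \<S>) * (qint q k * \<beta>)" using count by (simp add: mult_ac)
  finally show False by simp
qed

end

locale erdos_space = finite_vector_space scale q + erdos_params q k n
  for scale :: "'f::{field,finite} \<Rightarrow> 'v::ab_group_add \<Rightarrow> 'v" and q k n +
  assumes dim_V: "dim (UNIV :: 'v set) = n"
begin

lemma degree_le_g:
  assumes "\<F> \<subseteq> Gr scale k UNIV" "subspace A" "dim A \<le> k"
  shows "deg \<F> A \<le> g (dim A)"
proof -
  have "point_degree \<F> A \<le> card {F \<in> Gr scale k UNIV. A \<subseteq> F}"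
    unfolding point_degree_def using assms by (intro card_mono) auto
  then show ?thesis using card_supersets[of A UNIV k] assms dim_V by (simp add: g_def)
qed

lemma subspace_degree_sum: "real (subspace_degree scale \<F> S) = (\<Sum>x\<in>pts S. deg \<F> x)"
  by (simp add: subspace_degree_def pts_def)

lemma card_pts_diff:
  assumes "subspace F" "subspace T"
  shows "real (card (pts F - pts T)) = qint q (dim F) - qint q (dim (F \<inter> T))"
proof -
  have e: "pts F - pts T = pts F - pts (F \<inter> T)" by (auto simp: pts_iff)
  have sub: "pts (F \<inter> T) \<subseteq> pts F" by (auto simp: pts_iff)
  have "card (pts F - pts (F \<inter> T)) = card (pts F) - card (pts (F \<inter> T))"
    using sub by (simp add: card_Diff_subset)
  moreover have "card (pts (F \<inter> T)) \<le> card (pts F)" using sub by (simp add: card_mono)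
  ultimately show ?thesis
    using card_pts[OF assms(1)] card_pts[of "F \<inter> T"] assms subspace_inter[of F T] unfolding e
    by (simp add: of_nat_diff)
qed

text \<open>Strict inequality in the bound, witnessed by a single non-member. In this form it passes
  to subfamilies, see \<open>light_mono\<close>.\<close>

definition light :: "'v set set \<Rightarrow> bool" where
  "light \<F> \<longleftrightarrow> (\<exists>S\<in>Gr scale k UNIV - \<F>. real (subspace_degree scale \<F> S) < K * bd)"

text \<open>Members in \<open>\<A>\<close> are charged pointwise by \<alpha>; for the others
  \<open>weight_le\<close> gives the price c/K apiece. The S found by averaging is a non-member
  because it misses the cover T.\<close>

lemma light_by_weight:
  assumes \<F>: "\<F> \<subseteq> Gr scale k UNIV" and T: "subspace T" "dim T \<le> k"
    and cover: "\<And>F. F \<in> \<F> \<Longrightarrow> F \<inter> T \<noteq> {0}"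
    and \<A>: "\<A> \<subseteq> \<F>" "\<And>x. x \<in> pts UNIV \<Longrightarrow> \<not> x \<subseteq> T \<Longrightarrow> deg \<A> x \<le> \<alpha>"
    and R: "real (card (\<F> - \<A>)) \<le> R" and num: "\<alpha> + c * R / K < bd"
  shows "light \<F>"
proof -
  let ?P = "pts UNIV - pts T"
  let ?R = "\<F> - \<A>"
  define D where "D = qint q n - qint q (dim T)"
  have cardP: "real (card ?P) = D"
    using card_pts_diff[OF subspace_UNIV T(1)] dim_V by (simp add: D_def)
  have deg: "point_degree \<F> x = point_degree \<A> x + point_degree ?R x" for x
  proof -
    have "{F \<in> \<F>. x \<subseteq> F} = {F \<in> \<A>. x \<subseteq> F} \<union> {F \<in> ?R. x \<subseteq> F}" using \<A>(1) by auto
    then show ?thesis unfolding point_degree_def by (simp add: card_Un_disjoint disjoint_iff)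
  qed
  have "(\<Sum>x\<in>?P. deg \<A> x) \<le> real (card ?P) * \<alpha>"
    using \<A>(2) by (intro sum_bounded_above) (auto simp: pts_iff)
  moreover have "(\<Sum>x\<in>?P. deg ?R x) \<le> R * (K - 1)"
  proof -
    have "(\<Sum>x\<in>?P. deg ?R x) = (\<Sum>x\<in>?P. \<Sum>F\<in>{F \<in> ?R. x \<subseteq> F}. 1)"
      by (simp add: point_degree_def)
    also have "\<dots> = (\<Sum>F\<in>?R. \<Sum>x\<in>{x \<in> ?P. x \<subseteq> F}. 1)"
      by (rule sum.swap_restrict) auto
    also have "\<dots> = (\<Sum>F\<in>?R. real (card (pts F - pts T)))"
    proof (intro sum.cong refl)
      fix F assume "F \<in> ?R"
      have "{x \<in> ?P. x \<subseteq> F} = pts F - pts T" by (auto simp: pts_iff)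
      then show "(\<Sum>x\<in>{x \<in> ?P. x \<subseteq> F}. 1) = real (card (pts F - pts T))" by simp
    qed
    also have "\<dots> \<le> real (card ?R) * (K - 1)"
    proof (rule sum_bounded_above)
      fix F assume F: "F \<in> ?R"
      then have F': "subspace F" "dim F = k" using \<F> by (auto simp: Gr_iff)
      have "dim (F \<inter> T) \<ge> 1" using dim_Int_pos[OF F'(1) T(1)] cover F by auto
      then have "qint q (dim (F \<inter> T)) \<ge> 1" using qint_mono[OF q2, of 1] qint_1[OF q2] by fastforce
      then show "real (card (pts F - pts T)) \<le> K - 1" using card_pts_diff[OF F'(1) T(1)] F' by simp
    qed
    also have "\<dots> \<le> R * (K - 1)" using R K_ge_7 by (intro mult_right_mono) auto
    finally show ?thesis .
  qed
  ultimately have sum: "(\<Sum>x\<in>?P. deg \<F> x) \<le> D * \<alpha> + R * (K - 1)"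
    using cardP by (simp add: deg sum.distrib)
  have tK: "qint q (dim T) \<le> K" using T by (intro qint_mono[OF q2])
  have "K < qint q n"
  proof -
    have "qint q (Suc k) \<le> qint q n" using n_ge by (intro qint_mono[OF q2]) auto
    moreover have "K \<le> Q * K" using Q2 K_pos by simp
    ultimately show ?thesis using qint_Suc[OF q2, of k] by simp
  qed
  then have D: "D > 0" "qint q n - K \<le> D" using tK by (auto simp: D_def)
  have R0: "R \<ge> 0" using R by linarith
  have "R * (K - 1) * K \<le> R * (c * (qint q n - K))"
    using weight_le R0 by (simp add: mult.assoc mult_left_mono)
  also have "\<dots> \<le> R * (c * D)" using D c_pos R0 by (intro mult_left_mono) auto
  finally have "R * (K - 1) \<le> c * R / K * D" using K_pos by (simp add: field_simps)
  then have "D * \<alpha> + R * (K - 1) \<le> (\<alpha> + c * R / K) * D" by (simp add: algebra_simps)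
  also have "\<dots> < bd * D" using num D by (intro mult_strict_right_mono)
  finally have "(\<Sum>x\<in>?P. deg \<F> x) < bd * (qint q (dim (UNIV :: 'v set)) - qint q (dim T))"
    using sum unfolding D_def dim_V by linarith
  then obtain S where S: "S \<in> Gr scale k UNIV" "S \<inter> T = {0}"
      "(\<Sum>x\<in>pts S. deg \<F> x) < K * bd"
    using exists_light_subspace[OF T(1), of k "\<lambda>x. deg \<F> x" bd] T n_ge k_ge_3 dim_V by auto
  moreover have "S \<notin> \<F>" using cover[of S] S by auto
  ultimately show ?thesis unfolding light_def by (auto simp: subspace_degree_sum)
qed

end

section \<open>Maximal intersecting families with a cover of dimension two\<close>

locale maximal_family = erdos_space scale q k n
  for scale :: "'f::{field,finite} \<Rightarrow> 'v::ab_group_add \<Rightarrow> 'v" and q k n +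
  fixes \<F> :: "'v set set"
  assumes family: "\<F> \<subseteq> Gr scale k UNIV"
    and meet: "\<And>F F'. F \<in> \<F> \<Longrightarrow> F' \<in> \<F> \<Longrightarrow> F \<inter> F' \<noteq> {0}"
    and maximal: "\<And>G. G \<in> Gr scale k UNIV \<Longrightarrow> (\<And>F. F \<in> \<F> \<Longrightarrow> G \<inter> F \<noteq> {0}) \<Longrightarrow> G \<in> \<F>"
    and no_center: "\<And>x. x \<in> pts UNIV \<Longrightarrow> \<exists>F\<in>\<F>. \<not> x \<subseteq> F"
begin

section \<open>Covers of a maximal family\<close>

definition cover :: "'v set \<Rightarrow> bool" where
  "cover T \<longleftrightarrow> subspace T \<and> (\<forall>F\<in>\<F>. F \<inter> T \<noteq> {0})"

lemma member: "F \<in> \<F> \<Longrightarrow> subspace F" "F \<in> \<F> \<Longrightarrow> dim F = k"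
  using family by (auto simp: Gr_iff)

lemma member_cover: "F \<in> \<F> \<Longrightarrow> cover F"
  unfolding cover_def using meet member(1) by blast

lemma coverD: "cover T \<Longrightarrow> subspace T" "cover T \<Longrightarrow> F \<in> \<F> \<Longrightarrow> F \<inter> T \<noteq> {0}"
  unfolding cover_def by blast+

lemma cover_mono:
  assumes T: "cover T" "T \<subseteq> T'" "subspace T'"
  shows "cover T'"
  unfolding cover_def
proof (intro conjI ballI)
  fix F assume F: "F \<in> \<F>"
  obtain x where "x \<in> pts UNIV" "x \<subseteq> F" "x \<subseteq> T"
    using common_point[OF member(1)[OF F] coverD(1)[OF T(1)] coverD(2)[OF T(1) F]] by blast
  then show "F \<inter> T' \<noteq> {0}" using T by (intro Int_nonzeroI[of x]) auto
qed (rule T)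

text \<open>Otherwise A extends to a k-space S disjoint from B. Containing a cover, S meets all
  members and belongs to the family by maximality, yet it misses the cover B.\<close>

lemma covers_meet:
  assumes A: "cover A" "dim A \<le> k" and B: "cover B" "dim B \<le> k"
  shows "A \<inter> B \<noteq> {0}"
proof
  assume "A \<inter> B = {0}"
  then obtain S where S: "S \<in> Gr scale k UNIV" "A \<subseteq> S" "S \<inter> B = {0}"
    using exists_complementary[of A B k] A B n_ge dim_V coverD(1) by auto
  have "cover S" using cover_mono[OF A(1) S(2)] S(1) by (simp add: Gr_iff)
  then have "S \<in> \<F>" using S(1) coverD(2)[of S] by (intro maximal) (auto simp: Int_commute)
  then show False using S(3) coverD(2)[OF B(1)] by blast
qed

lemma exists_missing:
  assumes "x \<in> pts UNIV"
  obtains F where "F \<in> \<F>" "\<not> x \<subseteq> F" "x \<inter> F = {0}"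
proof -
  obtain F where F: "F \<in> \<F>" "\<not> x \<subseteq> F" using no_center[OF assms] by blast
  then show ?thesis using that[of F] point_Int[OF assms member(1)[OF F(1)]] by simp
qed

lemma degree_non_cover:
  assumes A: "subspace A" "dim A < k" "\<not> cover A"
  shows "deg \<F> A \<le> K * g (Suc (dim A))"
proof -
  obtain F where F: "F \<in> \<F>" "F \<inter> A = {0}" using A by (auto simp: cover_def)
  have "deg \<F> A \<le> qint q (dim F) * g (Suc (dim A))"
  proof (rule degree_branch)
    fix A' assume "subspace A'" "A \<subseteq> A'" "dim A' = Suc (dim A)"
    then show "deg \<F> A' \<le> g (Suc (dim A))"
      using degree_le_g[OF family, of A'] A by simp
  qed (use A F member meet in auto)
  then show ?thesis using member(2)[OF F(1)] by simp
qed

lemma degree_line: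
  assumes "subspace A" "dim A = 2" "\<not> cover A"
  shows "deg \<F> A \<le> K * g 3"
  using degree_non_cover[of A] assms k_ge_3 by (simp add: eval_nat_numeral)

text \<open>T2 meets T0 and T1 in different points and therefore lies in Z. A member meeting Z in a
  single point would have that point on all three sides, but the sides are not concurrent; so it
  contains a two-space of Z.\<close>

lemma triangle:
  assumes T: "cover T0" "cover T1" "cover T2" "dim T0 = 2" "dim T1 = 2" "dim T2 = 2"
    and ne: "T0 \<noteq> T1" and nc: "\<not> T0 \<inter> T1 \<subseteq> T2"
  shows "light \<F> \<or> (k = 3 \<and> (\<exists>Z\<in>Gr scale 3 UNIV. \<F> = H3 scale Z))"
proof -
  define X where "X = T0 \<inter> T1"
  define Z where "Z = T0 \<squnion> T1"
  have s: "subspace T0" "subspace T1" "subspace T2" using T coverD by auto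
  have c: "A \<inter> B \<noteq> {0}" if "A \<in> {T0, T1, T2}" "B \<in> {T0, T1, T2}" for A B
    using that T k_ge_3 by (intro covers_meet) auto
  have X: "X \<in> pts UNIV" and Z: "dim Z = 3" "subspace Z"
    using lines_meet[of T0 T1] s T ne c by (auto simp: X_def Z_def)
  have TZ: "T0 \<subseteq> Z" "T1 \<subseteq> Z" using join_ub[of T0 T1] join_ub[of T1 T0] by (auto simp: Z_def)
  obtain p0 where p0: "p0 \<in> pts T2" "p0 \<subseteq> T0" using common_point[OF s(3,1) c] by blast
  obtain p1 where p1: "p1 \<in> pts T2" "p1 \<subseteq> T1" using common_point[OF s(3,2) c] by blast
  have not_common: "x = X" if "x \<in> pts UNIV" "x \<subseteq> T0" "x \<subseteq> T1" for x
    using point_eq[OF that(1) X] that by (simp add: X_def)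
  have "p0 \<noteq> p1"
  proof
    assume "p0 = p1"
    then have "p0 = X" using not_common p0 p1 ptsD(1) by blast
    then show False using p0 nc ptsD(3) by (auto simp: X_def)
  qed
  then have "p0 \<squnion> p1 = T2" using two_points_line[OF p0(1) p1(1)] s T by auto
  then have T2Z: "T2 \<subseteq> Z"
    using join_least[of p0 Z p1] p0 p1 TZ Z by auto
  have two: "dim (F \<inter> Z) \<ge> 2" if F: "F \<in> \<F>" for F
  proof (rule ccontr)
    assume "\<not> ?thesis"
    then have d: "dim (F \<inter> Z) \<le> 1" by simp
    have sF: "subspace F" "subspace (F \<inter> Z)" using member[OF F] Z subspace_inter by auto
    have pt: "\<exists>x\<in>pts UNIV. x \<subseteq> F \<inter> T" if "T \<in> {T0, T1, T2}" for T
    proof -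
      have T': "cover T" using that T by auto
      obtain x where "x \<in> pts UNIV" "x \<subseteq> F" "x \<subseteq> T"
        using common_point[OF sF(1) coverD(1)[OF T'] coverD(2)[OF T' F]] by blast
      then show ?thesis by blast
    qed
    obtain r0 r1 r2 where r: "r0 \<in> pts UNIV" "r0 \<subseteq> F \<inter> T0" "r1 \<in> pts UNIV" "r1 \<subseteq> F \<inter> T1"
      "r2 \<in> pts UNIV" "r2 \<subseteq> F \<inter> T2"
      using pt[of T0] pt[of T1] pt[of T2] by blast
    have uniq: "x = F \<inter> Z" if "x \<in> pts UNIV" "x \<subseteq> F \<inter> Z" for x
      using that d sF ptsD by (intro subspace_eqI) auto
    have sub: "r0 \<subseteq> F \<inter> Z" "r1 \<subseteq> F \<inter> Z" "r2 \<subseteq> F \<inter> Z" using r TZ T2Z by blast+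
    have eq: "r1 = r0" "r2 = r0"
      using uniq[OF r(1) sub(1)] uniq[OF r(3) sub(2)] uniq[OF r(5) sub(3)] by simp_all
    have "r0 = X" "r0 \<subseteq> T2" using not_common[of r0] r unfolding eq by simp_all
    then show False using nc by (simp add: X_def)
  qed
  have \<F>: "\<F> = {F \<in> Gr scale k UNIV. dim (F \<inter> Z) \<ge> 2}"
  proof (intro set_eqI iffI)
    fix G assume "G \<in> \<F>"
    then show "G \<in> {F \<in> Gr scale k UNIV. dim (F \<inter> Z) \<ge> 2}" using two family by auto
  next
    fix G assume G: "G \<in> {F \<in> Gr scale k UNIV. dim (F \<inter> Z) \<ge> 2}"
    show "G \<in> \<F>"
    proof (rule maximal)
      show "G \<in> Gr scale k UNIV" using G by simp
      fix F assume F: "F \<in> \<F>"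
      have *: "(G \<inter> Z) \<inter> (F \<inter> Z) \<noteq> {0}"
        using G two[OF F] Z member(1)[OF F]
        by (intro dim_Int_gt[of _ _ Z] subspace_inter) (auto simp: Gr_iff)
      then obtain x where "x \<in> pts UNIV" "x \<subseteq> G \<inter> Z" "x \<subseteq> F \<inter> Z"
      proof -
        have "subspace (G \<inter> Z)" "subspace (F \<inter> Z)"
          using G Z member(1)[OF F] by (auto simp: Gr_iff intro: subspace_inter)
        with * that show ?thesis using common_point[of "G \<inter> Z" "F \<inter> Z"] by blast
      qed
      then show "G \<inter> F \<noteq> {0}" by (intro Int_nonzeroI[of x]) auto
    qed
  qed
  show ?thesis
  proof (cases "k = 3")
    case True
    then have "\<F> = H3 scale Z" using \<F> by (simp add: H3_def)
    then show ?thesis using True Z by (auto simp: Gr_iff)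
  next
    case False
    then have k4: "k \<ge> 4" using k_ge_3 by simp
    have "light \<F>"
    proof (rule light_by_weight[where T = Z and \<A> = \<F> and \<alpha> = "qint q 3 * g 3" and R = 0])
      show "F \<inter> Z \<noteq> {0}" if "F \<in> \<F>" for F
        using two[OF that] dim_Int_pos[of F Z] member(1)[OF that] Z by linarith
      fix x assume x: "x \<in> pts UNIV" "\<not> x \<subseteq> Z"
      have "real (card {F \<in> \<F>. x \<subseteq> F}) \<le> real (card (Gr scale 2 Z)) * g 3"
      proof (rule card_UN_bound[where T = "\<lambda>l. {F \<in> \<F>. l \<squnion> x \<subseteq> F}"])
        show "{F \<in> \<F>. x \<subseteq> F} \<subseteq> (\<Union>l\<in>Gr scale 2 Z. {F \<in> \<F>. l \<squnion> x \<subseteq> F})"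
        proof
          fix F assume F: "F \<in> {F \<in> \<F>. x \<subseteq> F}"
          then have sF: "subspace F" "subspace (F \<inter> Z)" using member Z subspace_inter by auto
          obtain l where "subspace l" "l \<subseteq> span (F \<inter> Z)" "dim l = 2"
            using choose_subspace_of_subspace two F by blast
          then have l: "subspace l" "l \<subseteq> F" "l \<subseteq> Z" "dim l = 2" using sF(2) by auto
          then have "l \<squnion> x \<subseteq> F" using F sF by (intro join_least) auto
          then show "F \<in> (\<Union>l\<in>Gr scale 2 Z. {F \<in> \<F>. l \<squnion> x \<subseteq> F})"
            using F l by (auto simp: Gr_iff)
        qed
        fix l assume l: "l \<in> Gr scale 2 Z"
        then have "dim (l \<squnion> x) = 3"
          using dim_join_point[OF x(1), of l] x(2) by (auto simp: Gr_iff)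
        then show "real (card {F \<in> \<F>. l \<squnion> x \<subseteq> F}) \<le> g 3"
          using degree_le_g[OF family, of "l \<squnion> x"] k_ge_3 by (simp add: point_degree_def)
      qed auto
      moreover have "real (card (Gr scale 2 Z)) = qint q 3"
      proof -
        have "qint q 2 > 0" by (rule qint_pos[OF q2]) simp
        then have "gauss q 3 2 = qint q 3"
          using gauss_Suc[OF q2, of 1 3] gauss_1[of q 3] by (simp add: eval_nat_numeral)
        then show ?thesis using card_Gr[OF Z(2)] Z(1) by simp
      qed
      ultimately show "deg \<F> x \<le> qint q 3 * g 3" by (simp add: point_degree_def)
    qed (use family Z k_ge_3 num_triangle[OF k4] in auto)
    then show ?thesis ..
  qed
qed

text \<open>A member not containing T passes through some point P of T and meets a member F1 missing
  P in a point y. If y were in T, the member would contain P + y = T. As F1 meets T, at most K - 1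
  points y remain, and by uniqueness of T the two-space P + y is no cover and has degree at most K
  \<open>g 3\<close>.\<close>

lemma single_line:
  assumes T: "cover T" "dim T = 2" and unique: "\<And>T'. cover T' \<Longrightarrow> dim T' = 2 \<Longrightarrow> T' = T"
  shows "light \<F>"
proof -
  have sT: "subspace T" using T coverD by auto
  define \<A> where "\<A> = {F \<in> \<F>. T \<subseteq> F}"
  define C where "C = (K - 1) * (K * g 3)"
  have pencil: "real (card {F \<in> \<F>. P \<subseteq> F \<and> \<not> T \<subseteq> F}) \<le> C" if P: "P \<in> pts T" for P
  proof -
    obtain F1 where F1: "F1 \<in> \<F>" "\<not> P \<subseteq> F1" using exists_missing ptsD(1)[OF P] by blast
    have sF1: "subspace F1" "dim F1 = k" using member F1 by auto
    have "real (card {F \<in> \<F>. P \<subseteq> F \<and> \<not> T \<subseteq> F}) \<le> real (card (pts F1 - pts T)) * (K * g 3)"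
    proof (rule card_UN_bound[where T = "\<lambda>y. {F \<in> \<F>. P \<squnion> y \<subseteq> F}"])
      show "{F \<in> \<F>. P \<subseteq> F \<and> \<not> T \<subseteq> F} \<subseteq> (\<Union>y\<in>pts F1 - pts T. {F \<in> \<F>. P \<squnion> y \<subseteq> F})"
      proof
        fix F assume F: "F \<in> {F \<in> \<F>. P \<subseteq> F \<and> \<not> T \<subseteq> F}"
        then have sF: "subspace F" using member by auto
        obtain y where y: "y \<in> pts F" "y \<in> pts F1"
          using common_point[OF sF sF1(1) meet[of F F1]] F F1 by blast
        have le: "P \<squnion> y \<subseteq> F" using F y ptsD sF by (intro join_least) auto
        have "y \<notin> pts T"
        proof
          assume yT: "y \<in> pts T"
          have "P \<noteq> y" using F1 ptsD(3)[OF y(2)] by auto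
          then have "P \<squnion> y = T" using two_points_line[OF P yT] sT T by auto
          then show False using le F by auto
        qed
        then show "F \<in> (\<Union>y\<in>pts F1 - pts T. {F \<in> \<F>. P \<squnion> y \<subseteq> F})" using F y le by auto
      qed
      fix y assume y: "y \<in> pts F1 - pts T"
      have yT: "\<not> y \<subseteq> T" using y by (auto simp: pts_iff)
      then have "\<not> y \<subseteq> P" using ptsD(3)[OF P] by auto
      then have d: "dim (P \<squnion> y) = 2"
        using dim_join_point[of y P] y P by (auto simp: pts_iff)
      have "\<not> cover (P \<squnion> y)"
        using unique[OF _ d] yT join_ub(2)[of y P] by auto
      then show "real (card {F \<in> \<F>. P \<squnion> y \<subseteq> F}) \<le> K * g 3"
        using degree_line[of "P \<squnion> y"] d by (simp add: point_degree_def)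
    qed auto
    also have "\<dots> \<le> C"
    proof -
      have "dim (F1 \<inter> T) \<ge> 1" using dim_Int_pos[OF sF1(1) sT] coverD(2)[OF T(1) F1(1)] by simp
      then have "qint q (dim (F1 \<inter> T)) \<ge> 1" using qint_mono[OF q2, of 1] qint_1[OF q2] by fastforce
      then have "real (card (pts F1 - pts T)) \<le> K - 1" using card_pts_diff[OF sF1(1) sT] sF1 by simp
      then show ?thesis unfolding C_def using K_pos g_nonneg by (intro mult_right_mono) auto
    qed
    finally show ?thesis .
  qed
  have "real (card (\<F> - \<A>)) \<le> real (card (pts T)) * C"
  proof (rule card_UN_bound[where T = "\<lambda>P. {F \<in> \<F>. P \<subseteq> F \<and> \<not> T \<subseteq> F}"])
    show "\<F> - \<A> \<subseteq> (\<Union>P\<in>pts T. {F \<in> \<F>. P \<subseteq> F \<and> \<not> T \<subseteq> F})"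
    proof
      fix F assume F: "F \<in> \<F> - \<A>"
      then have F': "F \<in> \<F>" by simp
      obtain P where "P \<in> pts T" "P \<subseteq> F"
        using common_point[OF member(1)[OF F'] sT coverD(2)[OF T(1) F']] by blast
      then show "F \<in> (\<Union>P\<in>pts T. {F \<in> \<F>. P \<subseteq> F \<and> \<not> T \<subseteq> F})" using F by (auto simp: \<A>_def)
    qed
  qed (use pencil in auto)
  then have R: "real (card (\<F> - \<A>)) \<le> (Q + 1) * (K - 1) * K * g 3"
    using card_pts[OF sT] T(2) qint_2 by (simp add: C_def mult_ac)
  show ?thesis
  proof (rule light_by_weight[OF family sT _ coverD(2)[OF T(1)] _ _ R num_single_cover])
    fix x assume x: "x \<in> pts UNIV" "\<not> x \<subseteq> T"
    have "{F \<in> \<A>. x \<subseteq> F} \<subseteq> {F \<in> \<F>. T \<squnion> x \<subseteq> F}"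
    proof
      fix F assume F: "F \<in> {F \<in> \<A>. x \<subseteq> F}"
      then have "subspace F" using member by (auto simp: \<A>_def)
      then have "T \<squnion> x \<subseteq> F" using F by (intro join_least) (auto simp: \<A>_def)
      then show "F \<in> {F \<in> \<F>. T \<squnion> x \<subseteq> F}" using F by (auto simp: \<A>_def)
    qed
    then have "point_degree \<A> x \<le> point_degree \<F> (T \<squnion> x)"
      unfolding point_degree_def by (intro card_mono) auto
    moreover have "dim (T \<squnion> x) = 3" using dim_join_point[OF x(1) sT x(2)] T by simp
    ultimately show "deg \<A> x \<le> g 3"
      using degree_le_g[OF family, of "T \<squnion> x"] k_ge_3 by simp
  qed (use T k_ge_3 in \<open>auto simp: \<A>_def\<close>)
qed

end

context maximal_family
begin

section \<open>Two-dimensional covers through a common point\<close>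

definition H1_full :: "'v set \<Rightarrow> 'v set \<Rightarrow> 'v set set" where
  "H1_full X M = H1_open scale k X M \<union> Gr scale k M"

lemma pencil:
  assumes X: "X \<in> pts UNIV" and center: "\<And>T. cover T \<Longrightarrow> dim T = 2 \<Longrightarrow> X \<subseteq> T"
    and T0: "cover T0" "dim T0 = 2" and T1: "cover T1" "dim T1 = 2" and ne: "T0 \<noteq> T1"
  shows "light \<F> \<or> (\<exists>M\<in>Gr scale (k + 1) UNIV. X \<subset> M \<and> \<F> = H1_full X M)"
proof -
  have sX: "subspace X" and dX: "dim X = 1" using X by (auto simp: pts_iff)
  have sT: "subspace T0" "subspace T1" using T0 T1 coverD(1) by auto
  define M where "M = span (\<Union>{T. cover T \<and> dim T = 2})"
  have sM: "subspace M" by (simp add: M_def)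
  have lineM: "T \<subseteq> M" if "cover T" "dim T = 2" for T
    using that span_superset[of "\<Union>{T. cover T \<and> dim T = 2}"] by (auto simp: M_def)
  have XM: "X \<subseteq> M" using center[OF T0] lineM[OF T0] by simp
  have coverM: "cover M" using cover_mono[OF T0(1) lineM[OF T0] sM] .
  have off: "F \<inter> X = {0}" if "F \<in> \<F>" "\<not> X \<subseteq> F" for F
    using point_Int[OF X member(1)[OF that(1)]] that by (simp add: Int_commute)
  \<comment> \<open>Each two-dimensional cover contains X and meets F in a further point, so it lies
    in (F \<inter> M) + X. Hence F \<inter> M is a complement of X in M, and its dimension l is the
    same for all F avoiding X.\<close>
  have hyper: "dim M = Suc (dim (F \<inter> M))" if F: "F \<in> \<F>" "\<not> X \<subseteq> F" for F
  proof -
    have sF: "subspace F" "subspace (F \<inter> M)" using member(1)[OF F(1)] sM subspace_inter by auto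
    have "M \<subseteq> (F \<inter> M) \<squnion> X"
      unfolding M_def
    proof (rule span_minimal)
      show "\<Union>{T. cover T \<and> dim T = 2} \<subseteq> (F \<inter> span (\<Union>{T. cover T \<and> dim T = 2})) \<squnion> X"
        unfolding M_def[symmetric]
      proof (rule Union_least)
        fix T assume "T \<in> {T. cover T \<and> dim T = 2}"
        then have T: "cover T" "dim T = 2" by auto
        obtain t where t: "t \<in> pts F" "t \<in> pts T"
          using common_point[OF sF(1) coverD(1)[OF T(1)] coverD(2)[OF T(1) F(1)]] by blast
        have XT: "X \<in> pts T" using X center[OF T] by (simp add: pts_iff)
        have "t \<noteq> X" using t F ptsD(3) by blast
        then have e: "t \<squnion> X = T" using two_points_line[OF t(2) XT] coverD(1)[OF T(1)] T by simp
        have "t \<subseteq> F \<inter> M" using ptsD(3)[OF t(1)] ptsD(3)[OF t(2)] lineM[OF T] by blast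
        then have "t \<union> X \<subseteq> (F \<inter> M) \<union> X" by blast
        then show "T \<subseteq> (F \<inter> M) \<squnion> X" using span_mono e by blast
      qed
    qed simp
    moreover have "(F \<inter> M) \<squnion> X \<subseteq> M" using XM sM by (intro join_least) auto
    ultimately have e: "(F \<inter> M) \<squnion> X = M" by blast
    have "\<not> X \<subseteq> F \<inter> M" using F by blast
    then show ?thesis using dim_join_point[OF X sF(2)] e by simp
  qed
  obtain F1 where F1: "F1 \<in> \<F>" "\<not> X \<subseteq> F1" using no_center[OF X] by blast
  have sF1: "subspace F1" "dim F1 = k" using member[OF F1(1)] by auto
  define l where "l = dim (F1 \<inter> M)"
  have dM: "dim M = Suc l" using hyper[OF F1] by (simp add: l_def)
  have dH: "dim (F \<inter> M) = l" if "F \<in> \<F>" "\<not> X \<subseteq> F" for F using hyper[OF that] dM by simp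
  have lk: "l \<le> k" using dim_subset[of "F1 \<inter> M" F1] sF1 by (simp add: l_def)
  have l2: "l \<ge> 2"
  proof -
    have "T0 \<inter> T1 \<noteq> {0}" using covers_meet[OF T0(1) _ T1(1)] T0 T1 k_ge_3 by simp
    then have "dim (T0 \<squnion> T1) = 3" using lines_meet[OF sT(1) T0(2) sT(2) T1(2) ne] by simp
    moreover have "T0 \<squnion> T1 \<subseteq> M" using lineM T0 T1 sM by (intro join_least) auto
    ultimately show ?thesis using dim_subset[of "T0 \<squnion> T1" M] dM by simp
  qed
  have meetF1: "\<exists>y. y \<in> pts F \<and> y \<in> pts F1 \<and> y \<noteq> X \<and> dim (X \<squnion> y) = 2 \<and> X \<squnion> y \<subseteq> F"
    if F: "F \<in> \<F>" "X \<subseteq> F" for F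
  proof -
    have sF: "subspace F" using member(1)[OF F(1)] .
    obtain y where y: "y \<in> pts F" "y \<in> pts F1"
      using common_point[OF sF sF1(1) meet[OF F(1) F1(1)]] by blast
    have yX: "y \<noteq> X" using F1(2) ptsD(3)[OF y(2)] by blast
    then have "\<not> y \<subseteq> X" using point_eq[OF y(1) X] by blast
    then have "dim (X \<squnion> y) = 2" using dim_join_point[OF ptsD(1)[OF y(1)] sX] dX by simp
    moreover have "X \<squnion> y \<subseteq> F" using F ptsD(3)[OF y(1)] sF by (intro join_least)
    ultimately show ?thesis using y yX by blast
  qed
  show ?thesis
  proof (cases "l = k")
    case True
    have F1M: "F \<subseteq> M" if "F \<in> \<F>" "\<not> X \<subseteq> F" for F
    proof -
      have "F \<inter> M = F"
        using dH[OF that] True member[OF that(1)] sM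
        by (intro subspace_eqI) (auto intro: subspace_inter)
      then show ?thesis by blast
    qed
    \<comment> \<open>All members satisfy \<open>P\<close>, and any two spaces with \<open>P\<close>
      meet; by maximality every k-space with \<open>P\<close> is a member.\<close>
    define P where "P F \<longleftrightarrow> subspace F \<and> (X \<subseteq> F \<and> dim (F \<inter> M) \<ge> 2 \<or> F \<subseteq> M \<and> dim F = k)" for F
    have PF: "P F" if F: "F \<in> \<F>" for F
    proof (cases "X \<subseteq> F")
      case True
      then obtain y where y: "y \<in> pts F1" "dim (X \<squnion> y) = 2" "X \<squnion> y \<subseteq> F" using meetF1[OF F] by blast
      have "y \<subseteq> M" using F1M[OF F1] ptsD(3)[OF y(1)] by blast
      then have "X \<squnion> y \<subseteq> M" using XM sM by (intro join_least)
      then have "dim (X \<squnion> y) \<le> dim (F \<inter> M)" using y by (intro dim_subset) auto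
      then show ?thesis using True y member(1)[OF F] by (simp add: P_def)
    next
      case False
      then show ?thesis using F1M[OF F] member[OF F] by (simp add: P_def)
    qed
    have PP: "F \<inter> G \<noteq> {0}" if "P F" "P G" for F G
    proof (cases "X \<subseteq> F \<and> X \<subseteq> G")
      case True
      then show ?thesis using Int_nonzeroI[OF X] by blast
    next
      case False
      have s: "subspace (F \<inter> M)" "subspace (G \<inter> M)" "subspace F" "subspace G"
        using that sM by (auto simp: P_def intro: subspace_inter)
      have 1: "dim (H \<inter> M) \<ge> 2" if "P H" for H
        using that k_ge_3 by (auto simp: P_def Int_absorb2)
      have 2: "dim (H \<inter> M) = k" if "P H" "\<not> X \<subseteq> H" for H
        using that by (auto simp: P_def Int_absorb2)
      \<comment> \<open>One of the two avoids X and so meets M in dimension k, the other in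
        dimension at least 2, and dim M = k + 1.\<close>
      have "dim M < dim (F \<inter> M) + dim (G \<inter> M)"
        using False 1[OF that(1)] 1[OF that(2)] 2[of F] 2[of G] that dM \<open>l = k\<close> by linarith
      then have ne: "(F \<inter> M) \<inter> (G \<inter> M) \<noteq> {0}"
        using s sM by (intro dim_Int_gt[of _ _ M]) auto
      obtain x where "x \<in> pts UNIV" "x \<subseteq> F \<inter> M" "x \<subseteq> G \<inter> M"
        using common_point[OF s(1,2) ne] by blast
      then show ?thesis by (intro Int_nonzeroI[of x]) auto
    qed
    have "\<F> = H1_full X M"
    proof (intro set_eqI iffI)
      fix F assume F: "F \<in> \<F>"
      then show "F \<in> H1_full X M" using PF[OF F] member[OF F]
        by (auto simp: P_def H1_full_def H1_open_def Gr_iff)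
    next
      fix G assume "G \<in> H1_full X M"
      then have G: "G \<in> Gr scale k UNIV" "P G" by (auto simp: P_def H1_full_def H1_open_def Gr_iff)
      show "G \<in> \<F>" using PP[OF G(2) PF] by (rule maximal[OF G(1)])
    qed
    moreover have "X \<subset> M" using XM dM dX l2 by auto
    moreover have "M \<in> Gr scale (k + 1) UNIV" using sM dM True by (simp add: Gr_iff)
    ultimately show ?thesis by blast
  next
    case False
    then have lk: "l < k" using lk by simp
    \<comment> \<open>The members through X are divided by whether they meet M in more than X
      (\<open>N\<close>) or only in X (\<open>B\<close>); \<open>O'\<close> holds those avoiding
      X.\<close>
    define N where "N = {F \<in> \<F>. X \<subseteq> F \<and> dim (F \<inter> M) \<ge> 2}"
    define B where "B = {F \<in> \<F>. X \<subseteq> F \<and> \<not> dim (F \<inter> M) \<ge> 2}"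
    define O' where "O' = {F \<in> \<F>. \<not> X \<subseteq> F}"
    have split: "\<F> = N \<union> B \<union> O'" by (auto simp: N_def B_def O'_def)
    have FM: "F \<inter> M = X" if "F \<in> B" for F
    proof -
      have F: "subspace (F \<inter> M)" "X \<subseteq> F \<inter> M" "dim (F \<inter> M) \<le> 1"
        using that XM sM member(1)[of F] by (auto simp: B_def intro: subspace_inter)
      then show ?thesis using subspace_eqI[OF sX F(1,2)] dX by simp
    qed
    \<comment> \<open>A member of \<open>B\<close> meets F1 in a point y outside M, since F1 avoids
      X. As all two-dimensional covers lie in M, X + y is none of them.\<close>
    have cardB: "real (card B) \<le> (K - qint q l) * K * g 3"
    proof -
      have "real (card B) \<le> real (card (pts F1 - pts M)) * (K * g 3)"
      proof (rule card_UN_bound[where T = "\<lambda>y. {F \<in> \<F>. X \<squnion> y \<subseteq> F}"])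
        show "B \<subseteq> (\<Union>y\<in>pts F1 - pts M. {F \<in> \<F>. X \<squnion> y \<subseteq> F})"
        proof
          fix F assume F: "F \<in> B"
          then have F': "F \<in> \<F>" "X \<subseteq> F" by (auto simp: B_def)
          obtain y where y: "y \<in> pts F" "y \<in> pts F1" "y \<noteq> X" "X \<squnion> y \<subseteq> F" using meetF1[OF F'] by blast
          have "y \<notin> pts M"
          proof
            assume "y \<in> pts M"
            then have "y \<subseteq> X" using FM[OF F] ptsD(3)[OF y(1)] ptsD(3)[of y M] by blast
            then show False using point_eq[OF y(1) X] y(3) by blast
          qed
          then show "F \<in> (\<Union>y\<in>pts F1 - pts M. {F \<in> \<F>. X \<squnion> y \<subseteq> F})" using y F' by blast
        qed
        fix y assume y: "y \<in> pts F1 - pts M"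
        have yM: "\<not> y \<subseteq> M" using y by (auto simp: pts_iff)
        then have "\<not> y \<subseteq> X" using XM by blast
        then have d: "dim (X \<squnion> y) = 2" using dim_join_point[OF _ sX, of y] y dX ptsD(1)[of y F1] by auto
        have "\<not> cover (X \<squnion> y)" using lineM[OF _ d] yM join_ub(2)[of y X] by blast
        then show "real (card {F \<in> \<F>. X \<squnion> y \<subseteq> F}) \<le> K * g 3"
          using degree_line[of "X \<squnion> y"] d by (simp add: point_degree_def)
      qed auto
      then show ?thesis using card_pts_diff[OF sF1(1) sM] sF1(2) by (simp add: l_def mult.assoc)
    qed
    have degN: "real (card {F \<in> N. x \<subseteq> F}) \<le> qint q l * g 3" if x: "x \<in> pts UNIV" "\<not> x \<subseteq> M" for x
    proof -
      have "real (card {F \<in> N. x \<subseteq> F}) \<le> real (card {L \<in> Gr scale 2 M. X \<subseteq> L}) * g 3"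
      proof (rule card_UN_bound[where T = "\<lambda>L. {F \<in> \<F>. L \<squnion> x \<subseteq> F}"])
        show "{F \<in> N. x \<subseteq> F} \<subseteq> (\<Union>L\<in>{L \<in> Gr scale 2 M. X \<subseteq> L}. {F \<in> \<F>. L \<squnion> x \<subseteq> F})"
        proof
          fix F assume "F \<in> {F \<in> N. x \<subseteq> F}"
          then have F: "F \<in> \<F>" "X \<subseteq> F" "dim (F \<inter> M) \<ge> 2" "x \<subseteq> F" by (auto simp: N_def)
          have sF: "subspace F" "subspace (F \<inter> M)" using member(1)[OF F(1)] sM subspace_inter by auto
          have "\<not> F \<inter> M \<subseteq> X" using dim_subset[of "F \<inter> M" X] dX F(3) by auto
          then obtain v where v: "v \<in> F \<inter> M" "v \<notin> X" by blast
          have d: "dim (X \<squnion> {v}) = 2" using dim_insert[of v X] v(2) sX dX by simp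
          have sub: "X \<squnion> {v} \<subseteq> F \<inter> M" using v F XM sF by (intro join_least) auto
          have "(X \<squnion> {v}) \<squnion> x \<subseteq> F" using sub F(4) sF(1) join_least[of "X \<squnion> {v}" F x] by blast
          moreover have "X \<squnion> {v} \<in> Gr scale 2 M" using d sub by (auto simp: Gr_iff)
          moreover have "X \<subseteq> X \<squnion> {v}" by (rule join_ub(1))
          ultimately show "F \<in> (\<Union>L\<in>{L \<in> Gr scale 2 M. X \<subseteq> L}. {F \<in> \<F>. L \<squnion> x \<subseteq> F})"
            using F(1) by blast
        qed
        fix L assume L: "L \<in> {L \<in> Gr scale 2 M. X \<subseteq> L}"
        have "\<not> x \<subseteq> L" using x L by (auto simp: Gr_iff)
        then have "dim (L \<squnion> x) = 3" using dim_join_point[OF x(1), of L] L by (auto simp: Gr_iff)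
        then show "real (card {F \<in> \<F>. L \<squnion> x \<subseteq> F}) \<le> g 3"
          using degree_le_g[OF family, of "L \<squnion> x"] k_ge_3 by (simp add: point_degree_def)
      qed auto
      also have "real (card {L \<in> Gr scale 2 M. X \<subseteq> L}) = qint q l"
        using card_supersets[OF sX sM XM, of 2] dX dM gauss_1[of q l] by simp
      finally show ?thesis .
    qed
    define J where "J = between {0} X M l"
    have cardJ: "real (card J) = Q ^ l"
      using card_between[of "{0}" X M l] sX sM XM dX dM subspace_0[OF sX] gauss_same[OF q2, of l]
      by (simp add: J_def)
    have HJ: "F \<inter> M \<in> J" if "F \<in> O'" for F
    proof -
      have F: "F \<in> \<F>" "\<not> X \<subseteq> F" using that by (auto simp: O'_def)
      have "F \<inter> M \<inter> X = {0}" using off[OF F] XM by blast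
      then show ?thesis
        using dH[OF F] member(1)[OF F(1)] sM subspace_0[OF member(1)[OF F(1)]] subspace_0[OF sM]
        by (auto simp: J_def between_def intro: subspace_inter)
    qed
    have sJ: "subspace H" "dim H = l" "H \<subseteq> M" if "H \<in> J" for H using that by (auto simp: J_def between_def)
    have "light \<F>"
    proof (cases "l = 2")
      case False
      then have l3: "l \<ge> 3" using l2 by simp
      \<comment> \<open>A member of \<open>O'\<close> through x contains x together with one of the
        q^l complements of X in M.\<close>
      have degO: "real (card {F \<in> O'. x \<subseteq> F}) \<le> Q ^ l * g (Suc l)" if x: "x \<in> pts UNIV" "\<not> x \<subseteq> M" for x
      proof -
        have "real (card {F \<in> O'. x \<subseteq> F}) \<le> real (card J) * g (Suc l)"
        proof (rule card_UN_bound[where T = "\<lambda>H. {F \<in> \<F>. H \<squnion> x \<subseteq> F}"])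
          show "{F \<in> O'. x \<subseteq> F} \<subseteq> (\<Union>H\<in>J. {F \<in> \<F>. H \<squnion> x \<subseteq> F})"
          proof
            fix F assume F: "F \<in> {F \<in> O'. x \<subseteq> F}"
            then have F': "F \<in> \<F>" "F \<inter> M \<in> J" using HJ[of F] by (auto simp: O'_def)
            have "(F \<inter> M) \<squnion> x \<subseteq> F" using F member(1)[OF F'(1)] by (intro join_least) auto
            then show "F \<in> (\<Union>H\<in>J. {F \<in> \<F>. H \<squnion> x \<subseteq> F})" using F' by blast
          qed
          fix H assume H: "H \<in> J"
          then have "\<not> x \<subseteq> H" using sJ(3) x(2) by blast
          then have "dim (H \<squnion> x) = Suc l" using dim_join_point[OF x(1) sJ(1)[OF H]] sJ(2)[OF H] by simp
          then show "real (card {F \<in> \<F>. H \<squnion> x \<subseteq> F}) \<le> g (Suc l)"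
            using degree_le_g[OF family, of "H \<squnion> x"] lk by (simp add: point_degree_def)
        qed auto
        then show ?thesis by (simp add: cardJ)
      qed
      show ?thesis
      proof (rule light_by_weight[where T = M and \<A> = "N \<union> O'" and R = "(K - qint q l) * K * g 3"
            and \<alpha> = "qint q l * g 3 + Q ^ l * g (Suc l)"])
        show "F \<inter> M \<noteq> {0}" if "F \<in> \<F>" for F using coverD(2)[OF coverM that] .
        show "qint q l * g 3 + Q ^ l * g (Suc l) + c * ((K - qint q l) * K * g 3) / K < bd"
          by (rule num_pencil[OF lk num_hyperplanes[OF l3 lk]])
        have "card (\<F> - (N \<union> O')) \<le> card B" using split by (intro card_mono) auto
        then show "real (card (\<F> - (N \<union> O'))) \<le> (K - qint q l) * K * g 3" using cardB by linarith
        fix x assume x: "x \<in> pts UNIV" "\<not> x \<subseteq> M"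
        have "{F \<in> N \<union> O'. x \<subseteq> F} = {F \<in> N. x \<subseteq> F} \<union> {F \<in> O'. x \<subseteq> F}" by blast
        then have "card {F \<in> N \<union> O'. x \<subseteq> F} \<le> card {F \<in> N. x \<subseteq> F} + card {F \<in> O'. x \<subseteq> F}"
          using card_Un_le[of "{F \<in> N. x \<subseteq> F}" "{F \<in> O'. x \<subseteq> F}"] by simp
        then show "deg (N \<union> O') x \<le> qint q l * g 3 + Q ^ l * g (Suc l)"
          using degN[OF x] degO[OF x] unfolding point_degree_def by linarith
      qed (use sM dM lk split family in auto)
    next
      case True
      \<comment> \<open>Here dim M = 3. Were \<open>B\<close> empty, all members would meet M in
        dimension at least 2, and F1 \<inter> M would be a two-dimensional cover avoiding X.\<close>
      have "B \<noteq> {}"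
      proof
        assume "B = {}"
        then have two: "dim (F \<inter> M) \<ge> 2" if "F \<in> \<F>" for F
          using that dH[OF that] True by (cases "X \<subseteq> F") (auto simp: B_def)
        have s1: "subspace (F1 \<inter> M)" using sF1 sM subspace_inter by blast
        have "cover (F1 \<inter> M)"
          unfolding cover_def
        proof (intro conjI ballI)
          fix F assume F: "F \<in> \<F>"
          have s: "subspace (F \<inter> M)" using member(1)[OF F] sM subspace_inter by blast
          have ne: "(F \<inter> M) \<inter> (F1 \<inter> M) \<noteq> {0}"
            using s s1 sM two[OF F] two[OF F1(1)] dM True by (intro dim_Int_gt[of _ _ M]) auto
          obtain x where "x \<in> pts UNIV" "x \<subseteq> F \<inter> M" "x \<subseteq> F1 \<inter> M"
            using common_point[OF s s1 ne] by blast
          then show "F \<inter> (F1 \<inter> M) \<noteq> {0}" by (intro Int_nonzeroI[of x]) auto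
        qed (rule s1)
        then have "X \<subseteq> F1 \<inter> M" by (rule center) (use True l_def in simp)
        then show False using F1 by blast
      qed
      then obtain F2 where F2: "F2 \<in> B" by blast
      then have F2': "F2 \<in> \<F>" by (simp add: B_def)
      have sF2: "subspace F2" "dim F2 = k" using member[OF F2'] by auto
      \<comment> \<open>Since F2 meets M only in X, a member avoiding X meets F2 outside M. It is
        thus located by one of q^2 two-spaces of M and one of K - 1 points of F2.\<close>
      have cardO: "real (card O') \<le> Q^2 * (K - 1) * g 3"
      proof -
        have "real (card O') \<le> real (card (J \<times> (pts F2 - pts M))) * g 3"
        proof (rule card_UN_bound[where T = "\<lambda>p. {F \<in> \<F>. fst p \<squnion> snd p \<subseteq> F}"])
          show "O' \<subseteq> (\<Union>p\<in>J \<times> (pts F2 - pts M). {F \<in> \<F>. fst p \<squnion> snd p \<subseteq> F})"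
          proof
            fix F assume F: "F \<in> O'"
            then have F': "F \<in> \<F>" "\<not> X \<subseteq> F" by (auto simp: O'_def)
            have sF: "subspace F" using member(1)[OF F'(1)] .
            obtain y where y: "y \<in> pts F" "y \<in> pts F2"
              using common_point[OF sF sF2(1) meet[OF F'(1) F2']] by blast
            have "y \<notin> pts M"
            proof
              assume "y \<in> pts M"
              then have "y \<subseteq> X" using FM[OF F2] ptsD(3)[OF y(2)] ptsD(3)[of y M] by blast
              then have "y = X" using point_eq[OF y(1) X] by blast
              then show False using F'(2) ptsD(3)[OF y(1)] by blast
            qed
            moreover have "(F \<inter> M) \<squnion> y \<subseteq> F" using ptsD(3)[OF y(1)] sF by (intro join_least) auto
            ultimately show "F \<in> (\<Union>p\<in>J \<times> (pts F2 - pts M). {F \<in> \<F>. fst p \<squnion> snd p \<subseteq> F})"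
              using HJ[OF F] y F' by (intro UN_I[of "(F \<inter> M, y)"]) auto
          qed
          fix p assume p: "p \<in> J \<times> (pts F2 - pts M)"
          obtain H y where Hy: "p = (H, y)" "H \<in> J" "y \<in> pts F2 - pts M" using p by blast
          have "\<not> y \<subseteq> H" using Hy sJ(3)[of H] by (auto simp: pts_iff)
          then have "dim (H \<squnion> y) = 3"
            using dim_join_point[of y H] sJ(1,2)[OF Hy(2)] Hy(3) ptsD(1)[of y F2] True by simp
          then show "real (card {F \<in> \<F>. fst p \<squnion> snd p \<subseteq> F}) \<le> g 3"
            using degree_le_g[OF family, of "H \<squnion> y"] k_ge_3 Hy by (simp add: point_degree_def)
        qed auto
        moreover have "real (card (J \<times> (pts F2 - pts M))) = Q^2 * (K - 1)"
          using card_pts_diff[OF sF2(1) sM] FM[OF F2] sF2(2) dX cardJ True qint_1[OF q2]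
          by (simp add: card_cartesian_product)
        ultimately show ?thesis by simp
      qed
      show ?thesis
      proof (rule light_by_weight[where T = M and \<A> = N
            and R = "(K - qint q 2) * K * g 3 + Q^2 * (K - 1) * g 3" and \<alpha> = "qint q 2 * g 3"])
        show "F \<inter> M \<noteq> {0}" if "F \<in> \<F>" for F using coverD(2)[OF coverM that] .
        have "card (\<F> - N) \<le> card (B \<union> O')" using split by (intro card_mono) auto
        also have "\<dots> \<le> card B + card O'" by (rule card_Un_le)
        finally show "real (card (\<F> - N)) \<le> (K - qint q 2) * K * g 3 + Q^2 * (K - 1) * g 3"
          using cardB cardO True by simp
        show "deg N x \<le> qint q 2 * g 3" if "x \<in> pts UNIV" "\<not> x \<subseteq> M" for x
          using degN[OF that] True by (simp add: point_degree_def)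
      qed (use sM dM lk split family num_pencil_2 True in auto)
    qed
    then show ?thesis ..
  qed
qed

end

section \<open>Maximal intersecting families without a cover of dimension two\<close>

context maximal_family
begin

text \<open>Allows branching to start at the zero space when a whole family is counted.\<close>

lemma point_degree_0: "(\<And>G. G \<in> \<G> \<Longrightarrow> subspace G) \<Longrightarrow> point_degree \<G> {0} = card \<G>"
proof -
  assume "\<And>G. G \<in> \<G> \<Longrightarrow> subspace G"
  then have "{G \<in> \<G>. {0} \<subseteq> G} = \<G>" using subspace_0 by auto
  then show ?thesis by (simp add: point_degree_def)
qed

lemma nonempty: "\<F> \<noteq> {}"
proof
  assume "\<F> = {}"
  obtain S where "S \<in> Gr scale k UNIV"
    using exists_complementary[of "{0}" "{0}" k] n_ge dim_V by auto
  then have "S \<in> \<F>" using \<open>\<F> = {}\<close> by (intro maximal) auto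
  then show False using \<open>\<F> = {}\<close> by simp
qed

text \<open>Any member serves as the cover T, with every member charged by count.\<close>

lemma light_if_small:
  assumes "real (card \<F>) \<le> R" "c * R / K < bd"
  shows "light \<F>"
proof -
  obtain F0 where F0: "F0 \<in> \<F>" using nonempty by blast
  show ?thesis
  proof (rule light_by_weight[where T = F0 and \<A> = "{}" and \<alpha> = 0 and R = R])
    show "F \<inter> F0 \<noteq> {0}" if "F \<in> \<F>" for F using meet[OF that F0] .
  qed (use assms F0 member[OF F0] family in \<open>auto simp: point_degree_def\<close>)
qed

lemma dim_1_point: "subspace x \<Longrightarrow> dim x = 1 \<Longrightarrow> x \<in> pts UNIV"
  by (simp add: pts_iff)

lemma zero_Int: "subspace B \<Longrightarrow> {0} \<inter> B = {0}"
  using subspace_0 by auto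

section \<open>Branching along covers of least dimension \<open>l\<close>\<close>

context
  fixes l T
  assumes l: "3 \<le> l" "l \<le> k"
    and T: "cover T" "dim T = l"
    and min: "\<And>A. cover A \<Longrightarrow> l \<le> dim A"
begin

lemma missed: "subspace A \<Longrightarrow> dim A < l \<Longrightarrow> \<exists>F\<in>\<F>. A \<inter> F = {0}"
  using min[of A] unfolding cover_def by (force simp: Int_commute)

lemma sT: "subspace T" using T coverD(1) by blast

lemma degree_iterate_family:
  assumes "\<And>G. G \<in> \<G> \<Longrightarrow> cover G"
    and "s \<le> l"
    and "\<And>A. subspace A \<Longrightarrow> dim A = s \<Longrightarrow> deg \<G> A \<le> C"
    and "subspace A" "dim A \<le> s"
  shows "deg \<G> A \<le> K ^ (s - dim A) * C"
proof (rule degree_iterate[where \<B> = \<F>])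
  show "G \<inter> D \<noteq> {0}" if "G \<in> \<G>" "D \<in> \<F>" for G D
    using coverD(2)[OF assms(1)[OF that(1)] that(2)] by (simp add: Int_commute)
qed (use assms member missed coverD(1) in auto)

text \<open>The first step branches over the [l] points of T instead of the K points of a member. Up
  to dimension l each further space is missed by some member, because no smaller space is a
  cover.\<close>

lemma card_via_cover:
  assumes sub: "\<G> \<subseteq> \<F>" and s: "1 \<le> s" "s \<le> l"
    and C: "\<And>A. subspace A \<Longrightarrow> dim A = s \<Longrightarrow> deg \<G> A \<le> C"
  shows "real (card \<G>) \<le> qint q l * (K ^ (s - 1) * C)"
proof -
  have sG: "subspace G" "cover G" if "G \<in> \<G>" for G using sub that member member_cover by auto
  have "deg \<G> {0} \<le> qint q (dim T) * (K ^ (s - 1) * C)"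
  proof (rule degree_branch)
    show "G \<inter> T \<noteq> {0}" if "G \<in> \<G>" for G using coverD(2)[OF T(1)] that sub by blast
    fix A' assume A': "subspace A'" "dim A' = Suc (dim {0})"
    then have d: "dim A' = 1" by simp
    have "deg \<G> A' \<le> K ^ (s - dim A') * C"
    proof (rule degree_iterate_family[of \<G> s C A'])
      show "dim A' \<le> s" using d s by simp
    qed (fact sG s C A')+
    then show "deg \<G> A' \<le> K ^ (s - 1) * C" unfolding d .
  qed (use sT sG zero_Int[OF sT] in auto)
  then show ?thesis using point_degree_0[of \<G>] sG T by simp
qed

lemma card_family: "real (card \<F>) \<le> qint q l * K ^ (l - 1) * g l"
proof -
  have "real (card \<F>) \<le> qint q l * (K ^ (l - 1) * g l)"
  proof (rule card_via_cover)
    fix A assume "subspace A" "dim A = l"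
    then show "deg \<F> A \<le> g l" using degree_le_g[OF family, of A] l by simp
  qed (use l in auto)
  then show ?thesis by (simp add: mult.assoc)
qed

definition min_covers :: "'v set set" where
  "min_covers = {E. cover E \<and> dim E = l}"

lemma min_coversD: "E \<in> min_covers \<Longrightarrow> cover E" "E \<in> min_covers \<Longrightarrow> dim E = l"
  "E \<in> min_covers \<Longrightarrow> subspace E"
  using coverD(1) by (auto simp: min_covers_def)

lemma min_covers_meet: "E \<in> min_covers \<Longrightarrow> E' \<in> min_covers \<Longrightarrow> E \<inter> E' \<noteq> {0}"
  using covers_meet[of E E'] min_coversD l by simp

text \<open>For members without a minimal cover every relevant l-space is a non-cover, so one more
  step is possible and replaces g l by K \<open>g (Suc l)\<close>, at most c g l. The others are
  bounded through the number of minimal covers.\<close>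

lemma card_family_split:
  assumes "l < k"
  shows "real (card \<F>) \<le> qint q l * K ^ l * g (Suc l) + real (card min_covers) * g l"
proof -
  define \<G> where "\<G> = {F \<in> \<F>. \<forall>E\<in>min_covers. \<not> E \<subseteq> F}"
  have "real (card \<G>) \<le> qint q l * (K ^ (l - 1) * (K * g (Suc l)))"
  proof (rule card_via_cover)
    fix A assume A: "subspace A" "dim A = l"
    show "deg \<G> A \<le> K * g (Suc l)"
    proof (cases "cover A")
      case True
      then have none: "{F \<in> \<G>. A \<subseteq> F} = {}" using A by (auto simp: \<G>_def min_covers_def)
      show ?thesis unfolding point_degree_def none using K_pos g_nonneg[of "Suc l"] by simp
    next
      case False
      have "point_degree \<G> A \<le> point_degree \<F> A"
        unfolding point_degree_def by (intro card_mono) (auto simp: \<G>_def)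
      then show ?thesis using degree_non_cover[OF A(1) _ False] A assms by simp
    qed
  qed (use l in \<open>auto simp: \<G>_def\<close>)
  moreover have "qint q l * (K ^ (l - 1) * (K * g (Suc l))) = qint q l * K ^ l * g (Suc l)"
  proof -
    have "K ^ l = K ^ (l - 1) * K" using l by (cases l) auto
    then show ?thesis by (simp only: mult.assoc)
  qed
  moreover have "real (card (\<F> - \<G>)) \<le> real (card min_covers) * g l"
  proof (rule card_UN_bound[where T = "\<lambda>E. {F \<in> \<F>. E \<subseteq> F}"])
    fix E assume "E \<in> min_covers"
    then show "real (card {F \<in> \<F>. E \<subseteq> F}) \<le> g l"
      using degree_le_g[OF family, of E] min_coversD l by (simp add: point_degree_def)
  qed (auto simp: \<G>_def)
  moreover have "card \<F> = card \<G> + card (\<F> - \<G>)"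
  proof -
    have "\<F> = \<G> \<union> (\<F> - \<G>)" by (auto simp: \<G>_def)
    then show ?thesis using card_Un_disjoint[of \<G> "\<F> - \<G>"] by auto
  qed
  ultimately show ?thesis unfolding of_nat_add by linarith
qed

text \<open>Minimal covers meet pairwise, so they can replace members as test spaces and reduce K
  choices to [l]. With a common point this is not possible. With a two-space L meeting all of them,
  the steps use L, then a minimal cover, then members; with neither, three steps use minimal
  covers.\<close>

lemma card_min_covers:
  "real (card min_covers) \<le> K ^ (l - 1) \<or>
   real (card min_covers) \<le> (Q + 1) * qint q l * K ^ (l - 2) \<or>
   real (card min_covers) \<le> qint q l ^ 3 * K ^ (l - 3)"
proof -
  have deg_l: "deg min_covers A \<le> 1" if A: "subspace A" "dim A = l" for A
  proof -
    have "{E \<in> min_covers. A \<subseteq> E} \<subseteq> {A}"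
    proof
      fix E assume E: "E \<in> {E \<in> min_covers. A \<subseteq> E}"
      then have E': "E \<in> min_covers" by blast
      have "A = E" using subspace_eqI[OF A(1) min_coversD(3)[OF E']] E A(2) min_coversD(2)[OF E'] by simp
      then show "E \<in> {A}" by simp
    qed
    then have "card {E \<in> min_covers. A \<subseteq> E} \<le> card {A}" by (intro card_mono) auto
    then show ?thesis by (simp add: point_degree_def)
  qed
  have deg: "deg min_covers A \<le> K ^ (l - dim A)" if "subspace A" "dim A \<le> l" for A
  proof -
    have "deg min_covers A \<le> K ^ (l - dim A) * 1"
      by (rule degree_iterate_family[of min_covers l 1 A]) (fact min_coversD deg_l that order_refl)+
    then show ?thesis by simp
  qed
  have N0: "point_degree min_covers {0} = card min_covers"
    using point_degree_0 min_coversD(3) by blast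
  consider (point) P where "P \<in> pts UNIV" "\<And>E. E \<in> min_covers \<Longrightarrow> P \<subseteq> E"
    | (line) L where "\<And>P. P \<in> pts UNIV \<Longrightarrow> \<exists>E\<in>min_covers. \<not> P \<subseteq> E" "subspace L" "dim L = 2"
        "\<And>E. E \<in> min_covers \<Longrightarrow> E \<inter> L \<noteq> {0}"
    | (none) "\<And>P. P \<in> pts UNIV \<Longrightarrow> \<exists>E\<in>min_covers. \<not> P \<subseteq> E"
        "\<And>L. subspace L \<Longrightarrow> dim L = 2 \<Longrightarrow> \<exists>E\<in>min_covers. E \<inter> L = {0}"
    by metis
  then show ?thesis
  proof cases
    case point
    have "{E \<in> min_covers. P \<subseteq> E} = min_covers" using point by blast
    then have "real (card min_covers) \<le> K ^ (l - 1)"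
      using deg[of P] point(1) l by (simp add: point_degree_def pts_iff)
    then show ?thesis by blast
  next
    case line
    have "deg min_covers {0} \<le> qint q (dim L) * (qint q l * K ^ (l - 2))"
    proof (rule degree_branch)
      fix P assume P: "subspace P" "dim P = Suc (dim {0})"
      then have dP: "dim P = 1" by simp
      then have P': "P \<in> pts UNIV" using P dim_1_point by blast
      obtain E where E: "E \<in> min_covers" "\<not> P \<subseteq> E" using line(1)[OF P'] by blast
      have "P \<inter> E = {0}" using point_Int[OF P' min_coversD(3)[OF E(1)]] E by simp
      then have "deg min_covers P \<le> qint q (dim E) * K ^ (l - 2)"
      proof (rule degree_branch[OF P(1) min_coversD(3)[OF E(1)]])
        fix A' assume A': "subspace A'" "dim A' = Suc (dim P)"
        have d: "dim A' = 2" using A'(2) dP by linarith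
        show "deg min_covers A' \<le> K ^ (l - 2)"
          using deg[OF A'(1)] l unfolding d by linarith
      qed (use min_coversD(3) min_covers_meet E in blast)+
      then show "deg min_covers P \<le> qint q l * K ^ (l - 2)"
        using min_coversD(2)[OF E(1)] by simp
    qed (use line min_coversD(3) zero_Int[of L] in auto)
    then have "real (card min_covers) \<le> (Q + 1) * qint q l * K ^ (l - 2)"
      using N0 line(3) qint_2 by (simp add: mult.assoc)
    then show ?thesis by blast
  next
    case none
    have "deg min_covers {0} \<le> qint q l ^ (3 - dim {0}) * K ^ (l - 3)"
    proof (rule degree_iterate[where \<B> = min_covers])
      show "subspace D \<and> dim D = l" if "D \<in> min_covers" for D using that min_coversD by blast
      show "G \<inter> D \<noteq> {0}" if "G \<in> min_covers" "D \<in> min_covers" for G D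
        using min_covers_meet that by blast
      fix A assume A: "subspace A" "dim A < 3"
      then consider "dim A = 0" | "dim A = 1" | "dim A = 2" by linarith
      then show "\<exists>D\<in>min_covers. A \<inter> D = {0}"
      proof cases
        case 1
        then have "A \<subseteq> {0}" by (simp only: dim_eq_0)
        then have "A = {0}" using subspace_0[OF A(1)] by blast
        moreover have "T \<in> min_covers" using T by (simp add: min_covers_def)
        ultimately show ?thesis using zero_Int[OF sT] by blast
      next
        case 2
        then have P: "A \<in> pts UNIV" using A dim_1_point by blast
        then obtain E where E: "E \<in> min_covers" "\<not> A \<subseteq> E" using none(1) by blast
        then show ?thesis using point_Int[OF P min_coversD(3)[OF E(1)]] by (intro bexI[of _ E]) auto
      next
        case 3
        then show ?thesis using none(2)[OF A(1)] by (simp add: Int_commute)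
      qed
    next
      fix A assume "subspace A" "dim A = 3"
      then show "deg min_covers A \<le> K ^ (l - 3)" using deg[of A] l by simp
    qed (use min_coversD(3) in auto)
    then show ?thesis using N0 by simp
  qed
qed

lemma light_large_cover:
  assumes k4: "k \<ge> 4"
  shows "light \<F>"
proof -
  define N where "N = real (card min_covers)"
  have R: "l < k \<Longrightarrow> real (card \<F>) \<le> qint q l * K ^ l * g (Suc l) + N * g l"
    using card_family_split by (simp add: N_def)
  have N: "N \<le> K ^ (l - 1) \<or> N \<le> (Q + 1) * qint q l * K ^ (l - 2) \<or> N \<le> qint q l ^ 3 * K ^ (l - 3)"
    using card_min_covers by (simp add: N_def)
  consider "l = 3" | "l = 4" "k = 4" | "l = 4" "k \<ge> 5" | "l \<ge> 5" using l by linarith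
  then show ?thesis
  proof cases
    case 1
    have "c * (qint q 3 * K ^ 3 * g 4 + N * g 3) / K < bd"
      using N 1 by (intro num_cover_3[OF k4, of N]) auto
    then show ?thesis using R k4 light_if_small 1 by simp
  next
    case 2
    then show ?thesis
      using light_if_small[OF card_family] num_cover_4_4[OF 2(2), of "qint q 4 * K^3 * g 4"] by simp
  next
    case 3
    have "c * (qint q 4 * K ^ 4 * g 5 + N * g 4) / K < bd"
      using N 3(1) by (intro num_cover_4[OF 3(2), of N]) auto
    then show ?thesis using R 3 light_if_small by simp
  next
    case 4
    show ?thesis
      using light_if_small[OF card_family num_cover_ge_5[OF 4 l(2) order_refl]] .
  qed
qed

end

section \<open>Three-dimensional members without a two-dimensional cover\<close>

lemma degree_point_planes:
  assumes k3: "k = 3" and no_line: "\<And>L. cover L \<Longrightarrow> 3 \<le> dim L" and P: "P \<in> pts UNIV"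
  shows "deg \<F> P \<le> K^2"
proof -
  obtain F0 where F0: "F0 \<in> \<F>" using nonempty by blast
  have "deg \<F> P \<le> K ^ (3 - dim P) * 1"
  proof (rule degree_iterate_family[where l = 3 and T = F0])
    fix A assume "subspace A" "dim A = 3"
    then show "deg \<F> A \<le> 1" using degree_le_g[OF family, of A] g3_k3 k3 by simp
  qed (use F0 member member_cover no_line P k3 in \<open>auto simp: pts_iff\<close>)
  then show ?thesis using P by (simp add: pts_iff)
qed

text \<open>For dim L = 2 and k = 3: all members missing L lie in a single five-space.\<close>

definition one_span :: "'v set \<Rightarrow> bool" where
  "one_span L \<longleftrightarrow>
    (\<forall>F\<in>\<F>. \<forall>F'\<in>\<F>. F \<inter> L = {0} \<longrightarrow> F' \<inter> L = {0} \<longrightarrow> L \<squnion> F = L \<squnion> F')"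

lemma light_planes:
  assumes k3: "k = 3" and no_line: "\<And>L. cover L \<Longrightarrow> 3 \<le> dim L"
  shows "light \<F>"
proof (cases "\<exists>L. subspace L \<and> dim L = 2 \<and> one_span L")
  case False
  \<comment> \<open>Two members missing L with different joins confine the members through L to the
    intersection I of the joins. As dim I <= 4, at most q + 1 three-spaces of I contain L.\<close>
  have dL: "deg \<F> L \<le> Q + 1" if L: "subspace L" "dim L = 2" for L
  proof -
    have "\<not> one_span L" using False L by blast
    then obtain F3 F4 where F: "F3 \<in> \<F>" "F4 \<in> \<F>" "F3 \<inter> L = {0}" "F4 \<inter> L = {0}" "L \<squnion> F3 \<noteq> L \<squnion> F4"
      unfolding one_span_def ball_simps not_imp by (elim bexE conjE)
    define I where "I = (L \<squnion> F3) \<inter> (L \<squnion> F4)"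
    have sI: "subspace I" by (simp add: I_def subspace_inter)
    have d5: "dim (L \<squnion> F') = 5" if "F' \<in> \<F>" "F' \<inter> L = {0}" for F'
      using dim_join[OF L(1) member(1)[OF that(1)]] that member(2)[OF that(1)] k3 L
      by (simp add: Int_commute)
    have "dim I < 5"
    proof (rule ccontr)
      assume "\<not> dim I < 5"
      then have I5: "5 \<le> dim I" by simp
      have "I = L \<squnion> F3"
        using I5 d5[OF F(1,3)] by (intro subspace_eqI[OF sI]) (auto simp: I_def)
      moreover have "I = L \<squnion> F4"
        using I5 d5[OF F(2,4)] by (intro subspace_eqI[OF sI]) (auto simp: I_def)
      ultimately show False using F(5) by simp
    qed
    \<comment> \<open>G has dimension three, hence equals L + y for a point y of F' in G.\<close>
    have in_join: "G \<subseteq> L \<squnion> F'" if G: "G \<in> \<F>" "L \<subseteq> G" and F': "F' \<in> \<F>" "F' \<inter> L = {0}" for G F'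
    proof -
      have sG: "subspace G" "dim G = 3" using member[OF G(1)] k3 by auto
      obtain y where y: "y \<in> pts G" "y \<in> pts F'"
        using common_point[OF sG(1) member(1)[OF F'(1)] meet[OF G(1) F'(1)]] by blast
      have "\<not> y \<subseteq> L"
      proof
        assume "y \<subseteq> L"
        then have "F' \<inter> L \<noteq> {0}" using Int_nonzeroI[OF ptsD(1)[OF y(1)] ptsD(3)[OF y(2)]] by blast
        then show False using F' by blast
      qed
      then have "dim (L \<squnion> y) = 3" using dim_join_point[OF ptsD(1)[OF y(1)] L(1)] L by simp
      moreover have "L \<squnion> y \<subseteq> G" using G(2) ptsD(3)[OF y(1)] sG by (intro join_least)
      ultimately have "L \<squnion> y = G" using sG by (intro subspace_eqI) auto
      moreover have "L \<squnion> y \<subseteq> L \<squnion> F'" using ptsD(3)[OF y(2)] by (intro span_mono) auto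
      ultimately show ?thesis by simp
    qed
    have LI: "L \<subseteq> I" using join_ub(1)[of L F3] join_ub(1)[of L F4] by (simp add: I_def)
    have "{G \<in> \<F>. L \<subseteq> G} \<subseteq> {G \<in> Gr scale 3 I. L \<subseteq> G}"
    proof
      fix G assume "G \<in> {G \<in> \<F>. L \<subseteq> G}"
      then have G: "G \<in> \<F>" "L \<subseteq> G" by auto
      have "G \<subseteq> I" unfolding I_def using in_join[OF G F(1,3)] in_join[OF G F(2,4)] by simp
      then show "G \<in> {G \<in> Gr scale 3 I. L \<subseteq> G}" using G member[OF G(1)] k3 by (simp add: Gr_iff)
    qed
    then have "point_degree \<F> L \<le> card {G \<in> Gr scale 3 I. L \<subseteq> G}"
      unfolding point_degree_def by (intro card_mono) auto
    then have "deg \<F> L \<le> qint q (dim I - 2)"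
      using card_supersets[OF L(1) sI LI, of 3] L(2) gauss_1[of q "dim I - 2"] by simp
    also have "\<dots> \<le> qint q 2" using \<open>dim I < 5\<close> by (intro qint_mono[OF q2]) auto
    finally show ?thesis using qint_2 by simp
  qed
  obtain F0 where F0: "F0 \<in> \<F>" using nonempty by blast
  \<comment> \<open>Two branching steps along members lead to two-spaces, whose degree is bounded by
    \<open>dL\<close>.\<close>
  have "deg \<F> {0} \<le> K ^ (2 - dim {0}) * (Q + 1)"
    by (rule degree_iterate_family[where l = 3 and T = F0])
       (use F0 member member_cover no_line k3 dL in auto)
  then have "real (card \<F>) \<le> (Q + 1) * K^2"
    using point_degree_0[of \<F>] member(1) by (simp add: mult.commute)
  moreover have "(0::real) \<le> Q ^ 5" by simp
  ultimately have "real (card \<F>) \<le> (Q + 1) * K^2 + Q^5" by linarith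
  then show ?thesis using light_if_small num_planes[OF k3 order_refl] by blast
next
  case True
  then obtain L where L: "subspace L" "dim L = 2" "one_span L" by blast
  have same: "L \<squnion> F = L \<squnion> F'" if "F \<in> \<F>" "F' \<in> \<F>" "F \<inter> L = {0}" "F' \<inter> L = {0}" for F F'
    by (rule L(3)[unfolded one_span_def, rule_format, OF that])
  have "\<not> cover L" using no_line[of L] L(2) by linarith
  then obtain F3 where F3: "F3 \<in> \<F>" "F3 \<inter> L = {0}" using L(1) by (auto simp: cover_def)
  define U where "U = L \<squnion> F3"
  have sU: "subspace U" by (simp add: U_def)
  have dU: "dim U = 5"
    using dim_join[OF L(1) member(1)[OF F3(1)]] F3 member(2)[OF F3(1)] k3 L
    by (simp add: Int_commute U_def)
  have LU: "L \<subseteq> U" unfolding U_def by (rule join_ub)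
  have inU: "F \<subseteq> U" if "F \<in> \<F>" "F \<inter> L = {0}" for F
    using same[OF that(1) F3(1) that(2) F3(2)] join_ub(2)[of F L] by (simp add: U_def)
  show ?thesis
  proof (cases "\<forall>F\<in>\<F>. F \<subseteq> U")
    case True
    \<comment> \<open>A three-space S missing a hyperplane U' of the five-space U meets U in at most
      a point. Only that point of S can have positive degree, at most the number (q^2+1) K of
      three-spaces of U through it, which is below K^2.\<close>
    obtain U' where U': "subspace U'" "U' \<subseteq> U" "dim U' = 4"
      using choose_subspace_of_subspace[of 4 U] dU sU by auto
    have "3 + dim U' \<le> dim (UNIV :: 'v set)" "dim {0} \<le> 3"
      using n_ge k3 dim_V U'(3) by simp_all
    then obtain S where S: "S \<in> Gr scale 3 UNIV" "S \<inter> U' = {0}"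
      using exists_complementary[OF subspace_single_0 U'(1) zero_Int[OF U'(1)]] by blast
    have sS: "subspace S" "dim S = 3" using S by (auto simp: Gr_iff)
    have sSU: "subspace (S \<inter> U)" using sS sU subspace_inter by blast
    have dSU: "dim (S \<inter> U) \<le> 1"
    proof (rule ccontr)
      assume "\<not> ?thesis"
      then have ne: "(S \<inter> U) \<inter> U' \<noteq> {0}" using sSU U' sU dU by (intro dim_Int_gt[of _ _ U]) auto
      have "(S \<inter> U) \<inter> U' = S \<inter> U'" using U'(2) by blast
      then show False using ne S(2) by simp
    qed
    have "S \<notin> \<F>"
    proof
      assume "S \<in> \<F>"
      then have "S \<inter> U = S" using True by blast
      then show False using dSU sS by simp
    qed
    have deg0: "point_degree \<F> x = 0" if "\<not> x \<subseteq> U" for x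
    proof -
      have "{F \<in> \<F>. x \<subseteq> F} = {}" using True that by blast
      then show ?thesis by (simp add: point_degree_def)
    qed
    have degU: "deg \<F> x \<le> gauss q 4 2" if x: "x \<in> pts U" for x
    proof -
      have "point_degree \<F> x \<le> card {F \<in> Gr scale 3 U. x \<subseteq> F}"
        unfolding point_degree_def using True member k3 by (intro card_mono) (auto simp: Gr_iff)
      then show ?thesis using card_supersets[of x U 3] x sU dU by (simp add: pts_iff)
    qed
    have "real (subspace_degree scale \<F> S) = (\<Sum>x\<in>pts S. deg \<F> x)"
      by (rule subspace_degree_sum)
    also have "\<dots> = (\<Sum>x\<in>pts (S \<inter> U). deg \<F> x)"
    proof (rule sum.mono_neutral_right)
      show "\<forall>x\<in>pts S - pts (S \<inter> U). deg \<F> x = 0"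
        using deg0 by (auto simp: pts_iff)
    qed (auto simp: pts_iff)
    also have "\<dots> \<le> real (card (pts (S \<inter> U))) * gauss q 4 2"
      using degU by (intro sum_bounded_above) (auto simp: pts_iff)
    also have "\<dots> \<le> 1 * gauss q 4 2"
    proof (intro mult_right_mono)
      show "real (card (pts (S \<inter> U))) \<le> 1"
        using card_pts[OF sSU] qint_mono[OF q2 dSU] qint_1[OF q2] by simp
    qed (rule gauss_nonneg[OF q2])
    also have "\<dots> < K * bd"
    proof -
      have "gauss q 4 2 * (Q + 1) = qint q 4 * qint q 3"
        using gauss_Suc[OF q2, of 1 4] gauss_1[of q 4] qint_2 by (simp add: eval_nat_numeral)
      then have "gauss q 4 2 * (Q + 1) = (Q^2 + 1) * K * (Q + 1)"
        unfolding qint_4 k3 by (simp add: mult_ac)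
      then have "gauss q 4 2 = (Q^2 + 1) * K" using Q2 by simp
      also have "\<dots> < K * K" using K_pos K_ge_3 Q2 by (intro mult_strict_right_mono) auto
      finally show ?thesis using bd_k3[OF k3] by simp
    qed
    finally show ?thesis using \<open>S \<notin> \<F>\<close> S(1) k3 unfolding light_def by blast
  next
    case False
    then obtain F5 where F5: "F5 \<in> \<F>" "\<not> F5 \<subseteq> U" by blast
    have sF5: "subspace F5" "dim F5 = 3" using member[OF F5(1)] k3 by auto
    have sFU: "subspace (F5 \<inter> U)" using sF5 sU subspace_inter by blast
    \<comment> \<open>F5 is not inside U, so it meets L, while F5 \<inter> U has dimension at most
      2; this leaves at most q points of F5 \<inter> U outside L.\<close>
    have "F5 \<inter> L \<noteq> {0}" using inU[OF F5(1)] F5(2) by blast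
    then have d1: "dim (F5 \<inter> L) \<ge> 1" using dim_Int_pos[OF sF5(1) L(1)] by simp
    have d2: "dim (F5 \<inter> U) \<le> 2"
    proof (rule ccontr)
      assume "\<not> ?thesis"
      then have "F5 \<inter> U = F5" using sFU sF5 by (intro subspace_eqI) auto
      then show False using F5 by blast
    qed
    define \<M> where "\<M> = {F \<in> \<F>. F \<inter> L = {0}}"
    have "real (card (\<F> - \<M>)) \<le> real (card (pts L)) * K^2"
    proof (rule card_UN_bound[where T = "\<lambda>P. {F \<in> \<F>. P \<subseteq> F}"])
      show "\<F> - \<M> \<subseteq> (\<Union>P\<in>pts L. {F \<in> \<F>. P \<subseteq> F})"
      proof
        fix F assume "F \<in> \<F> - \<M>"
        then have F: "F \<in> \<F>" "F \<inter> L \<noteq> {0}" by (auto simp: \<M>_def)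
        obtain P where "P \<in> pts L" "P \<subseteq> F" using common_point[OF member(1)[OF F(1)] L(1) F(2)] by blast
        then show "F \<in> (\<Union>P\<in>pts L. {F \<in> \<F>. P \<subseteq> F})" using F by blast
      qed
      fix P assume "P \<in> pts L"
      then show "real (card {F \<in> \<F>. P \<subseteq> F}) \<le> K^2"
        using degree_point_planes[OF k3 no_line ptsD(1)] by (simp add: point_degree_def)
    qed auto
    then have 1: "real (card (\<F> - \<M>)) \<le> (Q + 1) * K^2"
      using card_pts[OF L(1)] L(2) qint_2 by simp
    \<comment> \<open>A member missing L meets F5 in one of these q points r and meets r + L only in
      r. By \<open>card_between\<close> each r admits q^4 such three-spaces of U.\<close>
    have 2: "real (card \<M>) \<le> Q ^ 5"
    proof -
      have "real (card \<M>) \<le> real (card (pts (F5 \<inter> U) - pts L)) * Q ^ 4"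
      proof (rule card_UN_bound[where T = "\<lambda>r. between r (r \<squnion> L) U 3"])
        show "\<M> \<subseteq> (\<Union>r\<in>pts (F5 \<inter> U) - pts L. between r (r \<squnion> L) U 3)"
        proof
          fix F assume "F \<in> \<M>"
          then have F: "F \<in> \<F>" "F \<inter> L = {0}" by (auto simp: \<M>_def)
          have sF: "subspace F" "dim F = 3" using member[OF F(1)] k3 by auto
          obtain r where r: "r \<in> pts F" "r \<in> pts F5"
            using common_point[OF sF(1) sF5(1) meet[OF F(1) F5(1)]] by blast
          have "r \<in> pts (F5 \<inter> U)" using r inU[OF F] by (auto simp: pts_iff)
          moreover have "r \<notin> pts L"
          proof
            assume "r \<in> pts L"
            then have "F \<inter> L \<noteq> {0}"
              using Int_nonzeroI[OF ptsD(1)[OF r(1)] ptsD(3)[OF r(1)]] ptsD(3) by blast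
            then show False using F by blast
          qed
          moreover have "F \<inter> (r \<squnion> L) = r"
          proof -
            have sr: "subspace r" using ptsD(2)[OF r(1)] .
            have "(r \<squnion> L) \<inter> F = r \<squnion> (L \<inter> F)" using sr L sF ptsD(3)[OF r(1)] by (intro modular)
            also have "L \<inter> F = {0}" using F by (simp add: Int_commute)
            also have "r \<squnion> {0} = r" using sr subspace_0[OF sr] by (simp add: Un_absorb2)
            finally show ?thesis by (simp add: Int_commute)
          qed
          ultimately show "F \<in> (\<Union>r\<in>pts (F5 \<inter> U) - pts L. between r (r \<squnion> L) U 3)"
            using sF inU[OF F] ptsD(3)[OF r(1)] by (intro UN_I[of r]) (auto simp: between_def)
        qed
        fix r assume r: "r \<in> pts (F5 \<inter> U) - pts L"
        then have r': "r \<in> pts UNIV" "subspace r" "dim r = 1" "r \<subseteq> U" "\<not> r \<subseteq> L" by (auto simp: pts_iff)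
        have "r \<inter> L = {0}" using point_Int[OF r'(1) L(1)] r'(5) by simp
        then have d: "dim (r \<squnion> L) = 3" using dim_join[OF r'(2) L(1)] r' L by simp
        have "r \<squnion> L \<subseteq> U" using r' LU sU by (intro join_least)
        then show "real (card (between r (r \<squnion> L) U 3)) \<le> Q ^ 4"
          using card_between[of r "r \<squnion> L" U 3] r' sU d dU join_ub(1)[of r L] gauss_same[OF q2, of 2] by simp
      qed auto
      also have "\<dots> \<le> Q * Q ^ 4"
      proof (intro mult_right_mono)
        have e: "F5 \<inter> U \<inter> L = F5 \<inter> L" using LU by blast
        have "qint q (dim (F5 \<inter> U)) \<le> Q + 1" using qint_mono[OF q2 d2] qint_2 by simp
        moreover have "qint q (dim (F5 \<inter> L)) \<ge> 1" using qint_mono[OF q2 d1] qint_1[OF q2] by simp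
        ultimately show "real (card (pts (F5 \<inter> U) - pts L)) \<le> Q"
          using card_pts_diff[OF sFU L(1)] unfolding e by simp
      qed simp
      finally show ?thesis by (simp add: eval_nat_numeral)
    qed
    have "card \<F> = card \<M> + card (\<F> - \<M>)"
    proof -
      have "\<F> = \<M> \<union> (\<F> - \<M>)" by (auto simp: \<M>_def)
      then show ?thesis using card_Un_disjoint[of \<M> "\<F> - \<M>"] by auto
    qed
    then have "real (card \<F>) = real (card \<M>) + real (card (\<F> - \<M>))" by simp
    then have "real (card \<F>) \<le> (Q + 1) * K^2 + Q^5" using 1 2 by linarith
    then show ?thesis using light_if_small num_planes[OF k3 order_refl] by blast
  qed
qed

theorem maximal_family_cases:
  "light \<F> \<or> (\<exists>X\<in>Gr scale 1 UNIV. \<exists>M\<in>Gr scale (k + 1) UNIV. X \<subset> M \<and> \<F> = H1_full X M)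
    \<or> (k = 3 \<and> (\<exists>Z\<in>Gr scale 3 UNIV. \<F> = H3 scale Z))"
proof (cases "\<exists>T. cover T \<and> dim T = 2")
  case True
  then obtain T0 where T0: "cover T0" "dim T0 = 2" by blast
  show ?thesis
  proof (cases "\<forall>T. cover T \<longrightarrow> dim T = 2 \<longrightarrow> T = T0")
    case True
    then show ?thesis using single_line[OF T0] by blast
  next
    case False
    then obtain T1 where T1: "cover T1" "dim T1 = 2" "T0 \<noteq> T1" by blast
    show ?thesis
    proof (cases "\<forall>T. cover T \<longrightarrow> dim T = 2 \<longrightarrow> T0 \<inter> T1 \<subseteq> T")
      case True
      have "T0 \<inter> T1 \<noteq> {0}" using covers_meet[OF T0(1) _ T1(1)] T0 T1 k_ge_3 by simp
      then have X: "T0 \<inter> T1 \<in> pts UNIV"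
        using lines_meet[OF coverD(1)[OF T0(1)] T0(2) coverD(1)[OF T1(1)] T1(2,3)] by simp
      have "light \<F> \<or> (\<exists>M\<in>Gr scale (k + 1) UNIV. T0 \<inter> T1 \<subset> M \<and> \<F> = H1_full (T0 \<inter> T1) M)"
        using True by (intro pencil[OF X _ T0 T1]) blast
      then show ?thesis using X unfolding pts_def by blast
    next
      case False
      then obtain T2 where T2: "cover T2" "dim T2 = 2" "\<not> T0 \<inter> T1 \<subseteq> T2" by blast
      show ?thesis using triangle[OF T0(1) T1(1) T2(1) T0(2) T1(2) T2(2) T1(3) T2(3)] by blast
    qed
  qed
next
  case False
  have ge3: "3 \<le> dim A" if A: "cover A" for A
  proof (rule ccontr)
    assume "\<not> ?thesis"
    moreover have "dim A \<noteq> 2" using False A by blast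
    moreover obtain F0 where F0: "F0 \<in> \<F>" using nonempty by blast
    have "dim A \<noteq> 0"
    proof
      assume "dim A = 0"
      then have "A \<subseteq> {0}" by (simp only: dim_eq_0)
      then have "F0 \<inter> A = {0}" using subspace_0[OF member(1)[OF F0]] subspace_0[OF coverD(1)[OF A]] by blast
      then show False using coverD(2)[OF A F0] by blast
    qed
    ultimately have "dim A = 1" by linarith
    then have P: "A \<in> pts UNIV" using dim_1_point coverD(1)[OF A] by blast
    obtain F where "F \<in> \<F>" "A \<inter> F = {0}" using exists_missing[OF P] by blast
    then show False using coverD(2)[OF A] by (metis Int_commute)
  qed
  show ?thesis
  proof (cases "k = 3")
    case True
    then show ?thesis using light_planes ge3 by blast
  next
    case False
    obtain F0 where F0: "F0 \<in> \<F>" using nonempty by blast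
    define l where "l = (LEAST d. \<exists>T. cover T \<and> dim T = d)"
    have ex: "\<exists>T. cover T \<and> dim T = k" using member_cover[OF F0] member(2)[OF F0] by blast
    obtain T where T: "cover T" "dim T = l"
      using LeastI[of "\<lambda>d. \<exists>T. cover T \<and> dim T = d", OF ex] by (auto simp: l_def)
    have min: "l \<le> dim A" if "cover A" for A
      unfolding l_def using that by (intro Least_le) blast
    have "l \<le> k" using min[OF member_cover[OF F0]] member(2)[OF F0] by simp
    then have "light \<F>"
      using light_large_cover[OF _ _ T min] ge3[OF T(1)] T(2) False k_ge_3 by simp
    then show ?thesis ..
  qed
qed

end

section \<open>Extremal families\<close>

lemma gauss_ge_1:
  assumes "q \<ge> 2" "b \<le> a"
  shows "gauss q a b \<ge> 1"
proof -
  have "1 \<le> (real q ^ (a - i) - 1) / (real q ^ (b - i) - 1)" if "i < b" for i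
  proof -
    have "1 < real q ^ (b - i)" using assms that by (intro one_less_power) auto
    moreover have "real q ^ (b - i) \<le> real q ^ (a - i)" using assms by (intro power_increasing) auto
    ultimately show ?thesis by simp
  qed
  then show ?thesis unfolding gauss_binomial_def using assms by (auto intro!: prod_ge_1)
qed

lemma gauss_Suc_self: "q \<ge> 2 \<Longrightarrow> gauss q (Suc a) a = qint q (Suc a)"
  using gauss_Suc[of q a "Suc a"] gauss_same[of q "Suc a"] qint_1[of q] by simp

context erdos_params
begin

lemma qint_le_power: "qint q m \<le> Q ^ m"
proof -
  have "Q ^ m * 1 \<le> Q ^ m * (Q - 1)" using Q2 by (intro mult_left_mono) auto
  then have "Q ^ m - 1 \<le> Q ^ m * (Q - 1)" by linarith
  then show ?thesis using Q2 by (simp add: qint_def divide_le_eq)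
qed

text \<open>The right side counts the k-spaces through a two-space of M that are not inside M. It
  bounds the degree of the points of M in the first extremal family from below.\<close>

lemma bd_le_through_line: "bd \<le> gauss q (n - 2) (k - 2) - gauss q (k - 1) (k - 2)"
proof -
  obtain m where m: "k = Suc (Suc m)" "m \<ge> 1" using k_ge_3 by (intro that[of "k - 2"]) auto
  have "gauss q (k - 1) (k - 2) = qint q (k - 1)" using gauss_Suc_self[OF q2] m by simp
  also have "\<dots> \<le> Q ^ (k - 1)" by (rule qint_le_power)
  also have "\<dots> \<le> Q ^ (k * (k - 2))"
    using q2 m by (intro power_increasing) auto
  also have "\<dots> \<le> Q ^ (k * (k - 2)) * gauss q (n - k - 2) (k - 2)"
    using gauss_ge_1[OF q2, of "k - 2" "n - k - 2"] n_ge q2 by simp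
  finally show ?thesis unfolding bd_def by simp
qed

end

context erdos_space
begin

section \<open>Certificates for equality\<close>

lemma ore_le: "S \<in> Gr scale k UNIV - \<F> \<Longrightarrow> ore_degree scale k \<F> \<le> subspace_degree scale \<F> S"
  unfolding ore_degree_def by (rule Min_le) auto

lemma ore_light: "light \<F> \<Longrightarrow> real (ore_degree scale k \<F>) < K * bd"
  unfolding light_def using ore_le by (meson le_less_trans of_nat_le_iff)

lemma point_degree_mono: "\<F> \<subseteq> \<F>' \<Longrightarrow> point_degree \<F> x \<le> point_degree \<F>' (x :: 'v set)"
  unfolding point_degree_def by (intro card_mono) auto

lemma light_mono: "\<F> \<subseteq> \<F>' \<Longrightarrow> light \<F>' \<Longrightarrow> light \<F>"
proof -
  assume sub: "\<F> \<subseteq> \<F>'" and "light \<F>'"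
  then obtain S where S: "S \<in> Gr scale k UNIV - \<F>'" "real (subspace_degree scale \<F>' S) < K * bd"
    unfolding light_def by blast
  have "real (subspace_degree scale \<F> S) \<le> real (subspace_degree scale \<F>' S)"
    unfolding subspace_degree_sum using point_degree_mono[OF sub] by (intro sum_mono) simp
  then show ?thesis using S sub unfolding light_def by (intro bexI[of _ S]) auto
qed

text \<open>T stands for M or Z. Since dim T <= k + 1 <= n - k, there are k-spaces meeting T in 0;
  they are non-members, and all their points have degree exactly \<open>bd\<close>.\<close>

definition extremal :: "'v set set \<Rightarrow> 'v set \<Rightarrow> bool" where
  "extremal \<F> T \<longleftrightarrow> subspace T \<and> dim T \<le> k + 1 \<and> \<F> \<subseteq> Gr scale k UNIV \<and>
    (\<forall>F\<in>\<F>. F \<inter> T \<noteq> {0}) \<and>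
    (\<forall>x\<in>pts UNIV. bd \<le> deg \<F> x) \<and>
    (\<forall>x\<in>pts UNIV. \<not> x \<subseteq> T \<longrightarrow> deg \<F> x = bd)"

lemma extremal_complement:
  assumes T: "extremal \<F> T" and A: "subspace A" "A \<inter> T = {0}" "dim A \<le> k"
  obtains S where "S \<in> Gr scale k UNIV - \<F>" "A \<subseteq> S" "\<And>x. x \<in> pts S \<Longrightarrow> deg \<F> x = bd"
proof -
  have sT: "subspace T" "k + dim T \<le> dim (UNIV :: 'v set)"
    using T n_ge dim_V by (auto simp: extremal_def)
  obtain S where S: "S \<in> Gr scale k UNIV" "A \<subseteq> S" "S \<inter> T = {0}"
    using exists_complementary[OF A(1) sT(1) A(2,3) sT(2)] by blast
  have "S \<notin> \<F>" using T S(3) unfolding extremal_def by blast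
  moreover have "deg \<F> x = bd" if x: "x \<in> pts S" for x
  proof -
    have "\<not> x \<subseteq> T"
    proof
      assume "x \<subseteq> T"
      then show False using Int_nonzeroI[OF ptsD(1)[OF x] ptsD(3)[OF x]] S(3) by blast
    qed
    then show ?thesis using T ptsD(1)[OF x] by (auto simp: extremal_def)
  qed
  ultimately show ?thesis using that S by blast
qed

lemma ore_extremal:
  assumes T: "extremal \<F> T"
  shows "real (ore_degree scale k \<F>) = K * bd"
proof -
  have card: "real (card (pts S)) = K" if "S \<in> Gr scale k UNIV" for S
    using that card_pts[of S] by (auto simp: Gr_iff)
  have sT: "subspace T" using T by (simp add: extremal_def)
  have z: "{0} \<inter> T = {0}" using subspace_0[OF sT] by auto
  obtain S where S: "S \<in> Gr scale k UNIV - \<F>" "\<And>x. x \<in> pts S \<Longrightarrow> deg \<F> x = bd"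
    using extremal_complement[OF T subspace_single_0 z] by auto
  have "real (subspace_degree scale \<F> S) = K * bd"
    unfolding subspace_degree_sum using S card[of S] by simp
  then have le: "real (ore_degree scale k \<F>) \<le> K * bd" using ore_le[OF S(1)] by simp
  let ?D = "{subspace_degree scale \<F> S | S. S \<in> Gr scale k UNIV - \<F>}"
  have "?D = subspace_degree scale \<F> ` (Gr scale k UNIV - \<F>)" by auto
  then have "finite ?D" "?D \<noteq> {}" using S(1) by auto
  then have "ore_degree scale k \<F> \<in> ?D" unfolding ore_degree_def by (rule Min_in)
  then obtain S' where S': "S' \<in> Gr scale k UNIV - \<F>" "ore_degree scale k \<F> = subspace_degree scale \<F> S'"
    by blast
  have "bd \<le> deg \<F> x" if "x \<in> pts S'" for x
    using T ptsD(1)[OF that] by (simp add: extremal_def)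
  then have "real (card (pts S')) * bd \<le> (\<Sum>x\<in>pts S'. deg \<F> x)"
    by (rule sum_bounded_below)
  then have "K * bd \<le> real (ore_degree scale k \<F>)"
    unfolding S'(2) subspace_degree_sum using card[of S'] S'(1) by simp
  with le show ?thesis by simp
qed

text \<open>S is taken through a point of G outside T and disjoint from T. In the large family all
  points of S have critical degree, and the loss of G lowers one of them.\<close>

lemma light_proper_subfamily:
  assumes T: "extremal \<F>' T" and sub: "\<F> \<subseteq> \<F>'" and G: "G \<in> \<F>'" "G \<notin> \<F>" "\<not> G \<subseteq> T"
  shows "light \<F>"
proof -
  have sG: "subspace G" and sT: "subspace T" using T G(1) by (auto simp: extremal_def Gr_iff)
  obtain v where v: "v \<in> G" "v \<notin> T" using G(3) by blast
  then have "v \<noteq> 0" using subspace_0[OF sT] by auto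
  then have x: "span {v} \<in> pts G" using point_span v sG by blast
  have "\<not> span {v} \<subseteq> T" using v(2) span_base[of v "{v}"] by auto
  then have "span {v} \<inter> T = {0}" using point_Int[OF ptsD(1)[OF x] sT] by simp
  moreover have "dim (span {v}) \<le> k" using ptsD(4)[OF x] k_ge_3 by linarith
  ultimately obtain S where S: "S \<in> Gr scale k UNIV - \<F>'" "span {v} \<subseteq> S"
      "\<And>x. x \<in> pts S \<Longrightarrow> deg \<F>' x = bd"
    using extremal_complement[OF T ptsD(2)[OF x]] by blast
  have xS: "span {v} \<in> pts S" using x S(2) by (auto simp: pts_iff)
  have "point_degree \<F> (span {v}) < point_degree \<F>' (span {v})"
    unfolding point_degree_def using sub G(1,2) ptsD(3)[OF x] by (intro psubset_card_mono) auto
  then have "(\<Sum>x\<in>pts S. deg \<F> x) < (\<Sum>x\<in>pts S. deg \<F>' x)"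
    using xS point_degree_mono[OF sub] by (intro sum_strict_mono_ex1) auto
  also have "\<dots> = K * bd" using S(1,3) card_pts[of S] by (simp add: Gr_iff)
  finally show ?thesis unfolding light_def subspace_degree_sum using S(1) sub by (intro bexI[of _ S]) auto
qed

section \<open>The two extremal families\<close>

lemma extremal_H1:
  assumes X: "X \<in> pts UNIV" and M: "M \<in> Gr scale (k + 1) UNIV" "X \<subset> M" and \<G>: "\<G> \<subseteq> Gr scale k M"
  shows "extremal (H1_open scale k X M \<union> \<G>) M"
proof -
  let ?F = "H1_open scale k X M \<union> \<G>"
  have sX: "subspace X" and dX: "dim X = 1" and sM: "subspace M" and dM: "dim M = k + 1"
    using X M by (auto simp: pts_iff Gr_iff)
  have sub: "?F \<subseteq> Gr scale k UNIV" using \<G> by (auto simp: H1_open_def Gr_iff)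
  have meets: "F \<inter> M \<noteq> {0}" if F: "F \<in> ?F" for F
  proof -
    have sF: "subspace F" using F sub by (auto simp: Gr_iff)
    have "dim (F \<inter> M) \<ge> 1"
    proof (cases "F \<in> \<G>")
      case True
      then have "F \<subseteq> M" "dim F = k" using \<G> by (auto simp: Gr_def)
      then have "F \<inter> M = F" "dim F = k" by auto
      then show ?thesis using k_ge_3 by simp
    next
      case False
      then show ?thesis using F by (auto simp: H1_open_def)
    qed
    then show ?thesis using dim_Int_pos[OF sF sM] by blast
  qed
  \<comment> \<open>Some two-space L of M contains both X and x, and every k-space through L not
    inside M belongs to \<open>H1_open\<close>.\<close>
  have inside: "bd \<le> deg ?F x" if x: "x \<in> pts M" for x
  proof -
    have "\<exists>L. subspace L \<and> dim L = 2 \<and> X \<subseteq> L \<and> x \<subseteq> L \<and> L \<subseteq> M"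
    proof (cases "x = X")
      case True
      obtain v where v: "v \<in> M" "v \<notin> X" using M(2) by blast
      have "dim (X \<squnion> {v}) = 2" using dim_insert[of v X] v(2) sX dX by simp
      moreover have "X \<squnion> {v} \<subseteq> M" using v M(2) sM by (intro join_least) auto
      ultimately show ?thesis using True join_ub(1)[of X "{v}"] by (intro exI[of _ "X \<squnion> {v}"]) auto
    next
      case False
      then have "\<not> x \<subseteq> X" using point_eq[OF x X] by blast
      then have "dim (X \<squnion> x) = 2" using dim_join_point[OF ptsD(1)[OF x] sX] dX by simp
      moreover have "X \<squnion> x \<subseteq> M" using ptsD(3)[OF x] M(2) sM by (intro join_least) auto
      ultimately show ?thesis using join_ub(1)[of X x] join_ub(2)[of x X]
        by (intro exI[of _ "X \<squnion> x"]) auto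
    qed
    then obtain L where L: "subspace L" "dim L = 2" "X \<subseteq> L" "x \<subseteq> L" "L \<subseteq> M" by blast
    define P where "P = {F \<in> Gr scale k UNIV. L \<subseteq> F}"
    define P' where "P' = {F \<in> Gr scale k M. L \<subseteq> F}"
    have "P - P' \<subseteq> {F \<in> ?F. x \<subseteq> F}"
    proof
      fix F assume "F \<in> P - P'"
      then have F: "F \<in> Gr scale k UNIV" "L \<subseteq> F" "\<not> F \<subseteq> M" by (auto simp: P_def P'_def Gr_iff)
      have "dim L \<le> dim (F \<inter> M)" using F L by (intro dim_subset) auto
      then show "F \<in> {F \<in> ?F. x \<subseteq> F}" using F L by (auto simp: H1_open_def)
    qed
    then have "card (P - P') \<le> point_degree ?F x" unfolding point_degree_def by (intro card_mono) auto
    moreover have "card (P - P') = card P - card P'" "card P' \<le> card P"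
      by (auto intro!: card_Diff_subset card_mono simp: P_def P'_def Gr_iff)
    moreover have "real (card P) = gauss q (n - 2) (k - 2)"
      using card_supersets[of L UNIV k] L k_ge_3 dim_V by (simp add: P_def)
    moreover have "real (card P') = gauss q (k - 1) (k - 2)"
      using card_supersets[OF L(1) sM L(5), of k] L(2) k_ge_3 dM by (simp add: P'_def)
    ultimately show ?thesis using bd_le_through_line by linarith
  qed
  \<comment> \<open>A k-space through x belongs to the family exactly when it contains L = x + X and
    meets Y = x + M in more than L; this is the difference in \<open>bd\<close>.\<close>
  have outside: "deg ?F x = bd" if x: "x \<in> pts UNIV" "\<not> x \<subseteq> M" for x
  proof -
    have sx: "subspace x" using ptsD(2)[OF x(1)] .
    define L where "L = x \<squnion> X"
    define Y where "Y = x \<squnion> M"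
    have xX: "\<not> X \<subseteq> x" using point_eq[OF X x(1)] x(2) M(2) by blast
    have dL: "dim L = 2" using dim_join_point[OF X sx xX] ptsD(4)[OF x(1)] by (simp add: L_def)
    have dY: "dim Y = k + 2" using dim_join_point[OF x(1) sM x(2)] dM by (simp add: Y_def Un_commute)
    have sLY: "subspace L" "subspace Y" by (auto simp: L_def Y_def)
    have LY: "L \<subseteq> Y" unfolding L_def Y_def using M(2) by (intro span_mono) auto
    define P where "P = {F \<in> Gr scale k UNIV. L \<subseteq> F}"
    have sub2: "between L Y UNIV k \<subseteq> P" by (auto simp: P_def between_def Gr_iff)
    have "{F \<in> ?F. x \<subseteq> F} = P - between L Y UNIV k"
    proof (intro set_eqI iffI)
      fix F assume "F \<in> {F \<in> ?F. x \<subseteq> F}"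
      then have F: "F \<in> ?F" "x \<subseteq> F" by auto
      have "F \<notin> \<G>"
      proof
        assume "F \<in> \<G>"
        then have "F \<subseteq> M" using \<G> by (auto simp: Gr_def)
        then show False using x(2) F(2) by blast
      qed
      then have F': "F \<in> Gr scale k UNIV" "X \<subseteq> F" "dim (F \<inter> M) \<ge> 2" using F by (auto simp: H1_open_def)
      have sF: "subspace F" "subspace (F \<inter> M)" using F' sM by (auto simp: Gr_iff intro: subspace_inter)
      have "L \<subseteq> F" unfolding L_def using F(2) F'(2) sF(1) by (intro join_least)
      moreover have "F \<inter> Y \<noteq> L"
      proof
        assume e: "F \<inter> Y = L"
        have "\<not> x \<subseteq> F \<inter> M" using x(2) by blast
        then have "dim ((F \<inter> M) \<squnion> x) \<ge> 3" using dim_join_point[OF x(1) sF(2)] F'(3) by simp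
        moreover have "(F \<inter> M) \<squnion> x \<subseteq> F \<inter> Y"
        proof (rule join_least)
          show "F \<inter> M \<subseteq> F \<inter> Y" using join_ub(2)[of M x] by (auto simp: Y_def)
          show "x \<subseteq> F \<inter> Y" using F(2) join_ub(1)[of x M] by (auto simp: Y_def)
          show "subspace (F \<inter> Y)" using sF(1) sLY(2) subspace_inter by blast
        qed
        then have "dim ((F \<inter> M) \<squnion> x) \<le> dim L" unfolding e by (rule dim_subset)
        ultimately show False using dL by simp
      qed
      ultimately show "F \<in> P - between L Y UNIV k" using F'(1) by (auto simp: P_def between_def)
    next
      fix F assume "F \<in> P - between L Y UNIV k"
      then have F: "F \<in> Gr scale k UNIV" "L \<subseteq> F" "F \<inter> Y \<noteq> L" by (auto simp: P_def between_def Gr_iff)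
      have sF: "subspace F" "subspace (F \<inter> M)" using F sM by (auto simp: Gr_iff intro: subspace_inter)
      have xF: "x \<subseteq> F" "X \<subseteq> F" using F(2) join_ub(1)[of x X] join_ub(2)[of X x] by (auto simp: L_def)
      have "dim (F \<inter> M) \<ge> 2"
      proof (rule ccontr)
        assume "\<not> ?thesis"
        then have "X = F \<inter> M" using xF M(2) dX by (intro subspace_eqI[OF sX sF(2)]) auto
        then have "x \<squnion> (M \<inter> F) = L" by (simp add: L_def Int_commute)
        then have "Y \<inter> F = L" using modular[OF sx sM sF(1) xF(1)] by (simp add: Y_def)
        then show False using F(3) by (simp add: Int_commute)
      qed
      moreover have "\<not> F \<subseteq> M" using xF x(2) by blast
      ultimately show "F \<in> {F \<in> ?F. x \<subseteq> F}" using F(1) xF by (auto simp: H1_open_def)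
    qed
    then have "point_degree ?F x = card P - card (between L Y UNIV k)"
      unfolding point_degree_def using sub2 by (simp add: card_Diff_subset)
    moreover have "card (between L Y UNIV k) \<le> card P" using sub2 by (simp add: card_mono)
    moreover have "real (card P) = gauss q (n - 2) (k - 2)"
      using card_supersets[of L UNIV k] sLY dL k_ge_3 dim_V by (simp add: P_def)
    moreover have "real (card (between L Y UNIV k)) = Q ^ (k * (k - 2)) * gauss q (n - k - 2) (k - 2)"
      using card_between[OF sLY(1,2) subspace_UNIV LY, of k] dL dY k_ge_3 dim_V by simp
    ultimately show ?thesis by (simp add: bd_def of_nat_diff)
  qed
  have "bd \<le> deg ?F x" if "x \<in> pts UNIV" for x
    using inside[of x] outside[of x] that by (cases "x \<subseteq> M") (auto simp: pts_iff)
  then show ?thesis unfolding extremal_def using sM dM sub meets outside by simp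
qed

lemma extremal_H3:
  assumes k3: "k = 3" and Z: "Z \<in> Gr scale 3 UNIV" and \<F>: "\<F> = H3 scale Z \<or> \<F> = H3 scale Z - {Z}"
  shows "extremal \<F> Z"
proof -
  have sZ: "subspace Z" and dZ: "dim Z = 3" using Z by (auto simp: Gr_iff)
  have bd: "bd = qint q 3" using bd_k3[OF k3] k3 by simp
  have mem: "F \<in> \<F> \<Longrightarrow> F \<in> Gr scale 3 UNIV \<and> dim (F \<inter> Z) \<ge> 2" for F
    using \<F> by (auto simp: H3_def)
  have mem': "F \<in> Gr scale 3 UNIV \<Longrightarrow> dim (F \<inter> Z) \<ge> 2 \<Longrightarrow> F \<noteq> Z \<Longrightarrow> F \<in> \<F>" for F
    using \<F> by (auto simp: H3_def)
  have meets: "F \<inter> Z \<noteq> {0}" if F: "F \<in> \<F>" for F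
    using mem[OF F] dim_Int_pos[of F Z] sZ by (auto simp: Gr_iff)
  \<comment> \<open>For a two-space L of Z through x, all three-spaces through L are members, with
    the possible exception of Z.\<close>
  have inside: "bd \<le> deg \<F> x" if x: "x \<in> pts Z" for x
  proof -
    have "\<not> Z \<subseteq> x" using dim_subset[of Z x] ptsD(4)[OF x] dZ by auto
    then obtain v where v: "v \<in> Z" "v \<notin> x" by blast
    define L where "L = x \<squnion> {v}"
    have dL: "dim L = 2" using dim_insert[of v x] v(2) ptsD(2,4)[OF x] by (simp add: L_def)
    have LZ: "L \<subseteq> Z" unfolding L_def using v(1) ptsD(3)[OF x] sZ by (intro join_least) auto
    have sL: "subspace L" by (simp add: L_def)
    have xL: "x \<subseteq> L" unfolding L_def by (rule join_ub)
    define P where "P = {F \<in> Gr scale 3 UNIV. L \<subseteq> F}"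
    have "P - {Z} \<subseteq> {F \<in> \<F>. x \<subseteq> F}"
    proof
      fix F assume "F \<in> P - {Z}"
      then have F: "F \<in> Gr scale 3 UNIV" "L \<subseteq> F" "F \<noteq> Z" by (auto simp: P_def)
      have "dim L \<le> dim (F \<inter> Z)" using F LZ by (intro dim_subset) auto
      then show "F \<in> {F \<in> \<F>. x \<subseteq> F}" using mem'[OF F(1) _ F(3)] dL xL F(2) by auto
    qed
    then have "card (P - {Z}) \<le> point_degree \<F> x" unfolding point_degree_def by (intro card_mono) auto
    \<comment> \<open>The family may lack Z; the surplus of [4] over [3] makes up for this one
      member.\<close>
    moreover have "card P \<le> card (P - {Z}) + 1"
      using card_Diff1_le[of P Z] card_Diff_singleton_if[of P Z] by (simp split: if_splits)
    moreover have "real (card P) = qint q (n - 2)"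
      using card_supersets[of L UNIV 3] sL dL dim_V gauss_1[of q "n - 2"] by (simp add: P_def)
    moreover have "qint q 4 \<le> qint q (n - 2)" using n_ge k3 by (intro qint_mono[OF q2]) auto
    moreover have "qint q 4 \<ge> qint q 3 + 1"
    proof -
      have "1 * qint q 3 \<le> Q * qint q 3"
        using Q2 qint_nonneg[OF q2, of 3] by (intro mult_right_mono) auto
      then show ?thesis using qint_Suc[OF q2, of 3] by simp
    qed
    ultimately show ?thesis unfolding bd by linarith
  qed
  have outside: "deg \<F> x = bd" if x: "x \<in> pts UNIV" "\<not> x \<subseteq> Z" for x
  proof -
    have sx: "subspace x" using ptsD(2)[OF x(1)] .
    have xZ: "x \<inter> Z = {0}" using point_Int[OF x(1) sZ] x(2) by simp
    have cut: "(l \<squnion> x) \<inter> Z = l" if l: "l \<in> Gr scale 2 Z" for l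
    proof -
      have sl: "subspace l" "l \<subseteq> Z" using l by (auto simp: Gr_iff)
      have "(l \<squnion> x) \<inter> Z = l \<squnion> (x \<inter> Z)" using modular[OF sl(1) sx sZ sl(2)] .
      also have "\<dots> = l" unfolding xZ using sl(1) subspace_0[OF sl(1)] by (simp add: Un_absorb2)
      finally show ?thesis .
    qed
    \<comment> \<open>For members through x the inverse map is F \<mapsto> F \<inter> Z. Whether Z
      itself belongs to the family is irrelevant because Z does not contain x.\<close>
    have "bij_betw (\<lambda>l. l \<squnion> x) (Gr scale 2 Z) {F \<in> \<F>. x \<subseteq> F}"
    proof (rule bij_betw_imageI)
      show "inj_on (\<lambda>l. l \<squnion> x) (Gr scale 2 Z)"
        by (rule inj_on_inverseI[where g = "\<lambda>F. F \<inter> Z"]) (rule cut)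
      show "(\<lambda>l. l \<squnion> x) ` Gr scale 2 Z = {F \<in> \<F>. x \<subseteq> F}"
      proof (intro set_eqI iffI)
        fix F assume "F \<in> (\<lambda>l. l \<squnion> x) ` Gr scale 2 Z"
        then obtain l where l: "l \<in> Gr scale 2 Z" "F = l \<squnion> x" by blast
        then have l': "subspace l" "l \<subseteq> Z" "dim l = 2" by (auto simp: Gr_iff)
        have "\<not> x \<subseteq> l" using l'(2) x(2) by blast
        then have "dim F = 3" using dim_join_point[OF x(1) l'(1)] l'(3) l(2) by simp
        then have "F \<in> Gr scale 3 UNIV" using l(2) by (simp add: Gr_iff)
        moreover have "dim (F \<inter> Z) \<ge> 2" using cut[OF l(1)] l'(3) l(2) by simp
        moreover have xF: "x \<subseteq> F" unfolding l(2) by (rule join_ub)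
        moreover have "F \<noteq> Z" using xF x(2) by blast
        ultimately show "F \<in> {F \<in> \<F>. x \<subseteq> F}" using mem' by blast
      next
        fix F assume "F \<in> {F \<in> \<F>. x \<subseteq> F}"
        then have F: "F \<in> \<F>" "x \<subseteq> F" by auto
        have F3: "subspace F" "dim F = 3" "dim (F \<inter> Z) \<ge> 2" using mem[OF F(1)] by (auto simp: Gr_iff)
        have sFZ: "subspace (F \<inter> Z)" using F3 sZ subspace_inter by blast
        have nx: "\<not> x \<subseteq> F \<inter> Z" using x(2) by blast
        have d: "dim ((F \<inter> Z) \<squnion> x) = Suc (dim (F \<inter> Z))" using dim_join_point[OF x(1) sFZ nx] .
        have le: "(F \<inter> Z) \<squnion> x \<subseteq> F" using F(2) F3(1) by (intro join_least) auto
        have "Suc (dim (F \<inter> Z)) \<le> 3" using dim_subset[OF le] d F3(2) by simp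
        then have "F \<inter> Z \<in> Gr scale 2 Z" using F3(3) sFZ by (simp add: Gr_iff)
        moreover have "(F \<inter> Z) \<squnion> x = F"
          using d F3 le by (intro subspace_eqI) auto
        ultimately show "F \<in> (\<lambda>l. l \<squnion> x) ` Gr scale 2 Z" by (intro image_eqI[of _ _ "F \<inter> Z"]) auto
      qed
    qed
    then have "point_degree \<F> x = card (Gr scale 2 Z)"
      unfolding point_degree_def by (simp add: bij_betw_same_card)
    also have "real \<dots> = qint q 3"
      using card_Gr[OF sZ, of 2] dZ gauss_Suc_self[OF q2, of 2] by (simp add: eval_nat_numeral)
    finally show ?thesis unfolding bd .
  qed
  have "bd \<le> deg \<F> x" if "x \<in> pts UNIV" for x
    using inside[of x] outside[of x] that by (cases "x \<subseteq> Z") (auto simp: pts_iff)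
  moreover have "\<F> \<subseteq> Gr scale k UNIV" using mem k3 by blast
  ultimately show ?thesis unfolding extremal_def using sZ dZ k3 meets outside by simp
qed

section \<open>Assembling the theorem\<close>

lemma exists_maximal_extension:
  assumes \<F>: "\<F> \<subseteq> Gr scale k UNIV" "\<And>F F'. F \<in> \<F> \<Longrightarrow> F' \<in> \<F> \<Longrightarrow> F \<inter> F' \<noteq> {0}"
    and no_center: "\<And>x. x \<in> pts UNIV \<Longrightarrow> \<exists>F\<in>\<F>. \<not> x \<subseteq> F"
  obtains \<F>' where "\<F> \<subseteq> \<F>'" "maximal_family scale q k n \<F>'"
proof -
  define I where "I = {\<G>. \<F> \<subseteq> \<G> \<and> \<G> \<subseteq> Gr scale k UNIV \<and> (\<forall>F\<in>\<G>. \<forall>F'\<in>\<G>. F \<inter> F' \<noteq> {0})}"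
  have "I \<subseteq> Pow (Gr scale k UNIV)" by (auto simp: I_def)
  then have "finite I" by (rule finite_subset) simp
  moreover have "\<F> \<in> I" using \<F> unfolding I_def by blast
  ultimately obtain \<F>' where m: "\<F>' \<in> I" "\<And>\<G>. \<G> \<in> I \<Longrightarrow> \<F>' \<subseteq> \<G> \<Longrightarrow> \<F>' = \<G>"
    using finite_has_maximal[of I] by blast
  have F': "\<F> \<subseteq> \<F>'" "\<F>' \<subseteq> Gr scale k UNIV" "\<And>F G. F \<in> \<F>' \<Longrightarrow> G \<in> \<F>' \<Longrightarrow> F \<inter> G \<noteq> {0}"
    using m(1) unfolding I_def by blast+
  have "maximal_family scale q k n \<F>'"
  proof unfold_locales
    show "\<F>' \<subseteq> Gr scale k UNIV" by (rule F')
    show "F \<inter> G \<noteq> {0}" if "F \<in> \<F>'" "G \<in> \<F>'" for F G using F'(3) that .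
    show "\<exists>F\<in>\<F>'. \<not> x \<subseteq> F" if "x \<in> pts UNIV" for x using no_center[OF that] F'(1) by blast
    fix G assume G: "G \<in> Gr scale k UNIV" "\<And>F. F \<in> \<F>' \<Longrightarrow> G \<inter> F \<noteq> {0}"
    \<comment> \<open>Intersecting includes each member with itself, so adding G requires G to be
      nonzero.\<close>
    have "G \<noteq> {0}" using G(1) k_ge_3 by (auto simp: Gr_iff)
    then have GG: "G \<inter> G \<noteq> {0}" by simp
    have "A \<inter> B \<noteq> {0}" if "A \<in> insert G \<F>'" "B \<in> insert G \<F>'" for A B
    proof (cases "A = G")
      case True
      then show ?thesis using that(2) G(2) GG by (cases "B = G") auto
    next
      case False
      then have A: "A \<in> \<F>'" using that by simp
      show ?thesis
      proof (cases "B = G")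
        case True
        then show ?thesis using G(2)[OF A] by (metis Int_commute)
      next
        case False
        then show ?thesis using F'(3)[OF A] that(2) by simp
      qed
    qed
    then have "insert G \<F>' \<in> I" using F' G(1) unfolding I_def by blast
    then show "G \<in> \<F>'" using m(2) by blast
  qed
  then show ?thesis using that F'(1) by blast
qed

theorem ore_degree_bound:
  assumes \<F>: "\<F> \<subseteq> Gr scale k UNIV" "\<And>F F'. F \<in> \<F> \<Longrightarrow> F' \<in> \<F> \<Longrightarrow> F \<inter> F' \<noteq> {0}"
    and no_center: "\<And>x. x \<in> pts UNIV \<Longrightarrow> \<exists>F\<in>\<F>. \<not> x \<subseteq> F"
  shows "real (ore_degree scale k \<F>) \<le> K * bd \<and>
    (real (ore_degree scale k \<F>) = K * bd \<longleftrightarrow>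
      (\<exists>X M \<G>. X \<in> Gr scale 1 UNIV \<and> M \<in> Gr scale (k + 1) UNIV \<and> X \<subset> M
        \<and> \<G> \<subseteq> Gr scale k M \<and> (\<exists>G\<in>\<G>. \<not> X \<subseteq> G) \<and> \<F> = H1_open scale k X M \<union> \<G>)
      \<or> (k = 3 \<and> (\<exists>Z\<in>Gr scale 3 UNIV. \<F> = H3 scale Z \<or> \<F> = H3 scale Z - {Z})))"
    (is "?le \<and> (?eq \<longleftrightarrow> ?H1 \<or> ?H3)")
proof -
  have H: "?eq" if "?H1 \<or> ?H3"
    using that
  proof
    assume "?H1"
    then obtain X M \<G> where "X \<in> pts UNIV" "M \<in> Gr scale (k + 1) UNIV" "X \<subset> M" "\<G> \<subseteq> Gr scale k M"
      "\<F> = H1_open scale k X M \<union> \<G>" unfolding pts_def by blast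
    then show ?thesis using ore_extremal[OF extremal_H1] by simp
  next
    assume "?H3"
    then show ?thesis using ore_extremal[OF extremal_H3] by blast
  qed
  have "light \<F> \<or> ?H1 \<or> ?H3"
  proof -
    obtain \<F>' where sub: "\<F> \<subseteq> \<F>'" and max: "maximal_family scale q k n \<F>'"
      using exists_maximal_extension[OF \<F> no_center] by blast
    interpret m: maximal_family scale q k n \<F>' by (rule max)
    consider (light) "light \<F>'"
      | (H1) X M where "X \<in> Gr scale 1 UNIV" "M \<in> Gr scale (k + 1) UNIV" "X \<subset> M" "\<F>' = m.H1_full X M"
      | (H3) Z where "k = 3" "Z \<in> Gr scale 3 UNIV" "\<F>' = H3 scale Z"
      using m.maximal_family_cases by blast
    then show ?thesis
    proof cases
      case light
      then show ?thesis using light_mono[OF sub] by blast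
    next
      case H1
      have X: "X \<in> pts UNIV" using H1(1) by (simp add: pts_def)
      have F': "\<F>' = H1_open scale k X M \<union> Gr scale k M" using H1(4) by (simp add: m.H1_full_def)
      show ?thesis
      proof (cases "H1_open scale k X M \<subseteq> \<F>")
        case True
        \<comment> \<open>All members of \<open>H1_open\<close> contain X, so nontriviality provides
          the required member of Gr(k, M) that does not.\<close>
        obtain G where G: "G \<in> \<F>" "\<not> X \<subseteq> G" using no_center[OF X] by blast
        then have "G \<in> Gr scale k M" using sub F' by (auto simp: H1_open_def)
        moreover have "\<F> = H1_open scale k X M \<union> (\<F> \<inter> Gr scale k M)" using True sub F' by blast
        ultimately have ?H1 using H1(1-3) G by (intro exI[of _ X] exI[of _ M] exI[of _ "\<F> \<inter> Gr scale k M"]) blast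
        then show ?thesis by blast
      next
        case False
        then obtain G where G: "G \<in> H1_open scale k X M" "G \<notin> \<F>" by blast
        have "extremal \<F>' M" unfolding F' using extremal_H1[OF X H1(2,3) order_refl] .
        moreover have "G \<in> \<F>'" "\<not> G \<subseteq> M" using G F' by (auto simp: H1_open_def)
        ultimately show ?thesis using light_proper_subfamily[OF _ sub _ G(2)] by blast
      qed
    next
      case H3
      show ?thesis
      proof (cases "H3 scale Z - {Z} \<subseteq> \<F>")
        case True
        then have "\<F> = H3 scale Z \<or> \<F> = H3 scale Z - {Z}" using sub H3(3) by blast
        then show ?thesis using H3 by blast
      next
        case False
        then obtain G where G: "G \<in> H3 scale Z" "G \<noteq> Z" "G \<notin> \<F>" by blast
        have "\<not> G \<subseteq> Z"
        proof
          assume "G \<subseteq> Z"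
          then have "G = Z" using G(1) H3(2) by (intro subspace_eqI) (auto simp: H3_def Gr_iff)
          then show False using G(2) by simp
        qed
        moreover have "extremal \<F>' Z" using extremal_H3[OF H3(1,2)] H3(3) by blast
        ultimately show ?thesis using light_proper_subfamily[OF _ sub _ G(3)] G(1) H3(3) by blast
      qed
    qed
  qed
  then show ?thesis
  proof
    assume "light \<F>"
    then have "real (ore_degree scale k \<F>) < K * bd" by (rule ore_light)
    then have "?le" "\<not> ?eq" by linarith+
    then show ?thesis using H by blast
  next
    assume "?H1 \<or> ?H3"
    then show ?thesis using H by simp
  qed
qed

end

lemma (in vector_space) finite_span:
  assumes "finite (UNIV :: 'a set)" "finite B"
  shows "finite (span B)"
  using assms(2)
proof (induction B rule: finite_induct)
  case (insert b B)
  have "span (insert b B) \<subseteq> (\<lambda>(c, x). scale c b + x) ` (UNIV \<times> span B)"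
  proof
    fix v assume "v \<in> span (insert b B)"
    then obtain c where "v - scale c b \<in> span B" unfolding span_breakdown_eq[of v] by blast
    then show "v \<in> (\<lambda>(c, x). scale c b + x) ` (UNIV \<times> span B)"
      by (intro image_eqI[of _ _ "(c, v - scale c b)"]) auto
  qed
  then show ?case using finite_subset insert.IH assms(1) by blast
qed simp

text \<open>An infinite basis has cardinality 0 by convention, so positive dimension forces a finite
  basis; over a finite field its span is finite.\<close>

lemma (in vector_space) finite_UNIV_of_dim_pos:
  assumes "finite (UNIV :: 'a set)" "dim (UNIV :: 'b set) > 0"
  shows "finite (UNIV :: 'b set)"
proof -
  obtain B where B: "independent B" "span B = UNIV"
    using maximal_independent_subset[of UNIV] by (metis top.extremum_uniqueI)
  have "card B = dim (UNIV :: 'b set)" using dim_eq_card[of B UNIV] B by simp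
  then have "finite B" using assms(2) card_ge_0_finite by metis
  then show ?thesis using finite_span[OF assms(1)] B(2) by metis
qed

theorem theorem1p2:
  fixes scale :: "'f::{field,finite} \<Rightarrow> 'v::ab_group_add \<Rightarrow> 'v"
    and q k n :: nat
    and \<F> :: "'v set set"
  assumes V: "vector_space scale" "vector_space.dim scale (UNIV :: 'v set) = n"
    and q: "primepow q" "card (UNIV :: 'f set) = q"
    and k: "k \<ge> 3"
    and qn: "(q \<ge> 3 \<and> n \<ge> 2 * k + 1) \<or> (q \<ge> 2 \<and> n \<ge> 2 * k + 2)"
    and family: "\<F> \<subseteq> Gr scale k UNIV"
    and intersecting: "intersecting scale \<F>"
    and nontrivial: "\<not> trivial_family scale \<F>"
  shows "real (ore_degree scale k \<F>)
      \<le> gauss_binomial q k 1 *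
          (gauss_binomial q (n - 2) (k - 2)
            - real q ^ (k * (k - 2)) * gauss_binomial q (n - k - 2) (k - 2))
    \<and> (real (ore_degree scale k \<F>)
      = gauss_binomial q k 1 *
          (gauss_binomial q (n - 2) (k - 2)
            - real q ^ (k * (k - 2)) * gauss_binomial q (n - k - 2) (k - 2))
      \<longleftrightarrow>
        (\<exists>X M \<G>. X \<in> Gr scale 1 UNIV \<and> M \<in> Gr scale (k + 1) UNIV \<and> X \<subset> M
            \<and> \<G> \<subseteq> Gr scale k M \<and> (\<exists>G\<in>\<G>. \<not> X \<subseteq> G)
            \<and> \<F> = H1_open scale k X M \<union> \<G>)
        \<or> (k = 3 \<and> (\<exists>Z\<in>Gr scale 3 UNIV. \<F> = H3 scale Z \<or> \<F> = H3 scale Z - {Z})))"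
proof -
  interpret vs: vector_space scale by (rule V)
  have "vs.dim (UNIV :: 'v set) > 0" using V(2) qn by auto
  then have fin: "finite (UNIV :: 'v set)" by (intro vs.finite_UNIV_of_dim_pos) simp
  interpret erdos_space scale q k n
    by unfold_locales (use fin q k qn V in auto)
  have "F \<inter> F' \<noteq> {0}" if "F \<in> \<F>" "F' \<in> \<F>" for F F'
  proof -
    have "vs.dim (F \<inter> F') \<ge> 1" using intersecting that by (simp add: intersecting_def)
    moreover have "vs.subspace F" "vs.subspace F'" using family that by (auto simp: Gr_def)
    ultimately show ?thesis using dim_Int_pos[of F F'] by blast
  qed
  moreover have "\<exists>F\<in>\<F>. \<not> x \<subseteq> F" if "x \<in> pts UNIV" for x
    using nontrivial that unfolding trivial_family_def pts_def by blast
  ultimately show ?thesis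
    using ore_degree_bound[OF family] unfolding bd_def gauss_1 by blast
qed

end
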